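(* Let $q>1$ be an integer, let $\chi:\mathbb{Z}\to\mathbb{C}$ be a non-principal Dirichlet character of modulus $q$, and let $L(\cdot,\chi)$ be its Dirichlet $L$-function. Let $$E(\chi):=\Big\{n\in\mathbb{Z}:\ \sum_{l=1}^{q-1}\chi(l)e^{2\pi i nl/q}=0\Big\}.$$ Let $s\in\mathbb{C}$ with $\mathrm{Re}\,s\in(0,\infty)$, $\mathrm{Re}\,s\neq2,4,\ldots$, and $s\notin\mathbb{N}$, and put $m_1:=\lfloor(\mathrm{Re}\,s)/2\rfloor$. Then the following statements hold. (a) The function $$\gamma_{s,q}(y):=-\sin y\Bigg(q^s\sum_{j=1}^{m_1}(-1)^{j-1}\Gamma(s-2j)\,L(s-2j,\chi)(2y)^{2j}+\frac{\pi2^sy^{2(m_1+1)}}{\sin(\pi s)}\sum_{n\in\mathbb{N}\setminus E(\chi)}\frac{(\pi n)^{s-2m_1-1}\sum_{l=1}^{q-1}\chi(l)\sin[2\pi nl/q+\pi s/2]}{y^2-(\pi n)^2}\Bigg)$$ is the only entire function of exponential type $1$ that interpolates the function $$\varphi_{s,q}(y):=-\pi2^{s-2}\left(\frac{|y|^s\sum_{l=1}^{q-1}\chi(l)\sin[(2l/q-1)y]}{\sin(\pi s/2)}+\frac{|y|^s\,\mathrm{sgn}(y)\sum_{l=1}^{q-1}\chi(l)\cos[(2l/q-1)y]}{\cos(\pi s/2)}\right)$$ at the nodes $\{\pi n\}_{n\in\mathbb{Z}}$ and satisfies the following conditions: (C1* ) $\varphi_{s,q}-\gamma_{s,q}\in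 L_\infty(\mathbb{R})$ and (C2* ) $\gamma_{s,q}'(0)=0$. (b) In addition to (a), $$\varphi_{s,q}(\pi n)=\gamma_{s,q}(\pi n)=\begin{cases}0,& n\in E(\chi),\\[2pt] -\dfrac{\pi2^{s-1}(-1)^n[\pi|n|]^s}{\sin(\pi s)}\displaystyle\sum_{l=1}^{q-1}\chi(l)\sin\big[2\pi nl/q+(\pi s/2)\,\mathrm{sgn}\,n\big],&|n|\ge1,\ n\in\mathbb{Z}\setminus E(\chi).\end{cases}$$ (c) The limit equality $$L(s,\chi)=\frac{1}{q^s\Gamma(s)}\lim_{|y|\to\infty}\frac{\varphi_{s,q}(y)-\gamma_{s,q}(y)}{\sin y}$$ is valid.
   Context: $\mathbb{N}=\{1,2,\ldots\}$. For a non-principal $\chi$, $L(s,\chi)=\sum_{l=1}^\infty\chi(l)l^{-s}$ converges for $\mathrm{Re}\,s>0$ and extends to an entire function. Since $\sum_{l=1}^{q-1}\chi(l)=0$, one has $0\in E(\chi)$. An entire function $g:\mathbb{C}\to\mathbb{C}$ has exponential type $\sigma$ if for every $\varepsilon>0$ there is a constant $C>0$ with $|g(z)|\le C\exp((\sigma+\varepsilon)|z|)$ for all $z\in\mathbb{C}$. An entire function is identified with its restriction to $\mathbb{R}$. Conventions: complex powers of positive reals are principal, $0^s=0$ when $\mathrm{Re}\,s>0$; in the definition of $\gamma_{s,q}$ the factor $\sin y$ multiplies each term of the series, and at $y=\pm\pi n$ the product $\sin y/(y^2-(\pi n)^2)$ is understood by continuity; an empty sum is zero. In the limit in (c), $y$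 runs over real numbers with $\sin y\neq0$.
   Formalization: In the finite sum defining γ_{s,q}, the common factor q^s is replaced by q^{s-2j} in the j-th term; with q^s, (C1* ) and (c) fail, e.g. for q=3, s=4.7. Nothing changes for Re s<2. *)

theory Defs
  imports "HOL-Complex_Analysis.Complex_Analysis"
begin

definition dirichlet_character :: "nat \<Rightarrow> (int \<Rightarrow> complex) \<Rightarrow> bool" where
  "dirichlet_character q chi \<longleftrightarrow>
     (\<forall>m n. chi (m * n) = chi m * chi n) \<and>
     (\<forall>n. chi (n + int q) = chi n) \<and>
     (\<forall>n. chi n \<noteq> 0 \<longleftrightarrow> coprime n (int q))"

definition principal_character :: "nat \<Rightarrow> (int \<Rightarrow> complex) \<Rightarrow> bool" where
  "principal_character q chi \<longleftrightarrow> (\<forall>n. chi n = (if coprime n (int q) then 1 else 0))"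

definition dirichlet_series :: "(int \<Rightarrow> complex) \<Rightarrow> complex \<Rightarrow> complex" where
  "dirichlet_series chi s = (\<Sum>l. chi (int (Suc l)) * of_nat (Suc l) powr (- s))"

(* For a non-principal character the series converges (conditionally when Re s \<le> 1) on the
   right half-plane; elsewhere L is given by the unique entire function extending it. *)
definition dirichlet_L :: "(int \<Rightarrow> complex) \<Rightarrow> complex \<Rightarrow> complex" where
  "dirichlet_L chi s =
     (if Re s > 0 then dirichlet_series chi s
      else (THE f. f holomorphic_on UNIV \<and> (\<forall>z. Re z > 0 \<longrightarrow> f z = dirichlet_series chi z)) s)"

definition E_set :: "nat \<Rightarrow> (int \<Rightarrow> complex) \<Rightarrow> int set" where
  "E_set q chi =
     {n. (\<Sum>l = 1..q - 1. chi (int l) * exp (2 * of_real pi * \<i> * of_int n * of_nat l / of_nat q)) = 0}"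

definition exponential_type :: "real \<Rightarrow> (complex \<Rightarrow> complex) \<Rightarrow> bool" where
  "exponential_type \<sigma> g \<longleftrightarrow>
     (\<forall>\<epsilon>>0. \<exists>C>0. \<forall>z. norm (g z) \<le> C * exp ((\<sigma> + \<epsilon>) * norm z))"

definition in_L_infinity :: "(real \<Rightarrow> complex) \<Rightarrow> bool" where
  "in_L_infinity f \<longleftrightarrow>
     f \<in> borel_measurable lebesgue \<and> (\<exists>C. AE y in lebesgue. norm (f y) \<le> C)"

definition m1 :: "complex \<Rightarrow> nat" where
  "m1 s = nat \<lfloor>Re s / 2\<rfloor>"

(* sin y / (y^2 - (pi n)^2), with its value at y = pi n and y = - pi n given by continuity. *)
definition sin_quotient :: "nat \<Rightarrow> complex \<Rightarrow> complex" where
  "sin_quotient n y =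
     (let f = (\<lambda>z. sin z / (z\<^sup>2 - (of_real pi * of_nat n)\<^sup>2))
      in if y\<^sup>2 = (of_real pi * of_nat n)\<^sup>2 then Lim (at y) f else f y)"

(* CORRECTION: the printed formula has q^s in front of the finite sum; here the j-th term carries
   q^(s - 2 j) instead (no difference if Re s < 2, where the finite sum is empty).  For Re z > 0,
     2^(z-1) * (integral over u > 0 of u^(z-1) * (SUM l. chi(l) exp ((1 - 2 l / q) u)) / sinh u)
       = q^z * Gamma(z) * L(z, chi),
   and the finite sum collects these moments at z = s - 2 j.  The printed version differs from
   this one by sin y times a polynomial without constant term, which is not zero e.g. for
   Re s > 3 (as L(s - 2, chi) is nonzero); so phi - gamma would be unbounded on the real line.
   The infinite series converges absolutely, since Re s - 2 m1 - 1 < 1. *)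
definition gamma_fun :: "complex \<Rightarrow> nat \<Rightarrow> (int \<Rightarrow> complex) \<Rightarrow> complex \<Rightarrow> complex" where
  "gamma_fun s q chi y =
     - (sin y * (\<Sum>j = 1..m1 s. (- 1) ^ (j - 1) * of_nat q powr (s - 2 * of_nat j) *
           Gamma (s - 2 * of_nat j) * dirichlet_L chi (s - 2 * of_nat j) * (2 * y) ^ (2 * j))
        + of_real pi * 2 powr s * y ^ (2 * (m1 s + 1)) / sin (of_real pi * s) *
          (\<Sum>\<^sub>\<infinity>n\<in>{n::nat. 1 \<le> n \<and> int n \<notin> E_set q chi}.
             (of_real pi * of_nat n) powr (s - 2 * of_nat (m1 s) - 1) *
             (\<Sum>l = 1..q - 1. chi (int l) *
                sin (2 * of_real pi * of_nat n * of_nat l / of_nat q + of_real pi * s / 2)) *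
             sin_quotient n y))"

definition phi_fun :: "complex \<Rightarrow> nat \<Rightarrow> (int \<Rightarrow> complex) \<Rightarrow> real \<Rightarrow> complex" where
  "phi_fun s q chi y =
     - of_real pi * 2 powr (s - 2) *
     (of_real \<bar>y\<bar> powr s *
        (\<Sum>l = 1..q - 1. chi (int l) * of_real (sin ((2 * real l / real q - 1) * y))) /
        sin (of_real pi * s / 2)
      + of_real \<bar>y\<bar> powr s * of_real (sgn y) *
        (\<Sum>l = 1..q - 1. chi (int l) * of_real (cos ((2 * real l / real q - 1) * y))) /
        cos (of_real pi * s / 2))"

definition admissible_interpolant ::
  "complex \<Rightarrow> nat \<Rightarrow> (int \<Rightarrow> complex) \<Rightarrow> (complex \<Rightarrow> complex) \<Rightarrow> bool" where
  "admissible_interpolant s q chi g \<longleftrightarrow>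
     g holomorphic_on UNIV \<and> exponential_type 1 g \<and>
     (\<forall>n::int. g (of_real (pi * of_int n)) = phi_fun s q chi (pi * of_int n)) \<and>
     in_L_infinity (\<lambda>y. phi_fun s q chi y - g (of_real y)) \<and>
     deriv g 0 = 0"

end

theory Submission
  imports Defs "HOL-Real_Asymp.Real_Asymp"
begin

text \<open>
  The kernel \<open>K u = (\<Sum>l. \<chi> l * exp ((1 - 2 l / q) u)) / sinh u\<close> decays exponentially and is
  bounded at \<open>0\<close> because \<open>\<chi>\<close> sums to zero, and expanding \<open>1 / sinh\<close> geometrically shows
  \<open>2^(z - 1) * \<integral> u^(z - 1) K u = q^z \<Gamma>(z) L(z, \<chi>)\<close> on the half-line, for \<open>Re z > 0\<close>. The key identity is
  \<open>\<phi> y - \<gamma> y = sin y * I y\<close> with \<open>I y = 2^(s - 1) * \<integral> u^(s - 1) K u * y^2 / (y^2 + u^2)\<close>: the first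
  \<open>m1 s\<close> terms of the geometric expansion of \<open>y^2 / (y^2 + u^2)\<close> in \<open>(y / u)^2\<close> give the finite sum
  in \<open>\<gamma>\<close>, and in the remainder \<open>K\<close> is replaced by its partial fractions over the poles
  \<open>\<plusminus> i \<pi> n\<close>; termwise integration gives the series in \<open>\<gamma>\<close>, plus a sum which the same
  partial fractions at \<open>u = \<plusminus> i y\<close> identify with \<open>\<phi>\<close>. Boundedness on the line and the limit follow from
  dominated convergence for \<open>I\<close>.

  For uniqueness, the difference of two interpolants is of exponential type \<open>1\<close>, bounded on the line and
  zero at the zeros of \<open>sin\<close>; by Phragmen-Lindelof and Liouville it is a multiple of \<open>sin\<close>, and the
  condition on the derivative at \<open>0\<close> makes the multiple vanish.
\<close>

section \<open>Integrals over the half-line\<close>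

text \<open>In general the partial fractions of the kernel converge only conditionally, so they are
  summed in blocks of q consecutive indices. Over a block the weights \<open>Wexp\<close> add up to
  0; this bounds all partial sums uniformly in u and licenses termwise integration. The partial
  fractions come from those of the cotangent, one for each residue class modulo q, recombined by
  Fourier inversion. The same blocks carry the Dirichlet series, which need not converge absolutely
  when Re z <= 1. The shift w = s - 2 \<open>m1 s\<close> is forced by convergence: integrals of
  u^(w - 1) / (u^2 + y^2) ask for 0 < Re w < 2, which the floor and the condition on Re s provide.
  Each pole contributes terms with sin(pi w / 2) or cos(pi w / 2) in the denominator; in the open
  strip these vanish only at w = 1, and that would make s a natural number. The Mellin integrals
  with two poles are found without contours: a product of two poles is a Laplace integral, and
  Fubini with the reflection formula does the rest.\<close>

lemma integral_Ioi_bound: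
  fixes f :: "real \<Rightarrow> 'a::euclidean_space"
  assumes "continuous_on {0<..} f" "g integrable_on {0<..}" "\<And>u. u > 0 \<Longrightarrow> norm (f u) \<le> g u"
  shows "f absolutely_integrable_on {0<..}"
proof (rule measurable_bounded_by_integrable_imp_absolutely_integrable)
  show "f \<in> borel_measurable (lebesgue_on {0<..})"
    by (rule continuous_imp_measurable_on_sets_lebesgue) (use assms in auto)
qed (use assms in auto)

text \<open>Passes from the gauge integral over the half-line to the Bochner integral over
  \<open>lborel\<close>, the setting of Fubini and of the fundamental theorem on unbounded
  intervals. Continuity makes the extension by zero Borel measurable, so integrability descends from
  the completed measure.\<close>

lemma lborel_integral_Ioi:
  fixes f :: "real \<Rightarrow> 'a::euclidean_space"
  assumes "continuous_on {0<..} f" "f absolutely_integrable_on {0<..}"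
  shows "integrable lborel (\<lambda>x. indicator {0<..} x *\<^sub>R f x)"
    and "(\<integral>x. indicator {0<..} x *\<^sub>R f x \<partial>lborel) = integral {0<..} f"
proof -
  have m: "(\<lambda>x. indicator {0<..} x *\<^sub>R f x) \<in> borel_measurable borel"
    using assms(1) by (intro borel_measurable_continuous_on_indicator) auto
  show "integrable lborel (\<lambda>x. indicator {0<..} x *\<^sub>R f x)"
    using assms(2) m unfolding set_integrable_def by (subst (asm) integrable_completion) auto
  then have "set_integrable lborel {0<..} f" by (simp add: set_integrable_def)
  from set_borel_integral_eq_integral(2)[OF this]
  show "(\<integral>x. indicator {0<..} x *\<^sub>R f x \<partial>lborel) = integral {0<..} f"
    by (simp add: set_lebesgue_integral_def)
qed

lemma abs_int_imp_has_integral: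
  fixes f :: "real \<Rightarrow> 'a::euclidean_space"
  assumes "f absolutely_integrable_on S" shows "(f has_integral integral S f) S"
  using assms set_lebesgue_integral_eq_integral(1) by blast

lemma continuous_on_powr_of_real:
  fixes a :: complex
  shows "continuous_on {0<..} (\<lambda>v::real. of_real v powr a :: complex)"
  by (intro continuous_intros) (auto simp: complex_nonpos_Reals_iff)

lemma cmod_of_real_powr: "u > 0 \<Longrightarrow> cmod (of_real u powr a) = u powr Re a"
  by (simp add: norm_powr_real_powr)

text \<open>The substitution t -> c t in Euler's integral leaves a factor c^z; multiplying by c^(-z)
  moves it to the other side.\<close>

lemma Gamma_integral_scaled:
  assumes "Re z > 0" "c > 0"
  shows "(\<lambda>t. of_real t powr (z - 1) * of_real (exp (- (c * t)))) absolutely_integrable_on {0<..}"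
    and "((\<lambda>t. of_real t powr (z - 1) * of_real (exp (- (c * t)))) has_integral
            Gamma z * of_real c powr (- z)) {0<..}"
proof -
  let ?f = "\<lambda>t. complex_of_real t powr (z - 1) / of_real (exp t)"
  let ?g = "\<lambda>t. of_real t powr (z - 1) * complex_of_real (exp (- (c * t)))"
  have im: "(\<lambda>t. c * t) ` {0<..} = {0<..}"
  proof (intro equalityI subsetI)
    fix x :: real assume "x \<in> {0<..}"
    then show "x \<in> (\<lambda>t. c * t) ` {0<..}" using assms by (intro image_eqI[of _ _ "x/c"]) auto
  qed (use assms in auto)
  have "?f absolutely_integrable_on {0<..}" "integral {0<..} ?f = Gamma z"
    using absolutely_integrable_Gamma_integral'[OF assms(1)] Gamma_integral_complex'[OF assms(1)] by auto
  then have "(\<lambda>t. \<bar>c\<bar> *\<^sub>R ?f (c * t)) absolutely_integrable_on {0<..} \<and>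
             integral {0<..} (\<lambda>t. \<bar>c\<bar> *\<^sub>R ?f (c * t)) = Gamma z"
    using assms im
    by (subst has_absolute_integral_change_of_variables_real)
       (auto intro!: derivative_eq_intros simp: inj_on_def)
  moreover have eq: "\<bar>c\<bar> *\<^sub>R ?f (c * t) = of_real c powr z * ?g t" if "t \<in> {0<..}" for t
    using that assms
    by (simp add: powr_times_real_left powr_diff exp_minus field_simps scaleR_conv_of_real flip: of_real_mult)
       (simp add: powr_times_real)
  ultimately have ai: "(\<lambda>t. of_real c powr z * ?g t) absolutely_integrable_on {0<..}"
     and I: "integral {0<..} (\<lambda>t. of_real c powr z * ?g t) = Gamma z"
    by (metis (no_types, lifting) absolutely_integrable_spike_eq negligible_empty DiffD1 empty_iff eq set_integrable_cong, 
        metis (no_types, lifting) eq integral_cong)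
  have c: "of_real c powr z \<noteq> (0::complex)" using assms by simp
  have "(\<lambda>t. of_real c powr (- z) * (of_real c powr z * ?g t)) absolutely_integrable_on {0<..}"
    using ai by (rule set_integrable_mult_right)
  moreover have e2: "of_real c powr (- z) * (of_real c powr z * ?g t) = ?g t" for t
    using c by (simp add: powr_minus field_simps)
  ultimately show ai2: "?g absolutely_integrable_on {0<..}" by (simp only: e2)
  have "((\<lambda>t. of_real c powr (- z) * (of_real c powr z * ?g t)) has_integral of_real c powr (- z) * Gamma z) {0<..}"
    using abs_int_imp_has_integral[OF ai] I by (intro has_integral_mult_right) simp
  then show "(?g has_integral Gamma z * of_real c powr (- z)) {0<..}"
    unfolding e2 by (simp only: mult.commute)
qed

text \<open>Real parts of the complex formula at a real exponent; this version supplies majorants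
  and integrals of norms.\<close>

lemma Gamma_integral_scaled_real:
  fixes p c :: real
  assumes "p > 0" "c > 0"
  shows "(\<lambda>t. t powr (p - 1) * exp (- (c * t))) absolutely_integrable_on {0<..}"
    and "((\<lambda>t. t powr (p - 1) * exp (- (c * t))) has_integral Gamma p * c powr (- p)) {0<..}"
proof -
  have *: "Re (of_real p :: complex) > 0" using assms by simp
  have e: "Re (of_real t powr (of_real p - 1) * complex_of_real (exp (- (c * t)))) = t powr (p - 1) * exp (- (c * t))"
    if "t \<in> {0<..}" for t
  proof -
    have "of_real t powr (of_real p - 1) = complex_of_real (t powr (p - 1))"
      using powr_of_real[of t "p - 1"] that by simp
    then show ?thesis by simp
  qed
  have "(\<lambda>t. Re (of_real t powr (of_real p - 1) * complex_of_real (exp (- (c * t))))) absolutely_integrable_on {0<..}"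
    using absolutely_integrable_linear[OF Gamma_integral_scaled(1)[OF * assms(2)] bounded_linear_Re]
    by (simp add: o_def)
  then show "(\<lambda>t. t powr (p - 1) * exp (- (c * t))) absolutely_integrable_on {0<..}"
    by (subst (asm) set_integrable_cong[OF refl refl e]) auto
  have "((\<lambda>t. Re (of_real t powr (of_real p - 1) * complex_of_real (exp (- (c * t))))) has_integral
      Re (Gamma (of_real p) * of_real c powr (- of_real p))) {0<..}"
    using has_integral_linear[OF Gamma_integral_scaled(2)[OF * assms(2)] bounded_linear_Re]
    by (simp add: o_def)
  moreover have "Re (Gamma (of_real p) * of_real c powr (- of_real p)) = Gamma p * c powr (- p)"
  proof -
    have "of_real c powr (- of_real p) = complex_of_real (c powr (- p))"
      using powr_of_real[of c "- p"] assms by simp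
    then show ?thesis by (simp add: Gamma_complex_of_real)
  qed
  ultimately have "((\<lambda>t. Re (of_real t powr (of_real p - 1) * complex_of_real (exp (- (c * t))))) has_integral
      Gamma p * c powr (- p)) {0<..}" by (simp only:)
  then show "((\<lambda>t. t powr (p - 1) * exp (- (c * t))) has_integral Gamma p * c powr (- p)) {0<..}"
    by (subst (asm) has_integral_cong[OF e]) auto
qed

text \<open>Turns denominators v + b^2 into u^2 + b^2, which match the poles of the kernel on the
  imaginary axis, and doubles the admissible range of exponents.\<close>

lemma integral_square_substitution:
  fixes f :: "real \<Rightarrow> 'a::euclidean_space"
  assumes "f absolutely_integrable_on {0<..}"
  shows "(\<lambda>u. (2 * u) *\<^sub>R f (u\<^sup>2)) absolutely_integrable_on {0<..}"
    and "((\<lambda>u. (2 * u) *\<^sub>R f (u\<^sup>2)) has_integral integral {0<..} f) {0<..}"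
proof -
  have im: "(\<lambda>t. t\<^sup>2) ` {0<..} = {0::real<..}"
  proof (intro equalityI subsetI)
    fix x :: real assume "x \<in> {0<..}"
    then show "x \<in> (\<lambda>t. t\<^sup>2) ` {0<..}" by (intro image_eqI[of _ _ "sqrt x"]) auto
  qed auto
  have "(\<lambda>t. \<bar>2 * t\<bar> *\<^sub>R f (t\<^sup>2)) absolutely_integrable_on {0<..} \<and>
             integral {0<..} (\<lambda>t. \<bar>2 * t\<bar> *\<^sub>R f (t\<^sup>2)) = integral {0<..} f"
    using assms im
    by (subst has_absolute_integral_change_of_variables_real)
       (auto intro!: derivative_eq_intros inj_onI simp: power2_eq_iff_nonneg)
  moreover have e: "\<bar>2 * t\<bar> *\<^sub>R f (t\<^sup>2) = (2 * t) *\<^sub>R f (t\<^sup>2)" if "t \<in> {0<..}" for t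
    using that by simp
  ultimately show ai: "(\<lambda>u. (2 * u) *\<^sub>R f (u\<^sup>2)) absolutely_integrable_on {0<..}"
    by (subst (asm) set_integrable_cong[OF refl refl e]) auto
  have "integral {0<..} (\<lambda>u. (2 * u) *\<^sub>R f (u\<^sup>2)) = integral {0<..} (\<lambda>t. \<bar>2 * t\<bar> *\<^sub>R f (t\<^sup>2))"
    by (rule integral_cong) (use e in auto)
  with abs_int_imp_has_integral[OF ai]
  show "((\<lambda>u. (2 * u) *\<^sub>R f (u\<^sup>2)) has_integral integral {0<..} f) {0<..}"
    using \<open>_ \<and> integral {0<..} (\<lambda>t. \<bar>2 * t\<bar> *\<^sub>R f (t\<^sup>2)) = integral {0<..} f\<close> by metis
qed


section \<open>Mellin integrals with two poles on the negative axis\<close>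

lemma exp_diff_bound:
  fixes B C t :: real
  assumes "0 < B" "B < C" "t > 0"
  shows "0 \<le> exp (- (B * t)) - exp (- (C * t))"
    and "exp (- (B * t)) - exp (- (C * t)) \<le> (C - B) * t * exp (- (B * t))"
proof -
  have "B * t < C * t" using assms by simp
  then show "0 \<le> exp (- (B * t)) - exp (- (C * t))" by simp
  \<comment> \<open>The factor t gained here outweighs the singularity t^(-a) at 0 as long as Re a <
    2.\<close>
  have "1 + (- ((C - B) * t)) \<le> exp (- ((C - B) * t))" by (rule exp_ge_add_one_self)
  then have "(1 - (C - B) * t) * exp (- (B * t)) \<le> exp (- ((C - B) * t)) * exp (- (B * t))"
    by (intro mult_right_mono) auto
  also have "\<dots> = exp (- (C * t))" by (simp add: algebra_simps flip: exp_add)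
  finally show "exp (- (B * t)) - exp (- (C * t)) \<le> (C - B) * t * exp (- (B * t))"
    by (simp add: algebra_simps)
qed

text \<open>For \<open>Re a \<ge> 1\<close> the two exponentials cannot be integrated separately; one integration by parts
  lowers the singularity at \<open>0\<close> and covers the whole strip except \<open>a = 1\<close>.\<close>

lemma Gamma_integral_exp_diff:
  fixes a :: complex and B C :: real
  assumes a: "0 < Re a" "Re a < 2" "a \<noteq> 1" and BC: "0 < B" "B < C"
  defines "f \<equiv> \<lambda>t. of_real t powr (- a) * complex_of_real (exp (- (B * t)) - exp (- (C * t)))"
  shows "f absolutely_integrable_on {0<..}"
    and "integral {0<..} f = Gamma (1 - a) * (of_real B powr (a - 1) - of_real C powr (a - 1))"
proof -
  let ?e = "\<lambda>t. exp (- (B * t)) - exp (- (C * t))"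
  have bound: "cmod (f t) \<le> (C - B) * (t powr ((2 - Re a) - 1) * exp (- (B * t)))" if "t > 0" for t
  proof -
    have "cmod (f t) = t powr (- Re a) * \<bar>?e t\<bar>"
      unfolding f_def norm_mult norm_of_real using that by (simp add: cmod_of_real_powr)
    also have "\<dots> \<le> t powr (- Re a) * ((C - B) * t * exp (- (B * t)))"
      using exp_diff_bound[OF BC that] by (intro mult_left_mono) auto
    also have "\<dots> = (C - B) * ((t powr (- Re a) * t powr 1) * exp (- (B * t)))" using that by simp
    also have "t powr (- Re a) * t powr 1 = t powr ((2 - Re a) - 1)"
      by (subst powr_add[symmetric]) simp
    finally show ?thesis .
  qed
  have cf: "continuous_on {0<..} f"
    unfolding f_def by (intro continuous_intros continuous_on_powr_of_real)
  have "(\<lambda>t. (C - B) * (t powr ((2 - Re a) - 1) * exp (- (B * t)))) integrable_on {0<..}"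
    using Gamma_integral_scaled_real(2)[of "2 - Re a" B] a BC by (intro integrable_on_mult_right) auto
  with cf bound show fi: "f absolutely_integrable_on {0<..}" by (intro integral_Ioi_bound) auto
  define g where "g t = of_real t powr ((2 - a) - 1) *
     (of_real C * complex_of_real (exp (- (C * t))) - of_real B * complex_of_real (exp (- (B * t)))) / (1 - a)" for t
  have gi: "g absolutely_integrable_on {0<..}"
    and gI: "integral {0<..} g = (of_real C * (Gamma (2 - a) * of_real C powr (- (2 - a)))
               - of_real B * (Gamma (2 - a) * of_real B powr (- (2 - a)))) / (1 - a)"
  proof -
    have *: "Re (2 - a) > 0" "B > 0" "C > 0" using a BC by auto
    have eq: "g = (\<lambda>t. (of_real C * (of_real t powr ((2 - a) - 1) * of_real (exp (- (C * t)))) -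
        of_real B * (of_real t powr ((2 - a) - 1) * of_real (exp (- (B * t))))) / (1 - a))"
      by (auto simp: g_def fun_eq_iff algebra_simps)
    show "g absolutely_integrable_on {0<..}"
      unfolding eq using Gamma_integral_scaled(1)[OF *(1,2)] Gamma_integral_scaled(1)[OF *(1,3)]
      by (intro set_integrable_divide set_integral_diff(1) set_integrable_mult_right) auto
    have "(g has_integral (of_real C * (Gamma (2 - a) * of_real C powr (- (2 - a)))
               - of_real B * (Gamma (2 - a) * of_real B powr (- (2 - a)))) / (1 - a)) {0<..}"
      unfolding eq using Gamma_integral_scaled(2)[OF *(1,2)] Gamma_integral_scaled(2)[OF *(1,3)]
      by (intro has_integral_divide has_integral_diff has_integral_mult_right) auto
    then show "integral {0<..} g = (of_real C * (Gamma (2 - a) * of_real C powr (- (2 - a)))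
               - of_real B * (Gamma (2 - a) * of_real B powr (- (2 - a)))) / (1 - a)" by blast
  qed
  have cg: "continuous_on {0<..} g"
    unfolding g_def using a by (intro continuous_intros continuous_on_powr_of_real) auto
  \<comment> \<open>The function for the integration by parts: F' = f + g, and F vanishes at 0 and
    at infinity, so the integral of \<open>f\<close> is minus that of \<open>g\<close>. The exponent
    1 - a in \<open>g\<close> is within reach of the Gamma integral.\<close>
  define F where "F t = of_real t powr (1 - a) * complex_of_real (?e t) / (1 - a)" for t
  have F_bound: "cmod (F t) \<le> (C - B) / cmod (1 - a) * (t powr (2 - Re a) * exp (- (B * t)))" if "t > 0" for t
  proof -
    have "cmod (F t) = t powr (1 - Re a) * \<bar>?e t\<bar> / cmod (1 - a)"
      unfolding F_def norm_mult norm_divide norm_of_real using that by (simp add: cmod_of_real_powr)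
    also have "\<dots> \<le> t powr (1 - Re a) * ((C - B) * t * exp (- (B * t))) / cmod (1 - a)"
      using exp_diff_bound[OF BC that] by (intro divide_right_mono mult_left_mono) auto
    also have "\<dots> = (C - B) / cmod (1 - a) * ((t powr (1 - Re a) * t powr 1) * exp (- (B * t)))"
      using that by simp
    also have "t powr (1 - Re a) * t powr 1 = t powr (2 - Re a)"
      by (subst powr_add[symmetric]) simp
    finally show ?thesis .
  qed
  have lim0: "(F \<longlongrightarrow> 0) (at_right 0)"
  proof (rule Lim_null_comparison)
    show "\<forall>\<^sub>F t in at_right 0. norm (F t) \<le> (C - B) / cmod (1 - a) * (t powr (2 - Re a) * exp (- (B * t)))"
      using F_bound by (auto simp: eventually_at_filter)
    have "((\<lambda>t. t powr (2 - Re a)) \<longlongrightarrow> 0) (at_right 0)"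
      using a by (intro tendsto_zero_powrI[where b = "2 - Re a"]) (auto intro!: tendsto_intros simp: eventually_at_filter)
    then have "((\<lambda>t. (C - B) / cmod (1 - a) * (t powr (2 - Re a) * exp (- (B * t)))) \<longlongrightarrow>
        (C - B) / cmod (1 - a) * (0 * exp (- (B * 0)))) (at_right 0)"
      by (intro tendsto_intros)
    then show "((\<lambda>t. (C - B) / cmod (1 - a) * (t powr (2 - Re a) * exp (- (B * t)))) \<longlongrightarrow> 0) (at_right 0)"
      by simp
  qed
  have lim1: "(F \<longlongrightarrow> 0) at_top"
  proof (rule Lim_null_comparison)
    show "\<forall>\<^sub>F t in at_top. norm (F t) \<le> (C - B) / cmod (1 - a) * (t powr (2 - Re a) * exp (- (B * t)))"
      using eventually_gt_at_top[of 0] by eventually_elim (rule F_bound)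
    have "((\<lambda>t. t powr (2 - Re a) * exp (- (B * t))) \<longlongrightarrow> 0) at_top"
      using BC by real_asymp
    then have "((\<lambda>t. (C - B) / cmod (1 - a) * (t powr (2 - Re a) * exp (- (B * t)))) \<longlongrightarrow>
        (C - B) / cmod (1 - a) * 0) at_top"
      by (intro tendsto_intros)
    then show "((\<lambda>t. (C - B) / cmod (1 - a) * (t powr (2 - Re a) * exp (- (B * t)))) \<longlongrightarrow> 0) at_top"
      by simp
  qed
  have fg: "(\<lambda>t. f t + g t) absolutely_integrable_on {0<..}" using fi gi by (rule set_integral_add)
  have cfg: "continuous_on {0<..} (\<lambda>t. f t + g t)" using cf cg by (rule continuous_on_add)
  have der: "(F has_vector_derivative f t + g t) (at t)" if "t > 0" for t
  proof -
    have np: "complex_of_real t \<notin> \<real>\<^sub>\<le>\<^sub>0" using that by simp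
    have a1: "1 - a \<noteq> 0" using a by auto
    have p: "((\<lambda>t. of_real t powr (1 - a)) has_vector_derivative (1 - a) * of_real t powr (- a)) (at t)"
      using has_vector_derivative_real_field[OF has_field_derivative_powr[OF np, of "1 - a"]] by simp
    have e: "((\<lambda>t. complex_of_real (?e t)) has_vector_derivative
              of_real (C * exp (- (C * t)) - B * exp (- (B * t)))) (at t)"
      by (rule has_vector_derivative_of_real) (auto intro!: derivative_eq_intros)
    have "(F has_vector_derivative (of_real t powr (1 - a) * of_real (C * exp (- (C * t)) - B * exp (- (B * t)))
            + ((1 - a) * of_real t powr (- a)) * complex_of_real (?e t)) / (1 - a)) (at t)"
      unfolding F_def by (intro has_vector_derivative_divide has_vector_derivative_mult p e)
    also have "(of_real t powr (1 - a) * of_real (C * exp (- (C * t)) - B * exp (- (B * t)))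
            + ((1 - a) * of_real t powr (- a)) * complex_of_real (?e t)) / (1 - a) = f t + g t"
      using a1 by (simp add: f_def g_def add_divide_distrib)
    finally show ?thesis .
  qed
  have "(LBINT x=0..\<infinity>. f x + g x) = 0 - 0"
  proof (rule interval_integral_FTC_integrable)
    show "(F has_vector_derivative f x + g x) (at x)" if "0 < ereal x" "ereal x < \<infinity>" for x
      using der that by simp
    show "isCont (\<lambda>t. f t + g t) x" if "0 < ereal x" "ereal x < \<infinity>" for x
      using cfg that by (auto simp: continuous_on_eq_continuous_at)
    have "einterval 0 \<infinity> = {0<..}" by (auto simp: einterval_def)
    then show "set_integrable lborel (einterval 0 \<infinity>) (\<lambda>t. f t + g t)"
      using lborel_integral_Ioi(1)[OF cfg fg] by (simp add: set_integrable_def)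
    show "((F \<circ> real_of_ereal) \<longlongrightarrow> 0) (at_right 0)"
      using lim0 unfolding zero_ereal_def by (simp add: ereal_tendsto_simps)
    show "((F \<circ> real_of_ereal) \<longlongrightarrow> 0) (at_left \<infinity>)"
      using lim1 by (simp add: ereal_tendsto_simps)
  qed auto
  then have "integral {0<..} (\<lambda>t. f t + g t) = 0"
    using lborel_integral_Ioi(2)[OF cfg fg]
    by (simp add: interval_integral_to_infinity_eq set_lebesgue_integral_def zero_ereal_def)
  moreover have "integral {0<..} (\<lambda>t. f t + g t) = integral {0<..} f + integral {0<..} g"
    using abs_int_imp_has_integral[OF fi] abs_int_imp_has_integral[OF gi] by (intro integral_add) auto
  ultimately have "integral {0<..} f = - integral {0<..} g" by (simp add: eq_neg_iff_add_eq_0)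
  also have "\<dots> = Gamma (2 - a) / (1 - a) * (of_real B * of_real B powr (- (2 - a)) - of_real C * of_real C powr (- (2 - a)))"
    unfolding gI by (simp add: field_simps diff_divide_distrib)
  also have "of_real B * of_real B powr (- (2 - a)) = of_real B powr (a - 1)"
    using BC powr_add[of "of_real B" 1 "- (2 - a)"] by simp
  also have "of_real C * of_real C powr (- (2 - a)) = of_real C powr (a - 1)"
    using BC powr_add[of "of_real C" 1 "- (2 - a)"] by simp
  also have "Gamma (2 - a) / (1 - a) = Gamma (1 - a)"
  proof -
    \<comment> \<open>In the strip Re (1 - a) > -1, so the only pole of Gamma that 1 - a could hit
      is 0.\<close>
    have "1 - a \<notin> \<int>\<^sub>\<le>\<^sub>0"
    proof
      assume "1 - a \<in> \<int>\<^sub>\<le>\<^sub>0"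
      then obtain n where n: "1 - a = - of_nat n" by (auto elim: nonpos_Ints_cases')
      then have "Re (1 - a) = - real n" by simp
      with a have "real n < 1" by simp
      then have "n = 0" by simp
      with n a show False by simp
    qed
    then have "Gamma ((1 - a) + 1) = (1 - a) * Gamma (1 - a)" by (rule Gamma_plus1)
    then show ?thesis using a by (simp add: algebra_simps field_simps)
  qed
  finally show "integral {0<..} f = Gamma (1 - a) * (of_real B powr (a - 1) - of_real C powr (a - 1))" .
qed


text \<open>Up to the factor C - B, the product 1 / ((v + B) (v + C)) is the Laplace transform of
  exp(-B t) - exp(-C t) at v. After exchanging the integrals the v-integral gives Gamma(a) t^(-a),
  the t-integral gives Gamma(1 - a) times the difference of powers, and the reflection formula turns
  the product of the Gammas into pi / sin(pi a).\<close>

lemma Mellin_two_poles_aux: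
  fixes a :: complex and B C :: real
  assumes a: "0 < Re a" "Re a < 2" "a \<noteq> 1" and BC: "0 < B" "B < C"
  defines "f \<equiv> \<lambda>v. of_real v powr (a - 1) / complex_of_real ((v + B) * (v + C))"
  shows "f absolutely_integrable_on {0<..}"
    and "integral {0<..} f = of_real pi / sin (of_real pi * a) *
           (of_real B powr (a - 1) - of_real C powr (a - 1)) / of_real (C - B)"
proof -
  let ?e = "\<lambda>t. exp (- (B * t)) - exp (- (C * t))"
  let ?i = "indicat_real {0<..}"
  define F where "F = (\<lambda>(t, v). ?i t *\<^sub>R (?i v *\<^sub>R (complex_of_real v powr (a - 1) * of_real (exp (- (t * v)))
      * complex_of_real (?e t))))"
  \<comment> \<open>Through exp and ln the power becomes an expression whose joint measurability is
    automatic; the indicator restricts it to v > 0.\<close>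
  have powr_eq: "complex_of_real v powr (a - 1) = exp ((a - 1) * of_real (ln v))" if "v > 0" for v
    using that by (simp add: powr_def Ln_of_real)
  have F_eq: "F = (\<lambda>(t, v). ?i t *\<^sub>R (?i v *\<^sub>R (exp ((a - 1) * of_real (ln v)) * of_real (exp (- (t * v)))
      * complex_of_real (?e t))))"
    unfolding F_def by (auto simp: fun_eq_iff indicator_def powr_eq)
  have meas [measurable]: "F \<in> borel_measurable (lborel \<Otimes>\<^sub>M lborel)"
    unfolding F_eq by measurable
  have gi: "(\<lambda>v. complex_of_real v powr (a - 1) * of_real (exp (- (t * v)))) absolutely_integrable_on {0<..}"
       "integral {0<..} (\<lambda>v. complex_of_real v powr (a - 1) * of_real (exp (- (t * v)))) = Gamma a * of_real t powr (- a)"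
    if "t > 0" for t
    using Gamma_integral_scaled[OF a(1) that] by (simp_all add: integral_unique)
  have gir: "(\<lambda>v. v powr (Re a - 1) * exp (- (t * v))) absolutely_integrable_on {0<..}"
       "integral {0<..} (\<lambda>v. v powr (Re a - 1) * exp (- (t * v))) = Gamma (Re a) * t powr (- Re a)"
    if "t > 0" for t
    using Gamma_integral_scaled_real[OF a(1) that] by (simp_all add: integral_unique)
  have cg: "continuous_on {0<..} (\<lambda>v. complex_of_real v powr (a - 1) * of_real (exp (- (t * v))))"
       "continuous_on {0<..} (\<lambda>v. v powr (Re a - 1) * exp (- (t * v)))" for t
    by (intro continuous_intros continuous_on_powr_of_real; auto)+
  have inner1: "(\<integral>v. norm (F (t, v)) \<partial>lborel) = ?i t * (Gamma (Re a) * (t powr (- Re a) * ?e t))" for t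
  proof (cases "t > 0")
    case True
    have "(\<integral>v. norm (F (t, v)) \<partial>lborel) = (\<integral>v. ?e t * (?i v *\<^sub>R (v powr (Re a - 1) * exp (- (t * v)))) \<partial>lborel)"
      using True exp_diff_bound(1)[OF BC True]
      by (intro Bochner_Integration.integral_cong) 
         (auto simp: F_def norm_mult indicator_def cmod_of_real_powr simp flip: of_real_diff)
    also have "\<dots> = ?e t * integral {0<..} (\<lambda>v. v powr (Re a - 1) * exp (- (t * v)))"
      using lborel_integral_Ioi[OF cg(2) gir(1)[OF True]] by simp
    finally show ?thesis using True gir(2)[OF True] by simp
  qed (simp add: F_def)
  have inner2: "(\<integral>v. F (t, v) \<partial>lborel) = ?i t *\<^sub>R (Gamma a * (of_real t powr (- a) * of_real (?e t)))" for t
  proof (cases "t > 0")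
    case True
    have "(\<integral>v. F (t, v) \<partial>lborel) = (\<integral>v. of_real (?e t) * (?i v *\<^sub>R (complex_of_real v powr (a - 1) * of_real (exp (- (t * v))))) \<partial>lborel)"
      using True by (intro Bochner_Integration.integral_cong) (auto simp: F_def indicator_def)
    also have "\<dots> = of_real (?e t) * integral {0<..} (\<lambda>v. complex_of_real v powr (a - 1) * of_real (exp (- (t * v))))"
      by (subst integral_mult_right_zero, subst lborel_integral_Ioi(2)[OF cg(1) gi(1)[OF True]]) simp
    finally show ?thesis using True gi(2)[OF True] by simp
  qed (simp add: F_def)
  have int2: "integrable lborel (\<lambda>v. F (t, v))" for t
  proof (cases "t > 0")
    case True
    have "integrable lborel (\<lambda>v. of_real (?e t) * (?i v *\<^sub>R (complex_of_real v powr (a - 1) * of_real (exp (- (t * v))))))"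
      by (rule integrable_mult_right) (rule lborel_integral_Ioi(1)[OF cg(1) gi(1)[OF True]])
    also have "(\<lambda>v. of_real (?e t) * (?i v *\<^sub>R (complex_of_real v powr (a - 1) * of_real (exp (- (t * v)))))) = (\<lambda>v. F (t, v))"
      using True by (auto simp: F_def indicator_def fun_eq_iff)
    finally show ?thesis .
  qed (simp add: F_def)
  note D = Gamma_integral_exp_diff[OF a BC]
  have cD: "continuous_on {0<..} (\<lambda>t. of_real t powr (- a) * complex_of_real (?e t))"
    by (intro continuous_intros continuous_on_powr_of_real)
  have normD: "norm (?i t *\<^sub>R (of_real t powr (- a) * complex_of_real (?e t))) = ?i t * (t powr (- Re a) * ?e t)" for t
    using exp_diff_bound(1)[OF BC, of t]
    by (cases "t > 0") (auto simp: norm_mult cmod_of_real_powr simp flip: of_real_diff)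
  \<comment> \<open>The inner integral of the norm is Gamma(Re a) t^(-Re a) times a nonnegative
    difference of exponentials, which is integrable in t by
    \<open>Gamma_integral_exp_diff\<close>.\<close>
  have Fi: "integrable (lborel \<Otimes>\<^sub>M lborel) F"
  proof (rule lborel_pair.Fubini_integrable)
    have "integrable lborel (\<lambda>t. Gamma (Re a) * (?i t * (t powr (- Re a) * ?e t)))"
      using integrable_norm[OF lborel_integral_Ioi(1)[OF cD D(1)]] unfolding normD by simp
    then show "integrable lborel (\<lambda>t. \<integral>v. norm (F (t, v)) \<partial>lborel)"
      unfolding inner1 by (simp add: algebra_simps)
  qed (use int2 meas in auto)
  then have Fi': "integrable (lborel \<Otimes>\<^sub>M lborel) (case_prod (\<lambda>t v. F (t, v)))" by simp
  have "(\<integral>t. (\<integral>v. F (t, v) \<partial>lborel) \<partial>lborel) = (\<integral>t. Gamma a * (?i t *\<^sub>R (of_real t powr (- a) * of_real (?e t))) \<partial>lborel)"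
    unfolding inner2 by (intro Bochner_Integration.integral_cong) auto
  also have "\<dots> = Gamma a * (\<integral>t. ?i t *\<^sub>R (of_real t powr (- a) * of_real (?e t)) \<partial>lborel)"
    by (rule integral_mult_right_zero)
  also have "\<dots> = Gamma a * (Gamma (1 - a) * (of_real B powr (a - 1) - of_real C powr (a - 1)))"
    by (subst lborel_integral_Ioi(2)[OF cD D(1)], subst D(2)) simp
  finally have val: "(\<integral>t. (\<integral>v. F (t, v) \<partial>lborel) \<partial>lborel) =
      of_real pi / sin (of_real pi * a) * (of_real B powr (a - 1) - of_real C powr (a - 1))"
    by (simp add: Gamma_reflection_complex flip: mult.assoc)
  have inner3: "(\<integral>t. F (t, v) \<partial>lborel) = of_real (C - B) * (?i v *\<^sub>R f v)" for v
  proof (cases "v > 0")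
    case True
    have e: "(\<lambda>t. exp (- (x * t)) :: real) absolutely_integrable_on {0<..}"
      "integral {0<..} (\<lambda>t. exp (- (x * t)) :: real) = 1 / x" if "x > 0" for x
    proof -
      have eq: "t powr (1 - 1) * exp (- (x * t)) = exp (- (x * t))" if "t \<in> {0<..}" for t :: real
        using that by simp
      show "(\<lambda>t. exp (- (x * t)) :: real) absolutely_integrable_on {0<..}"
        using Gamma_integral_scaled_real(1)[of 1 x] that by (subst (asm) set_integrable_cong[OF refl refl eq]) auto
      have "((\<lambda>t. exp (- (x * t))) has_integral Gamma 1 * x powr (- 1)) {0<..}"
        using Gamma_integral_scaled_real(2)[of 1 x] that by (subst (asm) has_integral_cong[OF eq]) auto
      then show "integral {0<..} (\<lambda>t. exp (- (x * t)) :: real) = 1 / x"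
        using that by (simp add: powr_minus inverse_eq_divide integral_unique)
    qed
    have p: "v + B > 0" "v + C > 0" using True BC by auto
    have ei: "(\<lambda>t. exp (- ((v + B) * t)) - exp (- ((v + C) * t))) absolutely_integrable_on {0<..}"
      using e(1)[OF p(1)] e(1)[OF p(2)] by (rule set_integral_diff(1))
    have eI: "integral {0<..} (\<lambda>t. exp (- ((v + B) * t)) - exp (- ((v + C) * t))) = 1 / (v + B) - 1 / (v + C)"
      using e[OF p(1)] e[OF p(2)] by (subst integral_diff) (auto dest!: abs_int_imp_has_integral)
    have ec: "continuous_on {0<..} (\<lambda>t. exp (- ((v + B) * t)) - exp (- ((v + C) * t)))"
      by (intro continuous_intros)
    have "(\<integral>t. F (t, v) \<partial>lborel) = (\<integral>t. of_real v powr (a - 1) * complex_of_real (?i t *\<^sub>R (exp (- ((v + B) * t)) - exp (- ((v + C) * t)))) \<partial>lborel)"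
    proof (intro Bochner_Integration.integral_cong refl)
      fix t
      have "exp (- (t * v)) * ?e t = exp (- ((v + B) * t)) - exp (- ((v + C) * t))"
      proof -
        have "exp (- (t * v)) * exp (- (X * t)) = exp (- ((v + X) * t))" for X
          by (simp add: algebra_simps flip: exp_add)
        then show ?thesis by (simp only: right_diff_distrib)
      qed
      then have "complex_of_real (exp (- (t * v))) * complex_of_real (?e t) =
          complex_of_real (exp (- ((v + B) * t)) - exp (- ((v + C) * t)))"
        by (simp only: of_real_mult[symmetric])
      then show "F (t, v) = of_real v powr (a - 1) * complex_of_real (?i t *\<^sub>R (exp (- ((v + B) * t)) - exp (- ((v + C) * t))))"
        using True by (simp add: F_def indicator_def mult.assoc)
    qed
    also have "\<dots> = of_real v powr (a - 1) * complex_of_real (1 / (v + B) - 1 / (v + C))"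
      using lborel_integral_Ioi[OF ec ei] eI by (subst integral_mult_right_zero, subst integral_complex_of_real) simp
    also have "1 / (v + B) - 1 / (v + C) = (C - B) / ((v + B) * (v + C))" using p by (simp add: field_simps)
    finally show ?thesis using True by (simp add: f_def)
  qed (simp add: F_def)
  have BC0: "complex_of_real (C - B) \<noteq> 0" using BC by simp
  have ne: "complex_of_real ((v + B) * (v + C)) \<noteq> 0" if "v > 0" for v
    unfolding of_real_eq_0_iff using that BC by auto
  have cf: "continuous_on {0<..} f"
    unfolding f_def
    by (intro continuous_on_divide continuous_on_powr_of_real continuous_intros ballI) (rule ne, simp)
  have "integrable lborel (\<lambda>v. of_real (C - B) * (?i v *\<^sub>R f v))"
    using lborel_pair.integrable_snd[OF Fi'] unfolding inner3 .
  then have "integrable lborel (\<lambda>v. (1 / of_real (C - B)) * (of_real (C - B) * (?i v *\<^sub>R f v)))"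
    by (rule integrable_mult_right)
  moreover have "(1 / of_real (C - B)) * (of_real (C - B) * (?i v *\<^sub>R f v)) = ?i v *\<^sub>R f v" for v
    using BC0 by simp
  ultimately have "integrable lborel (\<lambda>v. ?i v *\<^sub>R f v)" by (simp only:)
  then show fi: "f absolutely_integrable_on {0<..}"
    unfolding set_integrable_def by (rule integrable_completion[THEN iffD2, rotated]) (use cf in \<open>auto intro!: borel_measurable_continuous_on_indicator\<close>)
  have "of_real (C - B) * integral {0<..} f = (\<integral>v. of_real (C - B) * (?i v *\<^sub>R f v) \<partial>lborel)"
    by (subst integral_mult_right_zero, subst lborel_integral_Ioi(2)[OF cf fi]) simp
  also have "\<dots> = (\<integral>v. (\<integral>t. F (t, v) \<partial>lborel) \<partial>lborel)" unfolding inner3 ..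
  also have "\<dots> = (\<integral>t. (\<integral>v. F (t, v) \<partial>lborel) \<partial>lborel)"
    by (rule lborel_pair.Fubini_integral[OF Fi'])
  finally have "of_real (C - B) * integral {0<..} f = of_real pi / sin (of_real pi * a) *
           (of_real B powr (a - 1) - of_real C powr (a - 1))" unfolding val .
  then show "integral {0<..} f = of_real pi / sin (of_real pi * a) *
           (of_real B powr (a - 1) - of_real C powr (a - 1)) / of_real (C - B)"
    using BC0 by (metis nonzero_mult_div_cancel_left)
qed

text \<open>The integrand and the value are both symmetric in B and C, so the case B < C
  suffices.\<close>

lemma Mellin_two_poles:
  fixes a :: complex and B C :: real
  assumes a: "0 < Re a" "Re a < 2" "a \<noteq> 1" and BC: "0 < B" "0 < C" "B \<noteq> C"
  shows "(\<lambda>v. of_real v powr (a - 1) / complex_of_real ((v + B) * (v + C))) absolutely_integrable_on {0<..}"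
    and "integral {0<..} (\<lambda>v. of_real v powr (a - 1) / complex_of_real ((v + B) * (v + C))) =
           of_real pi / sin (of_real pi * a) *
           (of_real B powr (a - 1) - of_real C powr (a - 1)) / of_real (C - B)"
proof -
  have "(\<lambda>v. of_real v powr (a - 1) / complex_of_real ((v + B) * (v + C))) absolutely_integrable_on {0<..} \<and>
    integral {0<..} (\<lambda>v. of_real v powr (a - 1) / complex_of_real ((v + B) * (v + C))) =
           of_real pi / sin (of_real pi * a) *
           (of_real B powr (a - 1) - of_real C powr (a - 1)) / of_real (C - B)"
  proof (cases "B < C")
    case True
    then show ?thesis using Mellin_two_poles_aux[OF a BC(1)] by blast
  next
    case False
    then have "C < B" using BC by simp
    from Mellin_two_poles_aux[OF a BC(2) this] show ?thesis
      by (simp add: mult.commute[of "complex_of_real _ + complex_of_real C"] mult.commute[of "_ + C"])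
         (metis (no_types, lifting) divide_minus_left minus_diff_eq minus_divide_divide mult_minus_right)
  qed
  then show "(\<lambda>v. of_real v powr (a - 1) / complex_of_real ((v + B) * (v + C))) absolutely_integrable_on {0<..}"
    and "integral {0<..} (\<lambda>v. of_real v powr (a - 1) / complex_of_real ((v + B) * (v + C))) =
           of_real pi / sin (of_real pi * a) *
           (of_real B powr (a - 1) - of_real C powr (a - 1)) / of_real (C - B)" by auto
qed

text \<open>The case a = z / 2 after v = u^2. The wide strip Re z < 4 later admits the exponents w,
  w + 1 and w + 2 for 0 < Re w < 2; the excluded point z = 2 is w = 1 in the second of them.\<close>

lemma Mellin_two_poles_square:
  fixes z :: complex and b c :: real
  assumes z: "0 < Re z" "Re z < 4" "z \<noteq> 2" and bc: "0 < b" "0 < c" "b \<noteq> c"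
  shows "(\<lambda>u. of_real u powr (z - 1) / complex_of_real ((u\<^sup>2 + b\<^sup>2) * (u\<^sup>2 + c\<^sup>2))) absolutely_integrable_on {0<..}"
    and "integral {0<..} (\<lambda>u. of_real u powr (z - 1) / complex_of_real ((u\<^sup>2 + b\<^sup>2) * (u\<^sup>2 + c\<^sup>2))) =
           of_real pi / (2 * sin (of_real pi * z / 2)) *
           (of_real b powr (z - 2) - of_real c powr (z - 2)) / of_real (c\<^sup>2 - b\<^sup>2)"
proof -
  have a: "0 < Re (z / 2)" "Re (z / 2) < 2" "z / 2 \<noteq> 1" using z by auto
  have BC: "0 < b\<^sup>2" "0 < c\<^sup>2" "b\<^sup>2 \<noteq> c\<^sup>2" using bc by (auto simp: power2_eq_iff_nonneg)
  let ?f = "\<lambda>v. of_real v powr (z / 2 - 1) / complex_of_real ((v + b\<^sup>2) * (v + c\<^sup>2))"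
  let ?g = "\<lambda>u. of_real u powr (z - 1) / complex_of_real ((u\<^sup>2 + b\<^sup>2) * (u\<^sup>2 + c\<^sup>2))"
  note J = Mellin_two_poles[OF a BC]
  have pw: "complex_of_real (x\<^sup>2) powr (z / 2 - 1) = of_real x powr (z - 2)" if "x > 0" for x
    using that by (simp add: powr_def Ln_of_real ln_realpow of_real_power[symmetric] del: of_real_power)
      (simp add: algebra_simps)
  have eq: "(2 * u) *\<^sub>R ?f (u\<^sup>2) = 2 * ?g u" if "u \<in> {0<..}" for u
  proof -
    have "of_real u powr (z - 2) * of_real u = of_real u powr (z - 1)"
      using that powr_add[of "of_real u" "z - 2" 1] by simp
    then show ?thesis using that pw[of u] by (simp add: scaleR_conv_of_real mult_ac)
  qed
  have 1: "(\<lambda>u. 2 * ?g u) absolutely_integrable_on {0<..}"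
    using integral_square_substitution(1)[OF J(1)] by (subst (asm) set_integrable_cong[OF refl refl eq]) auto
  have 2: "((\<lambda>u. 2 * ?g u) has_integral integral {0<..} ?f) {0<..}"
    using integral_square_substitution(2)[OF J(1)] by (subst (asm) has_integral_cong[OF eq]) auto
  have "(\<lambda>u. (1/2) * (2 * ?g u)) absolutely_integrable_on {0<..}"
    using 1 by (rule set_integrable_mult_right)
  then show "?g absolutely_integrable_on {0<..}" by simp
  have "((\<lambda>u. (1/2) * (2 * ?g u)) has_integral (1/2) * integral {0<..} ?f) {0<..}"
    by (rule has_integral_mult_right[OF 2])
  then have "integral {0<..} ?g = (1/2) * integral {0<..} ?f" by (simp add: integral_unique)
  then show "integral {0<..} ?g = of_real pi / (2 * sin (of_real pi * z / 2)) *
           (of_real b powr (z - 2) - of_real c powr (z - 2)) / of_real (c\<^sup>2 - b\<^sup>2)"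
    unfolding J(2) pw[OF bc(1)] pw[OF bc(2)] by simp
qed

section \<open>Entire functions of exponential type bounded on the line\<close>

text \<open>\<open>z * csqrt z\<close> is z^(3/2). In the sector |arg z| <= pi / 4 its argument is
  at most 3 pi / 8 in modulus, and the cosine of that angle exceeds 1 / 4.\<close>

lemma Re_mult_csqrt_ge:
  assumes "\<bar>Im z\<bar> \<le> Re z"
  shows "Re (z * csqrt z) \<ge> cmod z * sqrt (cmod z) / 4"
proof (cases "z = 0")
  case False
  define r where "r = cmod z"
  define x where "x = Re z"
  have r: "r > 0" using False by (simp add: r_def)
  have xr: "x \<le> r" using complex_Re_le_cmod[of z] by (simp add: x_def r_def)
  have x0: "x \<ge> 0" using assms by (simp add: x_def)
  have "\<bar>Im z\<bar>\<^sup>2 \<le> x\<^sup>2" using assms by (intro power_mono) (auto simp: x_def)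
  then have r2: "r\<^sup>2 \<le> 2 * x\<^sup>2" by (simp add: r_def x_def cmod_power2)
  \<comment> \<open>\<open>p\<close> and \<open>m\<close> are the real part of
    \<open>csqrt z\<close> and the modulus of its imaginary part.\<close>
  define p where "p = sqrt ((r + x) / 2)"
  define m where "m = sqrt ((r - x) / 2)"
  have pm: "p \<ge> 0" "m \<ge> 0" "p\<^sup>2 = (r + x) / 2" "m\<^sup>2 = (r - x) / 2"
    using r x0 xr by (auto simp: p_def m_def)
  have p_le: "p \<le> sqrt r" unfolding p_def using xr by (intro real_sqrt_le_mono) auto
  have m_le: "m \<le> p" unfolding p_def m_def using x0 by (intro real_sqrt_le_mono) auto
  have p0: "sqrt r > 0" using r by simp
  have "x = (p - m) * (p + m)" using pm by (simp add: power2_eq_square algebra_simps)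
  also have "\<dots> \<le> (p - m) * (2 * sqrt r)" using m_le p_le by (intro mult_left_mono) auto
  finally have "x / (2 * sqrt r) \<le> p - m" using p0 by (simp add: field_simps)
  then have "x * (x / (2 * sqrt r)) \<le> x * (p - m)" using x0 by (intro mult_left_mono)
  moreover have "r * sqrt r / 4 \<le> x * (x / (2 * sqrt r))"
  proof -
    have "r * sqrt r / 4 * (2 * sqrt r) = r\<^sup>2 / 2"
      using r by (simp add: power2_eq_square)
    also have "\<dots> \<le> x * x" using r2 by (simp add: power2_eq_square)
    finally show ?thesis using p0 by (simp add: field_simps)
  qed
  moreover have "x * (p - m) \<le> Re (z * csqrt z)"
  proof -
    have "\<bar>Im z * Im (csqrt z)\<bar> \<le> x * m"
      using assms pm by (auto simp: abs_mult m_def r_def x_def abs_sgn_eq intro!: mult_mono)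
    moreover have "Re (csqrt z) = p" by (simp add: p_def r_def x_def)
    ultimately show ?thesis by (simp add: x_def algebra_simps)
  qed
  ultimately show ?thesis unfolding r_def by linarith
qed auto

text \<open>In a sector of opening pi / 2 the critical order of growth is 2, while f has order at
  most 1. Damping by exp(-\<delta> z^(3/2)), of an order strictly between, makes f small on large
  arcs; the maximum modulus principle on a truncated sector then gives the bound M, and \<delta>
  tends to 0.\<close>

lemma Phragmen_Lindelof_sector:
  fixes f :: "complex \<Rightarrow> complex"
  assumes hol: "f holomorphic_on UNIV"
    and growth: "\<And>z. \<bar>Im z\<bar> \<le> Re z \<Longrightarrow> cmod (f z) \<le> A * exp (B * cmod z)"
    and bdry: "\<And>z. \<bar>Im z\<bar> = Re z \<Longrightarrow> cmod (f z) \<le> M"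
    and "A > 0" and "B > 0" and "M > 0" and \<xi>: "\<bar>Im \<xi>\<bar> \<le> Re \<xi>"
  shows "cmod (f \<xi>) \<le> M"
proof -
  let ?w = "\<lambda>z. z * csqrt z"
  define S where "S = {z. \<bar>Im z\<bar> \<le> Re z}"
  have main: "cmod (f \<xi> * exp (- (of_real \<delta> * ?w \<xi>))) \<le> M" if \<delta>: "\<delta> > 0" for \<delta> :: real
  proof -
    have "((\<lambda>R. A * exp (B * R) * exp (- (\<delta> * (R * sqrt R / 4)))) \<longlongrightarrow> 0) at_top"
      using \<delta> \<open>A > 0\<close> \<open>B > 0\<close> by real_asymp
    then have "\<forall>\<^sub>F R in at_top. A * exp (B * R) * exp (- (\<delta> * (R * sqrt R / 4))) < M"
      using \<open>M > 0\<close> by (rule order_tendstoD)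
    then have "\<forall>\<^sub>F R in at_top. A * exp (B * R) * exp (- (\<delta> * (R * sqrt R / 4))) < M \<and> R > cmod \<xi>"
      using eventually_gt_at_top by (rule eventually_conj)
    from eventually_happens'[OF trivial_limit_at_top_linorder this]
    obtain R where R: "A * exp (B * R) * exp (- (\<delta> * (R * sqrt R / 4))) < M" "R > cmod \<xi>" by blast
    define T where "T = S \<inter> cball 0 R"
    have S1: "S = {z. Im z \<le> Re z} \<inter> {z. - Im z \<le> Re z}" by (auto simp: S_def)
    have clS: "closed S" unfolding S1
      by (intro closed_Int closed_Collect_le continuous_intros)
    have clT: "closed T" unfolding T_def using clS by auto
    have opS: "open {z. \<bar>Im z\<bar> < Re z}"
      by (intro open_Collect_less continuous_intros)
    have frontier: "\<bar>Im z\<bar> = Re z \<or> cmod z = R" if "z \<in> frontier T" for z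
    proof (rule ccontr)
      assume *: "\<not> ?thesis"
      have "z \<in> T" using that clT by (auto simp: frontier_def)
      with * have "z \<in> {z. \<bar>Im z\<bar> < Re z} \<inter> ball 0 R" by (auto simp: T_def S_def)
      moreover have "open ({z. \<bar>Im z\<bar> < Re z} \<inter> ball 0 R)" using opS by auto
      moreover have "{z. \<bar>Im z\<bar> < Re z} \<inter> ball 0 R \<subseteq> T" by (auto simp: T_def S_def)
      ultimately have "z \<in> interior T" by (auto simp: interior_def)
      with that show False by (simp add: frontier_def)
    qed
    \<comment> \<open>Interior points stay clear of the branch cut of \<open>csqrt\<close>, so the
      damping factor is holomorphic there; at the vertex 0 only continuity enters.\<close>
    have sub: "interior T \<subseteq> {z. Re z > 0}"
    proof
      fix z assume z: "z \<in> interior T"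
      then obtain e where e: "e > 0" "ball z e \<subseteq> T" by (meson mem_interior)
      have "z - of_real (e / 2) \<in> ball z e" using e by (simp add: dist_norm)
      with e have "z - of_real (e / 2) \<in> T" by blast
      then have "0 \<le> Re z - e / 2" by (auto simp: T_def S_def)
      with e show "z \<in> {z. Re z > 0}" by simp
    qed
    have nn: "z \<notin> \<real>\<^sub>\<le>\<^sub>0" if "Re z > 0" for z using that by (auto simp: complex_nonpos_Reals_iff)
    have wcont: "continuous_on T ?w"
      unfolding continuous_on_eq_continuous_within
    proof
      fix z assume z: "z \<in> T"
      show "continuous (at z within T) ?w"
      proof (cases "z = 0")
        case True
        have "((\<lambda>z. ?w z) \<longlongrightarrow> 0) (at 0)"
        proof (rule Lim_null_comparison)
          show "\<forall>\<^sub>F z in at 0. norm (?w z) \<le> cmod z * sqrt (cmod z)"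
            by (auto simp: norm_mult)
          show "((\<lambda>z::complex. cmod z * sqrt (cmod z)) \<longlongrightarrow> 0) (at 0)"
            by (rule tendsto_eq_intros refl | simp)+
        qed
        then show ?thesis using True by (auto simp: continuous_within intro: tendsto_within_subset)
      next
        case False
        with z have "z \<notin> \<real>\<^sub>\<le>\<^sub>0" by (auto simp: T_def S_def complex_nonpos_Reals_iff complex_eq_iff)
        then show ?thesis by (intro continuous_intros continuous_within_csqrt)
      qed
    qed
    show ?thesis
    proof (rule maximum_modulus_frontier[of "\<lambda>z. f z * exp (- (of_real \<delta> * ?w z))" T])
      show "(\<lambda>z. f z * exp (- (of_real \<delta> * ?w z))) holomorphic_on interior T"
        using sub nn by (intro holomorphic_intros holomorphic_on_subset[OF hol]) auto
      show "continuous_on (closure T) (\<lambda>z. f z * exp (- (of_real \<delta> * ?w z)))"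
        using clT wcont holomorphic_on_imp_continuous_on[OF hol]
        by (auto intro!: continuous_intros intro: continuous_on_subset)
      show "bounded T" by (auto simp: T_def)
      show "\<xi> \<in> T" using \<xi> R by (auto simp: T_def S_def)
      fix z assume z: "z \<in> frontier T"
      then have zT: "z \<in> T" using clT by (auto simp: frontier_def)
      then have zS: "\<bar>Im z\<bar> \<le> Re z" by (auto simp: T_def S_def)
      have eq: "cmod (f z * exp (- (of_real \<delta> * ?w z))) = cmod (f z) * exp (- (\<delta> * Re (?w z)))"
        by (simp add: norm_mult norm_exp_eq_Re del: csqrt.sel)
      have w: "\<delta> * (cmod z * sqrt (cmod z) / 4) \<le> \<delta> * Re (?w z)"
        using Re_mult_csqrt_ge[OF zS] \<delta> by (intro mult_left_mono) auto
      show "cmod (f z * exp (- (of_real \<delta> * ?w z))) \<le> M"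
        using frontier[OF z]
      proof
        assume b: "\<bar>Im z\<bar> = Re z"
        have "0 \<le> \<delta> * (cmod z * sqrt (cmod z) / 4)" using \<delta> by simp
        with w have "exp (- (\<delta> * Re (?w z))) \<le> 1" by (simp del: csqrt.sel)
        then have "cmod (f z) * exp (- (\<delta> * Re (?w z))) \<le> M * 1"
          using bdry[OF b] \<open>M > 0\<close> by (intro mult_mono) auto
        then show ?thesis unfolding eq by simp
      next
        assume b: "cmod z = R"
        have "cmod (f z) * exp (- (\<delta> * Re (?w z))) \<le> (A * exp (B * R)) * exp (- (\<delta> * (R * sqrt R / 4)))"
          using growth[OF zS] w b by (intro mult_mono) (auto intro: order_trans[OF norm_ge_zero])
        then show ?thesis unfolding eq using R by linarith
      qed
    qed
  qed
  have "((\<lambda>\<delta>::real. cmod (f \<xi> * exp (- (of_real \<delta> * ?w \<xi>)))) \<longlongrightarrow> cmod (f \<xi> * exp (- (of_real 0 * ?w \<xi>)))) (at_right 0)"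
    by (intro tendsto_intros)
  moreover have "\<forall>\<^sub>F \<delta> in at_right (0::real). cmod (f \<xi> * exp (- (of_real \<delta> * ?w \<xi>))) \<le> M"
    using main by (auto simp: eventually_at_filter)
  ultimately have "cmod (f \<xi> * exp (- (of_real 0 * ?w \<xi>))) \<le> M"
    by (intro tendsto_upperbound) auto
  then show ?thesis by simp
qed

text \<open>Multiplied by exp(i (\<sigma> + 2 \<epsilon>) z), the function stays bounded by M on the
  real line and decays along the positive imaginary axis, since the type costs only \<sigma> +
  \<epsilon>. The sector lemma bounds it in each quadrant by the larger of M and its supremum on
  that axis; a supremum above M would be attained inside the half-plane, against the maximum modulus
  principle.\<close>

lemma Phragmen_Lindelof_upper_halfplane:
  fixes f :: "complex \<Rightarrow> complex"
  assumes hol: "f holomorphic_on UNIV" and et: "exponential_type \<sigma> f"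
    and bdry: "\<And>x::real. cmod (f (of_real x)) \<le> M" and M: "M > 0" and \<sigma>: "\<sigma> \<ge> 0"
    and z: "Im z \<ge> 0"
  shows "cmod (f z) \<le> M * exp (\<sigma> * Im z)"
proof -
  have main: "cmod (f z) \<le> M * exp ((\<sigma> + 2 * \<epsilon>) * Im z)" if \<epsilon>: "\<epsilon> > 0" and z: "Im z \<ge> 0" for \<epsilon> z
  proof -
    obtain A where A: "A > 0" "\<And>z. cmod (f z) \<le> A * exp ((\<sigma> + \<epsilon>) * cmod z)"
      using et \<epsilon> unfolding exponential_type_def by metis
    define F where "F z = f z * exp (\<i> * of_real (\<sigma> + 2 * \<epsilon>) * z)" for z
    have normF: "cmod (F z) = cmod (f z) * exp (- ((\<sigma> + 2 * \<epsilon>) * Im z))" for z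
      unfolding F_def by (simp add: norm_mult norm_exp_eq_Re)
    have holF: "F holomorphic_on UNIV" unfolding F_def by (intro holomorphic_intros hol)
    have contF: "continuous_on UNIV F" using holF by (rule holomorphic_on_imp_continuous_on)
    have Freal: "cmod (F (of_real x)) \<le> M" for x :: real using bdry by (simp add: normF)
    have Fimag: "cmod (F (\<i> * of_real y)) \<le> A * exp (- (\<epsilon> * y))" if "y \<ge> 0" for y
    proof -
      have "cmod (F (\<i> * of_real y)) \<le> A * exp ((\<sigma> + \<epsilon>) * y) * exp (- ((\<sigma> + 2 * \<epsilon>) * y))"
        unfolding normF using A(2)[of "\<i> * of_real y"] A(1) that by (intro mult_mono) (auto simp: norm_mult)
      also have "\<dots> = A * exp (- (\<epsilon> * y))" by (simp add: algebra_simps flip: exp_add)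
      finally show ?thesis .
    qed
    have growth: "cmod (F z) \<le> A * exp ((\<sigma> + \<epsilon>) * cmod z)" if "Im z \<ge> 0" for z
    proof -
      have "cmod (F z) \<le> (A * exp ((\<sigma> + \<epsilon>) * cmod z)) * 1"
        unfolding normF using A(1) A(2)[of z] that \<sigma> \<epsilon> by (intro mult_mono) auto
      then show ?thesis by simp
    qed
    have bnd: "cmod (F z) \<le> K" if K: "K > 0" "M \<le> K" "\<And>y. y \<ge> 0 \<Longrightarrow> cmod (F (\<i> * of_real y)) \<le> K"
      and z: "Im z \<ge> 0" for z K
    proof -
      \<comment> \<open>Multiplication by 1 + i or -1 + i carries the sector |arg w| <= pi / 4 onto
        the first or second quadrant; the modulus sqrt 2 of these factors is absorbed in the bound
        2.\<close>
      have quad: "cmod (F (c * w)) \<le> K" if c: "c \<noteq> 0" "cmod c \<le> 2" "\<And>w. \<bar>Im w\<bar> \<le> Re w \<Longrightarrow> Im (c * w) \<ge> 0"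
        "\<And>w. \<bar>Im w\<bar> = Re w \<Longrightarrow> cmod (F (c * w)) \<le> K" and w: "\<bar>Im w\<bar> \<le> Re w" for c w
      proof (rule Phragmen_Lindelof_sector[of "\<lambda>w. F (c * w)" A "(\<sigma> + \<epsilon>) * 2"])
        show "(\<lambda>w. F (c * w)) holomorphic_on UNIV"
          using holomorphic_on_compose_gen[OF _ holF, of "\<lambda>w. c * w" UNIV] by (simp add: o_def holomorphic_intros)
        fix z :: complex assume "\<bar>Im z\<bar> \<le> Re z"
        then have "cmod (F (c * z)) \<le> A * exp ((\<sigma> + \<epsilon>) * cmod (c * z))" by (intro growth c)
        also have "\<dots> \<le> A * exp ((\<sigma> + \<epsilon>) * 2 * cmod z)"
        proof -
          have "cmod (c * z) \<le> 2 * cmod z" unfolding norm_mult using c(2) by (intro mult_right_mono) auto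
          then have "(\<sigma> + \<epsilon>) * cmod (c * z) \<le> (\<sigma> + \<epsilon>) * (2 * cmod z)"
            using \<sigma> \<epsilon> by (intro mult_left_mono) auto
          then have "exp ((\<sigma> + \<epsilon>) * cmod (c * z)) \<le> exp ((\<sigma> + \<epsilon>) * 2 * cmod z)" by (simp only: exp_le_cancel_iff mult.assoc)
          then show ?thesis using A(1) by (intro mult_left_mono) auto
        qed
        finally show "cmod (F (c * z)) \<le> A * exp ((\<sigma> + \<epsilon>) * 2 * cmod z)" .
      qed (use c K w A(1) \<sigma> \<epsilon> in auto)
      show ?thesis
      proof (cases "Re z \<ge> 0")
        case True
        let ?c = "1 + \<i>"
        let ?w = "z * (1 - \<i>) / 2"
        have "cmod (F (?c * ?w)) \<le> K"
        proof (rule quad)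
          show "cmod ?c \<le> 2" using norm_triangle_ineq[of 1 "\<i>"] by simp
          fix w :: complex assume w: "\<bar>Im w\<bar> = Re w"
          show "cmod (F (?c * w)) \<le> K"
          proof (cases "Im w \<ge> 0")
            case True
            with w have "?c * w = \<i> * of_real (2 * Re w)" by (auto simp: complex_eq_iff)
            then show ?thesis using K(3)[of "2 * Re w"] w by auto
          next
            case False
            with w have "?c * w = of_real (2 * Re w)" by (auto simp: complex_eq_iff)
            then show ?thesis using Freal[of "2 * Re w"] K by simp
          qed
        qed (use True z in \<open>auto simp: complex_eq_iff\<close>)
        also have "?c * ?w = z" by (auto simp: complex_eq_iff)
        finally show ?thesis .
      next
        case False
        let ?c = "-1 + \<i>"
        let ?w = "z * (-1 - \<i>) / 2"
        have "cmod (F (?c * ?w)) \<le> K"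
        proof (rule quad)
          show "cmod ?c \<le> 2" using norm_triangle_ineq[of "-1" "\<i>"] by simp
          fix w :: complex assume w: "\<bar>Im w\<bar> = Re w"
          show "cmod (F (?c * w)) \<le> K"
          proof (cases "Im w \<ge> 0")
            case False
            with w have "?c * w = \<i> * of_real (2 * Re w)" by (auto simp: complex_eq_iff)
            then show ?thesis using K(3)[of "2 * Re w"] w by auto
          next
            case True
            with w have "?c * w = of_real (- 2 * Re w)" by (auto simp: complex_eq_iff)
            then show ?thesis using Freal[of "- 2 * Re w"] K by simp
          qed
        qed (use False z in \<open>auto simp: complex_eq_iff\<close>)
        also have "?c * ?w = z" by (auto simp: complex_eq_iff)
        finally show ?thesis .
      qed
    qed
    have "((\<lambda>y. A * exp (- (\<epsilon> * y))) \<longlongrightarrow> 0) at_top" using \<epsilon> by real_asymp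
    then have "\<forall>\<^sub>F y in at_top. A * exp (- (\<epsilon> * y)) < M" using M by (rule order_tendstoD)
    then have "\<forall>\<^sub>F y in at_top. A * exp (- (\<epsilon> * y)) < M \<and> y > 0"
      using eventually_gt_at_top by (rule eventually_conj)
    from eventually_happens'[OF trivial_limit_at_top_linorder this]
    obtain Y where Y: "Y > 0" "A * exp (- (\<epsilon> * Y)) < M" by blast
    have FY: "cmod (F (\<i> * of_real y)) < M" if "y \<ge> Y" for y
    proof -
      have "cmod (F (\<i> * of_real y)) \<le> A * exp (- (\<epsilon> * y))" using that Y by (intro Fimag) auto
      also have "\<dots> \<le> A * exp (- (\<epsilon> * Y))" using A \<epsilon> that by simp
      finally show ?thesis using Y by linarith
    qed
    \<comment> \<open>Beyond Y the modulus on the imaginary axis is below M, so only the compact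
      segment up to Y can produce a larger supremum.\<close>
    have "continuous_on {0..Y} (\<lambda>y. cmod (F (\<i> * of_real y)))"
      by (intro continuous_intros continuous_on_compose2[OF contF]) auto
    then obtain y0 where y0: "y0 \<in> {0..Y}" "\<And>y. y \<in> {0..Y} \<Longrightarrow> cmod (F (\<i> * of_real y)) \<le> cmod (F (\<i> * of_real y0))"
      using continuous_attains_sup[of "{0..Y}" "\<lambda>y. cmod (F (\<i> * of_real y))"] Y by auto
    have "cmod (F z) \<le> M"
    proof (cases "cmod (F (\<i> * of_real y0)) \<le> M")
      case True
      show ?thesis
      proof (rule bnd[OF M order_refl _ z])
        show "cmod (F (\<i> * of_real y)) \<le> M" if "y \<ge> 0" for y
          using FY[of y] y0(2)[of y] True that by (cases "y \<ge> Y") auto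
      qed
    next
      case False
      define K where "K = cmod (F (\<i> * of_real y0))"
      have KM: "K > M" using False by (simp add: K_def)
      have imK: "cmod (F (\<i> * of_real y)) \<le> K" if "y \<ge> 0" for y
        using FY[of y] y0(2)[of y] KM that by (cases "y \<ge> Y") (auto simp: K_def)
      have y0pos: "y0 > 0"
      proof (rule ccontr)
        assume "\<not> y0 > 0"
        then have "y0 = 0" using y0 by simp
        then show False using Freal[of 0] KM by (simp add: K_def)
      qed
      \<comment> \<open>With an interior maximum at i y0 the function would be constant, but at i Y
        its modulus is already below M.\<close>
      let ?U = "{z. Im z > 0}"
      have "F constant_on ?U"
      proof (rule maximum_modulus_principle[of F ?U ?U "\<i> * of_real y0"])
        show "open ?U" by (rule open_halfspace_Im_gt)
        show "connected ?U" by (intro convex_connected convex_halfspace_Im_gt)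
        show "cmod (F z) \<le> cmod (F (\<i> * of_real y0))" if "z \<in> ?U" for z
        proof -
          have "cmod (F z) \<le> K" by (rule bnd) (use KM M imK that in auto)
          then show ?thesis by (simp add: K_def)
        qed
      qed (use holF y0pos in \<open>auto intro: holomorphic_on_subset open_halfspace_Im_gt\<close>)
      then have "F (\<i> * of_real y0) = F (\<i> * of_real Y)"
        unfolding constant_on_def using y0pos Y by fastforce
      then show ?thesis using FY[of Y] KM by (simp add: K_def)
    qed
    then have "cmod (f z) * exp (- ((\<sigma> + 2 * \<epsilon>) * Im z)) \<le> M" unfolding normF .
    then have "cmod (f z) * exp (- ((\<sigma> + 2 * \<epsilon>) * Im z)) * exp ((\<sigma> + 2 * \<epsilon>) * Im z) \<le> M * exp ((\<sigma> + 2 * \<epsilon>) * Im z)"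
      by (rule mult_right_mono) simp
    then show ?thesis by (simp only: mult.assoc exp_minus_inverse mult_exp_exp) simp
  qed
  have "((\<lambda>\<epsilon>::real. M * exp ((\<sigma> + 2 * \<epsilon>) * Im z)) \<longlongrightarrow> M * exp ((\<sigma> + 2 * 0) * Im z)) (at_right 0)"
    by (intro tendsto_intros)
  moreover have "\<forall>\<^sub>F \<epsilon> in at_right (0::real). cmod (f z) \<le> M * exp ((\<sigma> + 2 * \<epsilon>) * Im z)"
    using main z by (auto simp: eventually_at_filter)
  ultimately have "cmod (f z) \<le> M * exp ((\<sigma> + 2 * 0) * Im z)"
    by (intro tendsto_lowerbound) auto
  then show ?thesis by simp
qed

lemma exponential_type_bounded_on_reals:
  fixes f :: "complex \<Rightarrow> complex"
  assumes hol: "f holomorphic_on UNIV" and et: "exponential_type \<sigma> f"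
    and bdry: "\<And>x::real. cmod (f (of_real x)) \<le> M" and M: "M > 0" and \<sigma>: "\<sigma> \<ge> 0"
  shows "cmod (f z) \<le> M * exp (\<sigma> * \<bar>Im z\<bar>)"
proof (cases "Im z \<ge> 0")
  case True
  then show ?thesis using Phragmen_Lindelof_upper_halfplane[OF assms, of z] by simp
next
  case False
  have "(\<lambda>z. f (- z)) holomorphic_on UNIV"
    using holomorphic_on_compose_gen[OF _ hol, of uminus UNIV] by (simp add: o_def holomorphic_intros)
  moreover have "exponential_type \<sigma> (\<lambda>z. f (- z))"
    unfolding exponential_type_def
  proof (intro allI impI)
    fix \<epsilon> :: real assume "\<epsilon> > 0"
    then obtain C where "C > 0" "\<And>z. cmod (f z) \<le> C * exp ((\<sigma> + \<epsilon>) * cmod z)"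
      using et unfolding exponential_type_def by metis
    then show "\<exists>C>0. \<forall>z. cmod (f (- z)) \<le> C * exp ((\<sigma> + \<epsilon>) * cmod z)"
      by (metis norm_minus_cancel)
  qed
  moreover have "cmod (f (- of_real x)) \<le> M" for x using bdry[of "- x"] by simp
  ultimately show ?thesis
    using Phragmen_Lindelof_upper_halfplane[of "\<lambda>z. f (- z)" \<sigma> M "- z"] False M \<sigma> by simp
qed


section \<open>Dividing by the sine\<close>

lemma norm_sin_ge:
  assumes "\<bar>Im z\<bar> \<ge> 1 \<or> cos (2 * Re z) = - 1"
  shows "cmod (sin z) \<ge> exp \<bar>Im z\<bar> / 4"
proof -
  define E where "E = exp (2 * \<bar>Im z\<bar>)"
  have E1: "E \<ge> 1" by (simp add: E_def)
  have eq: "(cmod (sin z))\<^sup>2 = (E + inverse E - 2 * cos (2 * Re z)) / 4"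
    unfolding norm_sin_squared E_def by (cases "Im z \<ge> 0") (simp_all add: exp_minus add.commute)
  have "(exp \<bar>Im z\<bar> / 4)\<^sup>2 = E / 16" by (simp add: E_def power_divide flip: exp_double)
  also have "\<dots> \<le> (E + inverse E - 2 * cos (2 * Re z)) / 4"
  proof (cases "cos (2 * Re z) = - 1")
    case False
    with assms have "2 * \<bar>Im z\<bar> \<ge> 2" by simp
    then have "1 + 2 * \<bar>Im z\<bar> \<ge> 3" by simp
    \<comment> \<open>The value 3 is enough because (E - 2) / 4 >= E / 16 as soon as E >= 8 /
      3.\<close>
    then have "E \<ge> 3" unfolding E_def using exp_ge_add_one_self[of "2 * \<bar>Im z\<bar>"] by linarith
    moreover have "cos (2 * Re z) \<le> 1" "inverse E \<ge> 0" using E1 by auto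
    moreover have "E / 16 \<le> (E + i - 2 * c) / 4" if "3 \<le> E" "c \<le> 1" "0 \<le> i" for i c :: real
      using that by simp
    ultimately show ?thesis by blast
  next
    case True
    have "inverse E \<ge> 0" using E1 by auto
    with True E1 show ?thesis by simp
  qed
  also have "\<dots> = (cmod (sin z))\<^sup>2" by (rule eq[symmetric])
  finally show ?thesis by (rule power2_le_imp_le) auto
qed

text \<open>\<open>h / sin\<close> is entire and bounded: away from the real axis and on the vertical lines
  \<open>Re z \<in> \<pi> / 2 + \<pi> \<int>\<close> by the size of \<open>sin\<close>, and inside the rectangles cut out by
  these lines by the maximum modulus principle.\<close>

lemma bounded_type_one_vanishing_at_sin_zeros:
  fixes h :: "complex \<Rightarrow> complex"
  assumes hol: "h holomorphic_on UNIV" and et: "exponential_type 1 h"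
    and bdry: "\<And>x::real. cmod (h (of_real x)) \<le> M"
    and zeros: "\<And>n::int. h (of_real (pi * of_int n)) = 0"
  obtains c where "\<And>z. h z = c * sin z"
proof -
  define M' where "M' = \<bar>M\<bar> + 1"
  have M': "M' > 0" by (simp add: M'_def)
  have "cmod (h (of_real x)) \<le> M'" for x using bdry[of x] by (simp add: M'_def)
  from exponential_type_bounded_on_reals[OF hol et this M']
  have hb: "cmod (h z) \<le> M' * exp \<bar>Im z\<bar>" for z by simp
  have hz: "h z = 0" if "sin z = 0" for z
  proof -
    from that obtain n :: int where "z = of_real (of_int n * pi)" by (auto simp: sin_eq_0)
    then have "z = of_real (pi * of_int n)" by (simp only: mult.commute)
    then show ?thesis using zeros by simp
  qed
  have sc: "cos z \<noteq> 0" if "sin z = 0" for z :: complex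
    using that sin_cos_squared_add[of z] by auto
  \<comment> \<open>The quotient h / sin, completed by its limit at the zeros of sin, which are all
    simple.\<close>
  define G where "G z = (if sin z = 0 then deriv h z / cos z else h z / sin z)" for z
  have near: "\<exists>e>0. \<forall>w\<in>ball z e - {z}. sin w \<noteq> 0" for z :: complex
  proof -
    show ?thesis
    proof (cases "sin z = 0")
      case True
      have "sin (complex_of_real (pi / 2)) \<noteq> 0" unfolding sin_of_real by simp
      show ?thesis
        by (rule isolated_zeros[of sin UNIV z "of_real (pi / 2)"])
           (use True \<open>sin (complex_of_real (pi / 2)) \<noteq> 0\<close> in \<open>auto simp: holomorphic_on_sin\<close>)
    next
      case False
      have "continuous (at z) (sin :: complex \<Rightarrow> complex)" by (intro continuous_intros)
      then obtain e where "e > 0" "\<forall>w. dist z w < e \<longrightarrow> sin w \<noteq> 0"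
        using continuous_at_avoid[of z sin 0] False by auto
      then show ?thesis by auto
    qed
  qed
  have holG: "G holomorphic_on UNIV"
  proof -
    have "G field_differentiable (at z)" for z
    proof -
      obtain e where e: "e > 0" "\<forall>w\<in>ball z e - {z}. sin w \<noteq> 0" using near by blast
      have "G holomorphic_on ball z e"
      proof (rule no_isolated_singularity'[of "{z}"])
        have "(\<lambda>w. h w / sin w) holomorphic_on (ball z e - {z})"
          using e by (intro holomorphic_intros holomorphic_on_subset[OF hol]) auto
        then show "G holomorphic_on (ball z e - {z})"
          by (rule holomorphic_transform) (use e in \<open>auto simp: G_def\<close>)
        fix w assume "w \<in> {z}"
        have ev: "\<forall>\<^sub>F x in at z. sin x \<noteq> 0"
          using e unfolding eventually_at by (intro exI[of _ e]) (auto simp: dist_commute)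
        have "(G \<longlongrightarrow> G z) (at z)"
        proof (cases "sin z = 0")
          case True
          have "((\<lambda>w. h w / sin w) \<longlongrightarrow> deriv h z / cos z) (at z)"
            using sc[OF True] hz[OF True] True
            by (intro lhopital_complex_simple) (auto intro!: derivative_eq_intros holomorphic_derivI[OF hol])
          moreover have "G z = deriv h z / cos z" using True by (simp add: G_def)
          moreover have "(G \<longlongrightarrow> l) (at z) = ((\<lambda>w. h w / sin w) \<longlongrightarrow> l) (at z)" for l
            by (rule tendsto_cong) (use ev in \<open>auto simp: G_def elim: eventually_mono\<close>)
          ultimately show ?thesis by simp
        next
          case False
          have "((\<lambda>w. h w / sin w) \<longlongrightarrow> h z / sin z) (at z)"
            using False holomorphic_on_imp_continuous_on[OF hol]
            by (intro tendsto_intros) (auto simp: continuous_on_def)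
          moreover have "G z = h z / sin z" using False by (simp add: G_def)
          moreover have "(G \<longlongrightarrow> l) (at z) = ((\<lambda>w. h w / sin w) \<longlongrightarrow> l) (at z)" for l
            by (rule tendsto_cong) (use ev in \<open>auto simp: G_def elim: eventually_mono\<close>)
          ultimately show ?thesis by simp
        qed
        then show "(G \<longlongrightarrow> G w) (at w within ball z e)" using \<open>w \<in> {z}\<close> tendsto_within_subset by blast
      qed auto
      then show ?thesis using e by (auto simp: holomorphic_on_open field_differentiable_def)
    qed
    then show ?thesis by (simp add: holomorphic_on_def)
  qed
  have hG: "h z = G z * sin z" for z using hz[of z] by (simp add: G_def)
  have Gb0: "cmod (G z) \<le> 4 * M'" if "\<bar>Im z\<bar> \<ge> 1 \<or> cos (2 * Re z) = - 1" for z
  proof -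
    have s: "cmod (sin z) \<ge> exp \<bar>Im z\<bar> / 4" using that by (rule norm_sin_ge)
    then have "cmod (G z) * (exp \<bar>Im z\<bar> / 4) \<le> cmod (G z) * cmod (sin z)" by (intro mult_left_mono) auto
    also have "\<dots> \<le> M' * exp \<bar>Im z\<bar>" using hb[of z] unfolding hG norm_mult .
    finally have "(cmod (G z) / 4) * exp \<bar>Im z\<bar> \<le> M' * exp \<bar>Im z\<bar>" by simp
    then show ?thesis by (simp only: mult_le_cancel_right) simp
  qed
  have Gb: "cmod (G z) \<le> 4 * M'" for z
  proof (cases "\<bar>Im z\<bar> \<ge> 1")
    case False
    \<comment> \<open>\<open>x0\<close> and \<open>x1\<close> are the neighbours of Re z in pi / 2 +
      pi Z, where cos(2 x) = -1. With the lines |Im| = 1 they enclose z in a rectangle on whose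
      frontier the bound is already known.\<close>
    define k where "k = \<lfloor>(Re z - pi / 2) / pi\<rfloor>"
    define x0 where "x0 = pi / 2 + pi * of_int k"
    define x1 where "x1 = pi / 2 + pi * of_int (k + 1)"
    have "of_int k \<le> (Re z - pi / 2) / pi" "(Re z - pi / 2) / pi < of_int k + 1"
      unfolding k_def by linarith+
    then have "x0 \<le> Re z" "Re z \<le> x1" by (auto simp: x0_def x1_def field_simps)
    have cosm: "cos (2 * (pi / 2 + pi * of_int j)) = - 1" for j :: int
    proof -
      have "cos (2 * (pi / 2 + pi * of_int j)) = cos (pi + 2 * pi * of_int j)" by (simp add: algebra_simps)
      then show ?thesis by (simp add: cos_add cos_int_2pin sin_int_2pin)
    qed
    let ?S = "cbox (Complex x0 (-1)) (Complex x1 1)"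
    show ?thesis
    proof (rule maximum_modulus_frontier[of G ?S])
      show "z \<in> ?S" using False \<open>x0 \<le> Re z\<close> \<open>Re z \<le> x1\<close> by (auto simp: in_cbox_complex_iff)
      fix w assume "w \<in> frontier ?S"
      then have "w \<in> ?S - box (Complex x0 (-1)) (Complex x1 1)"
        by (simp add: frontier_def interior_cbox)
      then have "Im w = 1 \<or> Im w = -1 \<or> Re w = x0 \<or> Re w = x1"
        by (auto simp: in_cbox_complex_iff in_box_complex_iff)
      then have "\<bar>Im w\<bar> \<ge> 1 \<or> cos (2 * Re w) = - 1"
        using cosm[of k] cosm[of "k + 1"] by (auto simp: x0_def x1_def)
      then show "cmod (G w) \<le> 4 * M'" by (rule Gb0)
    qed (auto intro: holomorphic_on_subset[OF holG] continuous_on_subset[OF holomorphic_on_imp_continuous_on[OF holG]] bounded_cbox)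
  qed (use Gb0 in auto)
  have "G constant_on UNIV"
    using holG by (rule Liouville_theorem) (use Gb in \<open>auto simp: bounded_iff\<close>)
  then obtain c where "\<And>z. G z = c" by (auto simp: constant_on_def)
  with hG have "h z = c * sin z" for z by simp
  then show thesis by (rule that)
qed

section \<open>Partial fractions of the kernel\<close>

text \<open>Logarithmic differentiation of the reflection formula: Gamma(w) Gamma(1 - w) sin(pi w)
  is constant off the integers, and its derivative at z contains the nonvanishing factor Gamma(z)
  Gamma(1 - z).\<close>

lemma Digamma_reflection_complex:
  fixes z :: complex
  assumes "z \<notin> \<int>"
  shows "Digamma (1 - z) - Digamma z = of_real pi * cot (of_real pi * z)"
proof -
  have sub: "\<int>\<^sub>\<le>\<^sub>0 \<subseteq> (\<int> :: complex set)" by (rule nonpos_Ints_subset_Ints)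
  have z1: "1 - z \<notin> \<int>" using assms by (metis Ints_1 Ints_diff diff_diff_eq2 add_diff_cancel_left')
  have nz: "z \<notin> \<int>\<^sub>\<le>\<^sub>0" "1 - z \<notin> \<int>\<^sub>\<le>\<^sub>0" using assms z1 sub by auto
  have sinz: "sin (of_real pi * w) \<noteq> 0" if "w \<notin> \<int>" for w :: complex
    using that by (auto simp: sin_eq_0)
  let ?f = "\<lambda>w. Gamma w * Gamma (1 - w) * sin (of_real pi * w)"
  let ?d = "Gamma z * Gamma (1 - z) * ((Digamma z - Digamma (1 - z)) * sin (of_real pi * z)
       + of_real pi * cos (of_real pi * z))"
  have "(?f has_field_derivative ?d) (at z)"
    using nz by (auto intro!: derivative_eq_intros simp: algebra_simps)
  moreover have "(?f has_field_derivative 0) (at z)"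
  proof (rule has_field_derivative_transform_within_open[of "\<lambda>_. of_real pi" _ _ "- \<int>"])
    show "of_real pi = ?f w" if "w \<in> - \<int>" for w :: complex
      using sinz[of w] that by (simp add: Gamma_reflection_complex)
  qed (use assms in \<open>auto simp: closed_Ints intro!: derivative_eq_intros\<close>)
  ultimately have "?d = 0" by (rule DERIV_unique)
  moreover have "Gamma z \<noteq> 0" "Gamma (1 - z) \<noteq> 0" using nz by (auto simp: Gamma_eq_zero_iff)
  ultimately have "(Digamma z - Digamma (1 - z)) * sin (of_real pi * z) + of_real pi * cos (of_real pi * z) = 0"
    by simp
  then have "(Digamma (1 - z) - Digamma z) * sin (of_real pi * z) = of_real pi * cos (of_real pi * z)"
    by (simp add: algebra_simps eq_neg_iff_add_eq_0)
  then show ?thesis using sinz[OF assms] by (simp add: cot_def field_simps)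
qed

text \<open>The limits that represent the two Digamma values contain the same logarithm, which
  cancels in their difference.\<close>

lemma cot_partial_fractions:
  fixes z :: complex
  assumes "z \<notin> \<int>"
  shows "(\<lambda>M. \<Sum>k<M. 1 / (z + of_nat k) - 1 / (1 - z + of_nat k)) \<longlonglongrightarrow> of_real pi * cot (of_real pi * z)"
proof -
  have "z \<noteq> 0" "1 - z \<noteq> 0" using assms by auto
  then have "(\<lambda>m. (of_real (ln (real m)) - (\<Sum>n<m. inverse (1 - z + of_nat n))) -
      (of_real (ln (real m)) - (\<Sum>n<m. inverse (z + of_nat n)))) \<longlonglongrightarrow> Digamma (1 - z) - Digamma z"
    by (intro tendsto_diff Digamma_LIMSEQ)
  then show ?thesis
    unfolding Digamma_reflection_complex[OF assms]
    by (simp add: sum_subtractf inverse_eq_divide)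
qed

text \<open>Separates the constant i, which weights of vanishing sum annihilate, from a term that a
  finite geometric sum can expand.\<close>

lemma cot_exp_eq:
  assumes "sin z \<noteq> 0"
  shows "cot z = \<i> + 2 * \<i> / (exp (2 * \<i> * z) - 1)"
proof -
  have e: "exp (2 * \<i> * z) = exp (\<i> * z) * exp (\<i> * z)" by (metis exp_add mult.assoc mult_2)
  define E where "E = exp (\<i> * z)"
  have E: "E \<noteq> 0" "exp (- (\<i> * z)) = 1 / E" by (auto simp: E_def exp_minus inverse_eq_divide)
  have s: "sin z = (E * E - 1) / (2 * \<i> * E)" and c: "cos z = (E * E + 1) / (2 * E)"
    unfolding sin_exp_eq cos_exp_eq E(2) E_def[symmetric] using E(1) by (simp_all add: field_simps)
  have "E * E - 1 \<noteq> 0" using assms unfolding s by auto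
  then have "cot z = \<i> + 2 * \<i> / (E * E - 1)"
    unfolding cot_def s c using E(1) by (simp add: field_simps)
  then show ?thesis unfolding e E_def .
qed

section \<open>Finite Fourier analysis modulo q\<close>

lemma sum_lessThan_eq_from_1:
  fixes f :: "nat \<Rightarrow> 'a::comm_monoid_add"
  assumes "f 0 = 0" "q > 0"
  shows "(\<Sum>r<q. f r) = (\<Sum>r=1..q-1. f r)"
proof -
  have "{..<q} = insert 0 {1..q-1}" using assms(2) by auto
  then show ?thesis using assms(1) by simp
qed

lemma exp_2pi_i_of_int: "exp (2 * of_real pi * \<i> * of_int n) = 1"
  using exp_integer_2pi[of "of_int n"] by (simp add: mult_ac)

lemma sum_roots_of_unity:
  fixes m :: int and q :: nat
  assumes "q > 0"
  shows "(\<Sum>r<q. exp (2 * of_real pi * \<i> * of_nat r * of_int m / of_nat q)) =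
           (if int q dvd m then of_nat q else 0)"
proof -
  let ?w = "exp (2 * of_real pi * \<i> * of_int m / of_nat q)"
  have "?w ^ r = exp (2 * of_real pi * \<i> * of_nat r * of_int m / of_nat q)" for r
    by (simp add: exp_of_nat_mult[symmetric] algebra_simps)
  then have eq: "(\<Sum>r<q. exp (2 * of_real pi * \<i> * of_nat r * of_int m / of_nat q)) = (\<Sum>r<q. ?w ^ r)" by simp
  have wq: "?w ^ q = 1"
    using assms exp_2pi_i_of_int[of m] by (simp add: exp_of_nat_mult[symmetric])
  have w1: "?w = 1 \<longleftrightarrow> int q dvd m"
  proof -
    have "?w = 1 \<longleftrightarrow> (\<exists>n::int. of_int m / real q = of_int n)"
      using assms unfolding exp_eq_1 by (auto simp: field_simps)
    also have "\<dots> \<longleftrightarrow> (\<exists>n::int. real_of_int m = of_int (int q * n))" using assms by (simp add: field_simps)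
    also have "\<dots> \<longleftrightarrow> int q dvd m" unfolding of_int_eq_iff by (auto simp: dvd_def)
    finally show ?thesis .
  qed
  show ?thesis
  proof (cases "int q dvd m")
    case True
    then show ?thesis unfolding eq using w1 by simp
  next
    case False
    then show ?thesis unfolding eq using w1 wq by (simp add: geometric_sum)
  qed
qed

text \<open>The character values enter the kernel as weights \<open>x l\<close>; their vanishing sum
  removes the pole of 1 / sinh at 0.\<close>

locale zero_sum_weights =
  fixes q :: nat and x :: "nat \<Rightarrow> complex"
  assumes q: "q > 1" and sum_x: "(\<Sum>l=1..q-1. x l) = 0"
begin

definition Wcos :: "nat \<Rightarrow> complex" where
  "Wcos n = (\<Sum>l=1..q-1. x l * of_real (cos (2 * pi * real n * real l / real q)))"

definition Wsin :: "nat \<Rightarrow> complex" where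
  "Wsin n = (\<Sum>l=1..q-1. x l * of_real (sin (2 * pi * real n * real l / real q)))"

text \<open>In the residue of \<open>K\<close> at i pi n the sign (-1)^n of the numerator cancels
  against cosh(i pi n), which leaves this finite Fourier transform. Its sign convention is opposite
  to that of \<open>E_set\<close>.\<close>

definition Wexp :: "int \<Rightarrow> complex" where
  "Wexp n = (\<Sum>l=1..q-1. x l * exp (- (2 * of_real pi * \<i> * of_int n * of_nat l / of_nat q)))"

definition K :: "complex \<Rightarrow> complex" where
  "K u = (\<Sum>l=1..q-1. x l * exp ((1 - 2 * of_nat l / of_nat q) * u)) / sinh u"

text \<open>The contribution of the poles \<open>\<plusminus> i \<pi> n\<close> of the kernel, whose residues are \<open>Wexp (\<plusminus> n)\<close>; for \<open>n = 0\<close>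
  it is \<open>0\<close>, as the weights sum to \<open>0\<close>.\<close>

definition pole_pair :: "complex \<Rightarrow> nat \<Rightarrow> complex" where
  "pole_pair u n = (2 * u * Wcos n + 2 * of_real (pi * real n) * Wsin n) / (u\<^sup>2 + of_real ((pi * real n)\<^sup>2))"

lemma Wexp_int: "Wexp (int n) = Wcos n - \<i> * Wsin n" "Wexp (- int n) = Wcos n + \<i> * Wsin n"
proof -
  have e: "exp (\<i> * of_real t) = of_real (cos t) + \<i> * of_real (sin t)" for t
    by (simp add: exp_Euler cos_of_real sin_of_real)
  have "Wexp (int n) = (\<Sum>l=1..q-1. x l * exp (\<i> * of_real (- (2 * pi * real n * real l / real q))))"
    unfolding Wexp_def by (intro sum.cong refl arg_cong2[of _ _ _ _ "(*)"] arg_cong[of _ _ exp]) (simp add: algebra_simps)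
  also have "\<dots> = Wcos n - \<i> * Wsin n"
    unfolding e by (simp add: Wcos_def Wsin_def sum_distrib_left algebra_simps flip: sum_subtractf)
  finally show "Wexp (int n) = Wcos n - \<i> * Wsin n" .
  have "Wexp (- int n) = (\<Sum>l=1..q-1. x l * exp (\<i> * of_real (2 * pi * real n * real l / real q)))"
    unfolding Wexp_def by (intro sum.cong refl arg_cong2[of _ _ _ _ "(*)"] arg_cong[of _ _ exp]) (simp add: algebra_simps)
  also have "\<dots> = Wcos n + \<i> * Wsin n"
    unfolding e by (simp add: Wcos_def Wsin_def sum_distrib_left algebra_simps flip: sum.distrib)
  finally show "Wexp (- int n) = Wcos n + \<i> * Wsin n" .
qed

lemma Wexp_0: "Wexp 0 = 0" unfolding Wexp_def using sum_x by simp

lemma Wexp_periodic: "Wexp (n + k * int q) = Wexp n"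
proof -
  have "exp (- (2 * of_real pi * \<i> * of_int (n + k * int q) * of_nat l / of_nat q)) =
        exp (- (2 * of_real pi * \<i> * of_int n * of_nat l / of_nat q))" for l
  proof -
    have "- (2 * of_real pi * \<i> * of_int (n + k * int q) * of_nat l / of_nat q) =
      - (2 * of_real pi * \<i> * of_int n * of_nat l / of_nat q) + 2 * of_real pi * \<i> * of_int (- (k * int l))"
      using q by (simp add: field_simps)
    moreover have "exp (2 * of_real pi * \<i> * of_int (- (k * int l))) = 1"
      by (rule exp_2pi_i_of_int)
    ultimately show ?thesis by (simp only: exp_add) simp
  qed
  then show ?thesis by (simp add: Wexp_def)
qed

text \<open>Fourier inversion: after swapping the sums only l = j survives. At index 0, outside the
  range of l, the weight counts as 0.\<close>

lemma sum_Wexp_root: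
  assumes "j < q"
  shows "(\<Sum>r<q. Wexp (int r) * exp (2 * of_real pi * \<i> * of_nat r * of_nat j / of_nat q)) =
           (if j = 0 then 0 else of_nat q * x j)"
proof -
  have "(\<Sum>r<q. Wexp (int r) * exp (2 * of_real pi * \<i> * of_nat r * of_nat j / of_nat q)) =
     (\<Sum>r<q. \<Sum>l=1..q-1. x l * exp (2 * of_real pi * \<i> * of_nat r * of_int (int j - int l) / of_nat q))"
    unfolding Wexp_def sum_distrib_right mult.assoc exp_add[symmetric]
    by (intro sum.cong refl arg_cong2[of _ _ _ _ "(*)"] arg_cong[of _ _ exp]) (simp add: algebra_simps diff_divide_distrib)
  also have "\<dots> = (\<Sum>l=1..q-1. x l * (\<Sum>r<q. exp (2 * of_real pi * \<i> * of_nat r * of_int (int j - int l) / of_nat q)))"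
    by (subst sum.swap) (simp add: sum_distrib_left)
  also have "\<dots> = (\<Sum>l=1..q-1. x l * (if l = j then of_nat q else 0))"
  proof (intro sum.cong refl arg_cong2[of _ _ _ _ "(*)"])
    fix l assume l: "l \<in> {1..q-1}"
    have "int q dvd (int j - int l) \<longleftrightarrow> l = j"
    proof
      assume "int q dvd int j - int l"
      moreover have "\<bar>int j - int l\<bar> < int q" using l assms by auto
      ultimately have "int j - int l = 0" by (metis dvd_imp_le_int zdvd_not_zless abs_of_nat linorder_not_le)
      then show "l = j" by simp
    qed simp
    with sum_roots_of_unity[of q "int j - int l"] q
    show "(\<Sum>r<q. exp (2 * of_real pi * \<i> * of_nat r * of_int (int j - int l) / of_nat q)) = (if l = j then of_nat q else 0)"
      by simp
  qed
  also have "\<dots> = (if j = 0 then 0 else of_nat q * x j)"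
    using assms by (simp add: if_distrib sum.delta cong: if_cong)
  finally show ?thesis .
qed

lemma sum_Wexp: "(\<Sum>r<q. Wexp (int r)) = 0"
  using sum_Wexp_root[of 0] q by simp

lemma sum_Wexp_neg: "(\<Sum>r<q. Wexp (- int r)) = 0"
proof -
  have "(\<Sum>r<q. Wexp (- int r)) = (\<Sum>r=1..q-1. Wexp (- int r))"
    using Wexp_0 q by (intro sum_lessThan_eq_from_1) auto
  also have "\<dots> = (\<Sum>r=1..q-1. Wexp (int r))"
  proof (rule sum.reindex_bij_witness[of _ "\<lambda>r. q - r" "\<lambda>r. q - r"])
    fix r assume "r \<in> {1..q-1}"
    then have "int (q - r) = - int r + 1 * int q" by auto
    then show "Wexp (int (q - r)) = Wexp (- int r)" by (simp only: Wexp_periodic)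
  qed auto
  also have "\<dots> = (\<Sum>r<q. Wexp (int r))"
    using Wexp_0 q by (intro sum_lessThan_eq_from_1[symmetric]) auto
  finally show ?thesis using sum_Wexp by simp
qed

text \<open>With X = exp(2 pi i r / q) T one has X^q = T^q for every r, so 1 / (X - 1) is a
  geometric sum over the common denominator T^q - 1. Fourier inversion in r returns the weights, and
  the constant i of the cotangent drops out because the \<open>Wexp\<close> over a period sum to
  0.\<close>

lemma sum_Wexp_cot:
  assumes v: "v \<notin> \<int>"
  defines "T \<equiv> exp (- (2 * of_real pi * \<i> * v / of_nat q))"
  shows "(\<Sum>r<q. Wexp (int r) * cot (of_real pi * ((of_nat r - v) / of_nat q))) =
           2 * \<i> * of_nat q * (\<Sum>l=1..q-1. x l * T ^ l) / (T ^ q - 1)"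
proof -
  have Tq: "T ^ q = exp (- (2 * of_real pi * \<i> * v))"
    unfolding T_def using q by (simp add: exp_of_nat_mult[symmetric])
  have Tq1: "T ^ q \<noteq> 1"
  proof
    assume "T ^ q = 1"
    then obtain n :: int where "Re (2 * of_real pi * \<i> * v) = 0" "Im (- (2 * of_real pi * \<i> * v)) = of_int (2 * n) * pi"
      unfolding Tq exp_eq_1 by auto
    then have "pi * (Re v + of_int n) = 0" "Im v = 0" by (auto simp: algebra_simps)
    then have "v = of_int (- n)" by (auto simp: complex_eq_iff)
    with v show False by (metis Ints_of_int)
  qed
  let ?X = "\<lambda>r. exp (2 * of_real pi * \<i> * of_nat r / of_nat q) * T"
  have Xq: "?X r ^ q = T ^ q" for r
  proof -
    have "exp (2 * of_real pi * \<i> * of_nat r / of_nat q) ^ q = 1"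
      using q exp_2pi_i_of_int[of "int r"] by (simp add: exp_of_nat_mult[symmetric])
    then show ?thesis by (simp only: power_mult_distrib mult_1)
  qed
  have X1: "?X r \<noteq> 1" for r using Xq[of r] Tq1 by auto
  have cot: "cot (of_real pi * ((of_nat r - v) / of_nat q)) = \<i> + 2 * \<i> / (T ^ q - 1) * (\<Sum>j<q. ?X r ^ j)" for r
  proof -
    let ?z = "of_real pi * ((of_nat r - v) / of_nat q)"
    have X: "exp (2 * \<i> * ?z) = ?X r"
      unfolding T_def exp_add[symmetric] using q by (intro arg_cong[of _ _ exp]) (simp add: field_simps)
    have "sin ?z \<noteq> 0"
    proof
      assume "sin ?z = 0"
      then have "exp (\<i> * ?z) = exp (- (\<i> * ?z))" by (simp add: sin_exp_eq)
      moreover have "exp (2 * \<i> * ?z) = exp (\<i> * ?z) * exp (\<i> * ?z)" by (metis exp_add mult.assoc mult_2)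
      ultimately have "exp (2 * \<i> * ?z) = 1" using exp_minus_inverse[of "\<i> * ?z"] by metis
      with X X1 show False by simp
    qed
    then have "cot ?z = \<i> + 2 * \<i> / (?X r - 1)" using cot_exp_eq X by simp
    also have "1 / (?X r - 1) = (\<Sum>j<q. ?X r ^ j) / (T ^ q - 1)"
    proof -
      have "(\<Sum>j<q. ?X r ^ j) = (T ^ q - 1) / (?X r - 1)"
        unfolding Xq[of r, symmetric] using X1[of r] by (rule geometric_sum)
      then show ?thesis using Tq1 by simp
    qed
    then have "2 * \<i> / (?X r - 1) = 2 * \<i> / (T ^ q - 1) * (\<Sum>j<q. ?X r ^ j)"
      by (metis (no_types, opaque_lifting) mult.right_neutral times_divide_eq_left times_divide_eq_right)
    finally show ?thesis .
  qed
  have "(\<Sum>r<q. Wexp (int r) * cot (of_real pi * ((of_nat r - v) / of_nat q))) =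
     \<i> * (\<Sum>r<q. Wexp (int r)) + 2 * \<i> / (T ^ q - 1) * (\<Sum>r<q. Wexp (int r) * (\<Sum>j<q. ?X r ^ j))"
    unfolding cot by (simp add: distrib_left sum.distrib sum_distrib_left mult_ac)
  also have "(\<Sum>r<q. Wexp (int r) * (\<Sum>j<q. ?X r ^ j)) =
     (\<Sum>j<q. T ^ j * (\<Sum>r<q. Wexp (int r) * exp (2 * of_real pi * \<i> * of_nat r * of_nat j / of_nat q)))"
    by (subst sum_distrib_left, subst sum.swap)
       (simp add: sum_distrib_left power_mult_distrib exp_of_nat_mult[symmetric] mult_ac)
  also have "\<dots> = (\<Sum>j<q. T ^ j * (if j = 0 then 0 else of_nat q * x j))"
    using sum_Wexp_root by (intro sum.cong refl) auto
  also have "\<dots> = (\<Sum>j=1..q-1. of_nat q * (x j * T ^ j))"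
    using q by (subst sum_lessThan_eq_from_1) (auto intro!: sum.cong)
  also have "\<dots> = of_nat q * (\<Sum>l=1..q-1. x l * T ^ l)" by (rule sum_distrib_left[symmetric])
  finally show ?thesis unfolding sum_Wexp by simp
qed

lemma pole_pair_eq_Wexp:
  assumes "u - \<i> * of_real (pi * real n) \<noteq> 0" "u + \<i> * of_real (pi * real n) \<noteq> 0"
  shows "pole_pair u n = Wexp (int n) / (u - \<i> * of_real (pi * real n)) + Wexp (- int n) / (u + \<i> * of_real (pi * real n))"
proof -
  let ?w = "\<i> * of_real (pi * real n)"
  have "?w\<^sup>2 = - of_real ((pi * real n)\<^sup>2)" by (simp add: power_mult_distrib)
  then have d: "u\<^sup>2 + of_real ((pi * real n)\<^sup>2) = (u - ?w) * (u + ?w)"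
    by (simp add: algebra_simps power2_eq_square)
  have "Wexp (int n) / (u - ?w) + Wexp (- int n) / (u + ?w) =
      (Wexp (int n) * (u + ?w) + Wexp (- int n) * (u - ?w)) / ((u - ?w) * (u + ?w))"
    using assms by (rule add_frac_eq)
  also have "Wexp (int n) * (u + ?w) + Wexp (- int n) * (u - ?w) = 2 * u * Wcos n + 2 * of_real (pi * real n) * Wsin n"
    unfolding Wexp_int by (simp add: algebra_simps)
  finally show ?thesis unfolding pole_pair_def d by simp
qed

text \<open>Sorting the poles by their index modulo q makes the weight constant on each class, and
  each class sums to a cotangent. Adding the q cotangent series term by term yields partial sums
  over whole blocks of length q.\<close>

theorem K_partial_fractions:
  assumes u: "sinh u \<noteq> 0"
  shows "(\<lambda>M. \<Sum>n<M*q. pole_pair u n) \<longlonglongrightarrow> K u"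
proof -
  \<comment> \<open>In the variable v the poles of the kernel become the integers.\<close>
  define v where "v = - \<i> * u / of_real pi"
  have uv: "u = \<i> * of_real pi * v" by (simp add: v_def)
  have v: "v \<notin> \<int>"
  proof
    assume "v \<in> \<int>"
    then obtain n :: int where n: "v = of_int n" by (auto elim: Ints_cases)
    have "sinh u = \<i> * sin (of_real (of_int n * pi))"
      unfolding uv n sinh_conv_sin by (simp add: algebra_simps)
    also have "sin (of_real (of_int n * pi) :: complex) = 0" unfolding sin_eq_0 by blast
    finally show False using u by simp
  qed
  have vn: "of_nat n - v \<noteq> 0" "of_nat n + v \<noteq> 0" for n
  proof -
    show "of_nat n - v \<noteq> 0" using v by (metis Ints_of_nat eq_iff_diff_eq_0)
    show "of_nat n + v \<noteq> 0" using v by (metis Ints_of_nat Ints_minus eq_neg_iff_add_eq_0 add.commute)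
  qed
  have z: "(of_nat r - v) / of_nat q \<notin> \<int>" for r
  proof
    assume "(of_nat r - v) / of_nat q \<in> \<int>"
    then obtain n :: int where "(of_nat r - v) / of_nat q = of_int n" by (auto elim: Ints_cases)
    then have "v = of_int (int r - n * int q)" using q by (simp add: field_simps)
    with v show False by (metis Ints_of_int)
  qed
  define T where "T = exp (- (2 * of_real pi * \<i> * v / of_nat q))"
  let ?s = "\<lambda>r k. Wexp (int r) * (1 / ((of_nat r - v) / of_nat q + of_nat k) - 1 / (1 - (of_nat r - v) / of_nat q + of_nat k))"
  have "(\<lambda>M. \<Sum>r<q. Wexp (int r) * (\<Sum>k<M. 1 / ((of_nat r - v) / of_nat q + of_nat k) - 1 / (1 - (of_nat r - v) / of_nat q + of_nat k)))
     \<longlonglongrightarrow> (\<Sum>r<q. Wexp (int r) * (of_real pi * cot (of_real pi * ((of_nat r - v) / of_nat q))))"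
    by (intro tendsto_sum tendsto_mult tendsto_const cot_partial_fractions z)
  also have "(\<Sum>r<q. Wexp (int r) * (of_real pi * cot (of_real pi * ((of_nat r - v) / of_nat q)))) =
     of_real pi * (2 * \<i> * of_nat q * (\<Sum>l=1..q-1. x l * T ^ l) / (T ^ q - 1))"
    unfolding T_def sum_Wexp_cot[OF v, symmetric] by (simp add: sum_distrib_left mult_ac)
  also have "(\<lambda>M. \<Sum>r<q. Wexp (int r) * (\<Sum>k<M. 1 / ((of_nat r - v) / of_nat q + of_nat k) - 1 / (1 - (of_nat r - v) / of_nat q + of_nat k)))
     = (\<lambda>M. \<Sum>n<M*q. of_nat q * (Wexp (int n) / (of_nat n - v) - Wexp (- int n) / (of_nat n + v)))"
  proof
    fix M
    let ?g1 = "\<lambda>n. of_nat q * (Wexp (int n) / (of_nat n - v))"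
    let ?g2 = "\<lambda>n. of_nat q * (Wexp (- int n) / (of_nat n + v))"
    have block: "(\<Sum>r<q. ?s r k) = (\<Sum>n=k*q..<k*q+q. ?g1 n - ?g2 n)" for k
    proof -
      have g1: "Wexp (int r) * (1 / ((of_nat r - v) / of_nat q + of_nat k)) = ?g1 (r + k * q)" for r
      proof -
        have "of_nat (r + k * q) - v \<noteq> 0" using vn by blast
        then have "1 / ((of_nat r - v) / of_nat q + of_nat k) = of_nat q / (of_nat (r + k * q) - v)"
          using q by (simp add: field_simps)
        moreover have "Wexp (int (r + k * q)) = Wexp (int r)"
          using Wexp_periodic[of "int r" "int k"] by simp
        ultimately show ?thesis by (simp add: mult_ac)
      qed
      \<comment> \<open>The second half of the cotangent series of class r belongs to the poles -n
        with n = q - r + k q. As r varies, this covers 1..q rather than 0..q - 1 within the block;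
        both ends carry weight 0, so the ranges may be exchanged.\<close>
      have g2: "Wexp (int r) * (1 / (1 - (of_nat r - v) / of_nat q + of_nat k)) = ?g2 ((q - r) + k * q)" if "r < q" for r
      proof -
        have ne: "of_nat ((q - r) + k * q) + v \<noteq> 0" using vn by blast
        have "of_nat ((q - r) + k * q) = (of_nat q - of_nat r + of_nat k * of_nat q :: complex)" using that by simp
        with ne have "1 / (1 - (of_nat r - v) / of_nat q + of_nat k) = of_nat q / (of_nat ((q - r) + k * q) + v)"
          using q by (simp add: field_simps)
        moreover have "- int ((q - r) + k * q) = int r + (- 1 - int k) * int q" using that by (simp add: algebra_simps)
        then have "Wexp (- int ((q - r) + k * q)) = Wexp (int r)" by (simp only: Wexp_periodic)
        ultimately show ?thesis by (simp add: mult_ac)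
      qed
      have z2: "?g2 (k * q) = 0" for k
      proof -
        have "- int (k * q) = 0 + (- int k) * int q" by simp
        then have "Wexp (- int (k * q)) = Wexp 0" by (simp only: Wexp_periodic)
        then show ?thesis by (simp add: Wexp_0)
      qed
      have "(\<Sum>r<q. ?s r k) = (\<Sum>r<q. ?g1 (r + k * q)) - (\<Sum>r<q. Wexp (int r) * (1 / (1 - (of_nat r - v) / of_nat q + of_nat k)))"
        unfolding g1[symmetric] right_diff_distrib sum_subtractf ..
      also have "(\<Sum>r<q. Wexp (int r) * (1 / (1 - (of_nat r - v) / of_nat q + of_nat k))) = (\<Sum>r<q. ?g2 ((q - r) + k * q))"
        using g2 by (intro sum.cong) auto
      also have "\<dots> = (\<Sum>r=1..q-1. ?g2 ((q - r) + k * q))"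
        using z2[of "k + 1"] q by (intro sum_lessThan_eq_from_1) auto
      also have "\<dots> = (\<Sum>r=1..q-1. ?g2 (r + k * q))"
        by (rule sum.reindex_bij_witness[of _ "\<lambda>r. q - r" "\<lambda>r. q - r"]) auto
      also have "\<dots> = (\<Sum>r<q. ?g2 (r + k * q))"
        using z2[of k] q by (intro sum_lessThan_eq_from_1[symmetric]) auto
      also have "(\<Sum>r<q. ?g1 (r + k * q)) - (\<Sum>r<q. ?g2 (r + k * q)) = (\<Sum>r=0..<q. ?g1 (r + k * q) - ?g2 (r + k * q))"
        by (simp add: sum_subtractf atLeast0LessThan)
      also have "\<dots> = (\<Sum>n=0+k*q..<q+k*q. ?g1 n - ?g2 n)"
        by (rule sum.shift_bounds_nat_ivl[symmetric])
      finally show ?thesis by (simp add: add.commute)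
    qed
    have "(\<Sum>r<q. Wexp (int r) * (\<Sum>k<M. 1 / ((of_nat r - v) / of_nat q + of_nat k) - 1 / (1 - (of_nat r - v) / of_nat q + of_nat k)))
       = (\<Sum>k<M. \<Sum>r<q. ?s r k)"
      unfolding sum_distrib_left by (rule sum.swap)
    also have "\<dots> = (\<Sum>k<M. \<Sum>n=k*q..<k*q+q. ?g1 n - ?g2 n)" unfolding block ..
    also have "\<dots> = (\<Sum>n<M*q. ?g1 n - ?g2 n)" by (rule sum.nat_group)
    finally show "(\<Sum>r<q. Wexp (int r) * (\<Sum>k<M. 1 / ((of_nat r - v) / of_nat q + of_nat k) - 1 / (1 - (of_nat r - v) / of_nat q + of_nat k)))
       = (\<Sum>n<M*q. of_nat q * (Wexp (int n) / (of_nat n - v) - Wexp (- int n) / (of_nat n + v)))"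
      by (simp only: right_diff_distrib)
  qed
  also have "(\<lambda>M. \<Sum>n<M*q. of_nat q * (Wexp (int n) / (of_nat n - v) - Wexp (- int n) / (of_nat n + v)))
     = (\<lambda>M. - (\<i> * of_real pi * of_nat q) * (\<Sum>n<M*q. pole_pair u n))"
  proof
    fix M
    have "of_nat q * (Wexp (int n) / (of_nat n - v) - Wexp (- int n) / (of_nat n + v)) = - (\<i> * of_real pi * of_nat q) * pole_pair u n" for n
    proof -
      have m: "u - \<i> * of_real (pi * real n) = - (\<i> * of_real pi) * (of_nat n - v)"
        and p: "u + \<i> * of_real (pi * real n) = (\<i> * of_real pi) * (of_nat n + v)"
        unfolding uv by (simp_all add: algebra_simps)
      have t: "pole_pair u n = Wexp (int n) / (- (\<i> * of_real pi) * (of_nat n - v)) + Wexp (- int n) / ((\<i> * of_real pi) * (of_nat n + v))"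
        unfolding m[symmetric] p[symmetric] by (rule pole_pair_eq_Wexp) (unfold m p, use vn in auto)
      have c: "c * (a / (- c * y1) + b / (c * y2)) = - (a / y1 - b / y2)" if "c \<noteq> 0" "y1 \<noteq> 0" "y2 \<noteq> 0" for a b c y1 y2 :: complex
        using that by (simp add: field_simps)
      have "(\<i> * of_real pi) * pole_pair u n = - (Wexp (int n) / (of_nat n - v) - Wexp (- int n) / (of_nat n + v))"
        unfolding t by (rule c) (use vn in auto)
      then have "- of_nat q * ((\<i> * of_real pi) * pole_pair u n) = of_nat q * (Wexp (int n) / (of_nat n - v) - Wexp (- int n) / (of_nat n + v))"
        by (simp only: minus_mult_minus)
      then show ?thesis by (simp add: mult_ac)
    qed
    then show "(\<Sum>n<M*q. of_nat q * (Wexp (int n) / (of_nat n - v) - Wexp (- int n) / (of_nat n + v)))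
       = - (\<i> * of_real pi * of_nat q) * (\<Sum>n<M*q. pole_pair u n)"
      by (simp only: sum_distrib_left)
  qed
  finally have "(\<lambda>M. - (\<i> * of_real pi * of_nat q) * (\<Sum>n<M*q. pole_pair u n)) \<longlonglongrightarrow>
      of_real pi * (2 * \<i> * of_nat q * (\<Sum>l=1..q-1. x l * T ^ l) / (T ^ q - 1))" .
  then have "(\<lambda>M. (- (\<i> * of_real pi * of_nat q) * (\<Sum>n<M*q. pole_pair u n)) / (- (\<i> * of_real pi * of_nat q))) \<longlonglongrightarrow>
      (of_real pi * (2 * \<i> * of_nat q * (\<Sum>l=1..q-1. x l * T ^ l) / (T ^ q - 1))) / (- (\<i> * of_real pi * of_nat q))"
    by (rule tendsto_divide[OF _ tendsto_const]) (use q in simp)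
  then have "(\<lambda>M. \<Sum>n<M*q. pole_pair u n) \<longlonglongrightarrow>
      (of_real pi * (2 * \<i> * of_nat q * (\<Sum>l=1..q-1. x l * T ^ l) / (T ^ q - 1))) / (- (\<i> * of_real pi * of_nat q))"
    using q by simp
  also have "(of_real pi * (2 * \<i> * of_nat q * (\<Sum>l=1..q-1. x l * T ^ l) / (T ^ q - 1))) / (- (\<i> * of_real pi * of_nat q))
     = 2 * (\<Sum>l=1..q-1. x l * T ^ l) / (1 - T ^ q)"
  proof -
    have "pi' * (2 * \<i> * q' * S / (Y - 1)) / (- (\<i> * pi' * q')) = 2 * S / (1 - Y)"
      if "pi' \<noteq> 0" "q' \<noteq> 0" for pi' q' S Y :: complex
    proof -
      have "pi' * (2 * \<i> * q' * S / (Y - 1)) / (- (\<i> * pi' * q')) = - (2 * S / (Y - 1))"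
        using that by simp
      then show ?thesis by (metis minus_diff_eq minus_divide_right)
    qed
    note eq = this
    show ?thesis by (rule eq) (use q in auto)
  qed
  also have "\<dots> = K u"
  proof -
    \<comment> \<open>For this T the quotient is the kernel, because T^q = exp(-2 u) and sinh u =
      exp u (1 - exp(-2 u)) / 2.\<close>
    have Tl: "T ^ l = exp (- (2 * of_nat l / of_nat q) * u)" for l
      unfolding T_def uv by (simp add: exp_of_nat_mult[symmetric] mult_ac)
    have Tq: "T ^ q = exp (- u) * exp (- u)" using q unfolding Tl exp_add[symmetric] by simp
    have s: "sinh u = exp u * (1 - T ^ q) / 2"
      unfolding Tq sinh_field_def exp_minus by (simp add: field_simps)
    have "K u = exp u * (\<Sum>l=1..q-1. x l * T ^ l) / sinh u"
    proof -
      have "exp ((1 - 2 * of_nat l / of_nat q) * u) = exp u * T ^ l" for l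
      proof -
        have "(1 - 2 * of_nat l / of_nat q) * u = u + - (2 * of_nat l / of_nat q) * u" by (simp add: left_diff_distrib)
        then show ?thesis unfolding Tl by (simp only: exp_add)
      qed
      then have "K u = (\<Sum>l=1..q-1. x l * (exp u * T ^ l)) / sinh u" unfolding K_def by (simp only:)
      also have "(\<Sum>l=1..q-1. x l * (exp u * T ^ l)) = exp u * (\<Sum>l=1..q-1. x l * T ^ l)"
        by (simp only: sum_distrib_left mult.left_commute)
      finally show ?thesis .
    qed
    then show ?thesis unfolding s by simp
  qed
  finally show ?thesis .
qed

section \<open>Bounds uniform in the number of blocks\<close>

lemma cmod_Wexp_le: "cmod (Wexp n) \<le> (\<Sum>l=1..q-1. cmod (x l))"
proof -
  have "cmod (exp (- (2 * of_real pi * \<i> * of_int n * of_nat l / of_nat q))) = 1" for l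
    by (simp add: norm_exp_eq_Re)
  then show ?thesis unfolding Wexp_def by (intro order_trans[OF norm_sum]) (simp add: norm_mult)
qed

text \<open>Each block of \<open>q\<close> consecutive indices has vanishing weight sum, which gains a second power
  of the block number over the individual terms.\<close>

lemma pole_block_bound:
  fixes c :: "nat \<Rightarrow> complex" and u e :: real and k :: nat
  assumes c0: "(\<Sum>j<q. c j) = 0" "c 0 = 0" and A: "\<And>j. cmod (c j) \<le> A"
    and u: "u > 0" and e: "\<bar>e\<bar> = pi"
  shows "cmod (\<Sum>j<q. c j / (of_real u - \<i> * of_real (e * real (k * q + j)))) \<le> real q * A * (4 * inverse ((real k + 1)\<^sup>2))"
proof -
  define w where "w n = of_real u - \<i> * of_real (e * real n)" for n
  have w: "cmod (w n) \<ge> pi * real n" for n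
    using abs_Im_le_cmod[of "w n"] e by (simp add: w_def abs_mult)
  have w0: "w n \<noteq> 0" for n using u by (auto simp: w_def complex_eq_iff)
  have A0: "A \<ge> 0" using A[of 0] norm_ge_zero order_trans by blast
  show ?thesis
  \<comment> \<open>In the first block the denominator at index 0 is u itself and may be arbitrarily
    small; there the weight is 0. In later blocks every denominator is compared with the one at k q,
    whose total contribution vanishes.\<close>
  proof (cases "k = 0")
    case True
    have "cmod (c j / w j) \<le> A" if "j < q" for j
    proof (cases "j = 0")
      case False
      have "1 \<le> pi * real j" using False pi_ge_two mult_mono[of 1 pi 1 "real j"] by simp
      then have "cmod (w j) \<ge> 1" using w[of j] by linarith
      then have "cmod (c j) / cmod (w j) \<le> A / 1" using A A0 by (intro frac_le) auto
      then show ?thesis by (simp add: norm_divide)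
    qed (use c0 A0 in auto)
    then have "cmod (\<Sum>j<q. c j / w j) \<le> real q * A"
      using sum_norm_bound[of "{..<q}" "\<lambda>j. c j / w j" A] by simp
    also have "\<dots> \<le> real q * A * 4" using A0 by simp
    finally show ?thesis using True by (simp add: w_def)
  next
    case False
    have "cmod (c j / w (k * q + j) - c j / w (k * q)) \<le> A * (4 * inverse ((real k + 1)\<^sup>2))" if j: "j < q" for j
    proof -
      have "c j / w (k * q + j) - c j / w (k * q) = c j * ((w (k * q) - w (k * q + j)) / (w (k * q + j) * w (k * q)))"
        using w0 by (simp add: field_simps)
      also have "w (k * q) - w (k * q + j) = \<i> * of_real (e * real j)"
        by (simp add: w_def algebra_simps)
      finally have "cmod (c j / w (k * q + j) - c j / w (k * q)) = cmod (c j) * (pi * real j / (cmod (w (k * q + j)) * cmod (w (k * q))))"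
        using e by (simp add: norm_mult norm_divide abs_mult)
      also have "\<dots> \<le> A * (pi * real q / ((pi * real (k * q)) * (pi * real (k * q))))"
      proof (intro mult_mono frac_le A A0)
        have "pi * real (k * q) \<le> pi * real (k * q + j)" by simp
        with w[of "k * q + j"] show "pi * real (k * q) \<le> cmod (w (k * q + j))" by linarith
      qed (use j w[of "k * q"] q False in auto)
      also have "\<dots> = A * (1 / (pi * real q * (real k)\<^sup>2))"
        using q by (simp add: power2_eq_square)
      also have "\<dots> \<le> A * (4 * inverse ((real k + 1)\<^sup>2))"
      proof (intro mult_left_mono A0)
        \<comment> \<open>The constant 4 pays for replacing k by k + 1, as k + 1 <= 2 k for k >=
          1.\<close>
        have "(real k + 1)\<^sup>2 \<le> (2 * real k)\<^sup>2" using False by (intro power_mono) auto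
        also have "\<dots> = 4 * (1 * (real k)\<^sup>2)" by (simp add: power_mult_distrib)
        also have "\<dots> \<le> 4 * (pi * real q * (real k)\<^sup>2)"
          using q pi_ge_two mult_mono[of 1 pi 1 "real q"] by (intro mult_left_mono mult_right_mono) auto
        finally have "(real k + 1)\<^sup>2 \<le> 4 * (pi * real q * (real k)\<^sup>2)" .
        moreover have "pi * real q * (real k)\<^sup>2 > 0" using q False by simp
        ultimately show "1 / (pi * real q * (real k)\<^sup>2) \<le> 4 * inverse ((real k + 1)\<^sup>2)"
          by (simp add: field_simps)
      qed
      finally show ?thesis .
    qed
    then have "cmod (\<Sum>j<q. c j / w (k * q + j) - c j / w (k * q)) \<le> real q * (A * (4 * inverse ((real k + 1)\<^sup>2)))"
      using sum_norm_bound[of "{..<q}" "\<lambda>j. c j / w (k * q + j) - c j / w (k * q)"] by simp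
    moreover have "(\<Sum>j<q. c j / w (k * q + j) - c j / w (k * q)) = (\<Sum>j<q. c j / w (k * q + j))"
      using c0 by (simp add: sum_subtractf flip: sum_divide_distrib)
    ultimately show ?thesis by (simp add: w_def mult.assoc)
  qed
qed

text \<open>One constant for all M and all u > 0, the majorant required when the partial fractions
  are integrated. The blocks are dominated by a convergent series in 1 / (k + 1)^2, once for the
  poles on each half of the imaginary axis.\<close>

lemma pole_pair_sum_bound:
  obtains D where "\<And>M u. u > 0 \<Longrightarrow> cmod (\<Sum>n<M*q. pole_pair (of_real u) n) \<le> D"
proof
  fix M and u :: real assume u: "u > 0"
  define A where "A = (\<Sum>l=1..q-1. cmod (x l))"
  have A0: "A \<ge> 0" unfolding A_def by (intro sum_nonneg) auto
  have WA: "cmod (Wexp n) \<le> A" for n unfolding A_def by (rule cmod_Wexp_le)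
  have W0: "Wexp (int 0) = 0" "Wexp (- int 0) = 0" using Wexp_0 by simp_all
  have summ: "summable (\<lambda>k. inverse ((real k + 1)\<^sup>2))"
  proof -
    have "summable (\<lambda>n. inverse ((real n)\<^sup>2))" by (rule inverse_power_summable) simp
    then have "summable (\<lambda>n. inverse ((real (Suc n))\<^sup>2))" by (subst summable_Suc_iff)
    then show ?thesis by (simp add: add.commute)
  qed
  have block: "cmod (\<Sum>n=k*q..<k*q+q. pole_pair (of_real u) n) \<le> 2 * (real q * A * 4) * inverse ((real k + 1)\<^sup>2)" for k
  proof -
    let ?s1 = "\<Sum>j<q. Wexp (int j) / (of_real u - \<i> * of_real (pi * real (k * q + j)))"
    let ?s2 = "\<Sum>j<q. Wexp (- int j) / (of_real u - \<i> * of_real ((- pi) * real (k * q + j)))"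
    have s1: "cmod ?s1 \<le> real q * A * (4 * inverse ((real k + 1)\<^sup>2))"
      by (rule pole_block_bound[where c = "\<lambda>j. Wexp (int j)", OF sum_Wexp W0(1) WA u]) simp
    have s2: "cmod ?s2 \<le> real q * A * (4 * inverse ((real k + 1)\<^sup>2))"
      by (rule pole_block_bound[where c = "\<lambda>j. Wexp (- int j)", OF sum_Wexp_neg W0(2) WA u]) simp
    have "(\<Sum>n=k*q..<k*q+q. pole_pair (of_real u) n) = (\<Sum>n=0+k*q..<q+k*q. pole_pair (of_real u) n)"
      by (simp add: add.commute)
    also have "\<dots> = (\<Sum>j<q. pole_pair (of_real u) (k * q + j))"
      unfolding sum.shift_bounds_nat_ivl by (simp add: atLeast0LessThan add.commute)
    also have "\<dots> = (\<Sum>j<q. Wexp (int j) / (of_real u - \<i> * of_real (pi * real (k * q + j)))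
        + Wexp (- int j) / (of_real u - \<i> * of_real ((- pi) * real (k * q + j))))"
    proof (rule sum.cong)
      fix j
      have p: "Wexp (int (k * q + j)) = Wexp (int j)" "Wexp (- int (k * q + j)) = Wexp (- int j)"
        using Wexp_periodic[of "int j" "int k"] Wexp_periodic[of "- int j" "- int k"] by (simp_all add: add.commute)
      show "pole_pair (of_real u) (k * q + j) = Wexp (int j) / (of_real u - \<i> * of_real (pi * real (k * q + j)))
        + Wexp (- int j) / (of_real u - \<i> * of_real ((- pi) * real (k * q + j)))"
      proof -
        have "of_real u - \<i> * of_real (pi * real (k * q + j)) \<noteq> 0" "of_real u + \<i> * of_real (pi * real (k * q + j)) \<noteq> 0"
          using u by (auto simp: complex_eq_iff)
        from pole_pair_eq_Wexp[OF this] show ?thesis by (simp only: p) simp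
      qed
    qed auto
    also have "\<dots> = ?s1 + ?s2" by (rule sum.distrib)
    finally have "cmod (\<Sum>n=k*q..<k*q+q. pole_pair (of_real u) n) \<le> cmod ?s1 + cmod ?s2"
      using norm_triangle_ineq[of ?s1 ?s2] by (simp only:)
    also have "cmod ?s1 + cmod ?s2 \<le> real q * A * (4 * inverse ((real k + 1)\<^sup>2)) + real q * A * (4 * inverse ((real k + 1)\<^sup>2))"
      by (rule add_mono[OF s1 s2])
    finally show ?thesis by (simp add: algebra_simps)
  qed
  have "(\<Sum>n<M*q. pole_pair (of_real u) n) = (\<Sum>k<M. \<Sum>n=k*q..<k*q+q. pole_pair (of_real u) n)"
    by (rule sum.nat_group[symmetric])
  also have "cmod \<dots> \<le> (\<Sum>k<M. 2 * (real q * A * 4) * inverse ((real k + 1)\<^sup>2))"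
    by (rule sum_norm_le) (rule block)
  also have "\<dots> = 2 * (real q * A * 4) * (\<Sum>k<M. inverse ((real k + 1)\<^sup>2))"
    by (rule sum_distrib_left[symmetric])
  also have "\<dots> \<le> 2 * (real q * A * 4) * (\<Sum>k. inverse ((real k + 1)\<^sup>2))"
    using summ A0 by (intro mult_left_mono sum_le_suminf) auto
  finally show "cmod (\<Sum>n<M*q. pole_pair (of_real u) n) \<le> 2 * (real q * (\<Sum>l=1..q-1. cmod (x l)) * 4) * (\<Sum>k. inverse ((real k + 1)\<^sup>2))"
    unfolding A_def .
qed

end

section \<open>Series of sine quotients\<close>

lemma norm_cos_le_exp_Im: "cmod (cos z) \<le> exp \<bar>Im z\<bar>"
proof -
  have "cmod (cos z) = cmod (exp (\<i> * z) + exp (- (\<i> * z))) / 2" by (simp add: cos_exp_eq norm_divide)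
  also have "\<dots> \<le> (cmod (exp (\<i> * z)) + cmod (exp (- (\<i> * z)))) / 2"
    by (intro divide_right_mono norm_triangle_ineq) auto
  also have "\<dots> \<le> (exp \<bar>Im z\<bar> + exp \<bar>Im z\<bar>) / 2"
    by (intro divide_right_mono add_mono) (auto simp: norm_exp_eq_Re)
  finally show ?thesis by simp
qed

lemma norm_sin_le_exp_Im: "cmod (sin z) \<le> exp \<bar>Im z\<bar>"
proof -
  have "cmod (sin z) = cmod (exp (\<i> * z) - exp (- (\<i> * z))) / 2"
    by (simp add: sin_exp_eq norm_divide norm_mult)
  also have "\<dots> \<le> (cmod (exp (\<i> * z)) + cmod (exp (- (\<i> * z)))) / 2"
    by (intro divide_right_mono norm_triangle_ineq4) auto
  also have "\<dots> \<le> (exp \<bar>Im z\<bar> + exp \<bar>Im z\<bar>) / 2"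
    by (intro divide_right_mono add_mono) (auto simp: norm_exp_eq_Re)
  finally show ?thesis by simp
qed

text \<open>Mean value inequality starting from 0 on the convex strip |Im w| <= |Im z|, where |cos
  w| is at most exp |Im z|.\<close>

lemma norm_sin_le_norm_mult_exp_Im: "cmod (sin z) \<le> cmod z * exp \<bar>Im z\<bar>"
proof -
  let ?S = "{w. \<bar>Im w\<bar> \<le> \<bar>Im z\<bar>}"
  have "?S = {w. Im w \<le> \<bar>Im z\<bar>} \<inter> {w. Im w \<ge> - \<bar>Im z\<bar>}" by auto
  then have "convex ?S" by (simp add: convex_Int convex_halfspace_Im_le convex_halfspace_Im_ge)
  then have "cmod (sin z - sin 0) \<le> exp \<bar>Im z\<bar> * cmod (z - 0)"
  proof (rule field_differentiable_bound)
    show "cmod (cos w) \<le> exp \<bar>Im z\<bar>" if "w \<in> ?S" for w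
      using norm_cos_le_exp_Im[of w] that by (auto intro: order_trans)
  qed (auto intro!: derivative_eq_intros)
  then show ?thesis by (simp add: mult.commute)
qed

lemma sin_of_nat_mult_pi: "sin (of_real pi * of_nat n :: complex) = 0"
  by (metis mult.commute of_real_mult of_real_of_nat_eq sin_npi sin_of_real of_real_0)

text \<open>For n >= 1 the zeros of the denominator at +-pi n are simple and are also zeros of sin,
  so l'Hopital's rule gives the value by continuity.\<close>

lemma sin_quotient_eq:
  assumes n: "n \<ge> 1"
  shows "sin_quotient n y = (if y\<^sup>2 = (of_real pi * of_nat n)\<^sup>2 then cos y / (2 * y)
           else sin y / (y\<^sup>2 - (of_real pi * of_nat n)\<^sup>2))"
    and "((\<lambda>z. sin z / (z\<^sup>2 - (of_real pi * of_nat n)\<^sup>2)) \<longlongrightarrow> sin_quotient n y) (at y)"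
proof -
  let ?a = "of_real pi * of_nat n :: complex"
  let ?f = "\<lambda>z. sin z / (z\<^sup>2 - ?a\<^sup>2)"
  have lim: "(?f \<longlongrightarrow> cos y / (2 * y)) (at y)" if y: "y\<^sup>2 = ?a\<^sup>2"
  proof -
    have ya: "y = ?a \<or> y = - ?a" using y by (simp add: power2_eq_iff)
    then have "y \<noteq> 0" using n by auto
    moreover have "sin y = 0" using ya sin_of_nat_mult_pi[of n] by auto
    ultimately show ?thesis
      using y by (intro lhopital_complex_simple) (auto intro!: derivative_eq_intros)
  qed
  then have "Lim (at y) ?f = cos y / (2 * y)" if "y\<^sup>2 = ?a\<^sup>2"
    using that by (intro tendsto_Lim) auto
  then show eq: "sin_quotient n y = (if y\<^sup>2 = ?a\<^sup>2 then cos y / (2 * y) else ?f y)"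
    by (simp add: sin_quotient_def Let_def)
  show "(?f \<longlongrightarrow> sin_quotient n y) (at y)"
    using lim unfolding eq by (auto intro!: tendsto_intros)
qed

lemma sin_quotient_holomorphic:
  assumes n: "n \<ge> 1"
  shows "sin_quotient n holomorphic_on UNIV"
proof -
  let ?a = "of_real pi * of_nat n :: complex"
  let ?f = "\<lambda>z. sin z / (z\<^sup>2 - ?a\<^sup>2)"
  have sq: "z\<^sup>2 = ?a\<^sup>2 \<longleftrightarrow> z \<in> {?a, - ?a}" for z by (auto simp: power2_eq_iff)
  show ?thesis
  proof (rule no_isolated_singularity'[of "{?a, - ?a}"])
    have "?f holomorphic_on (UNIV - {?a, - ?a})"
      using sq by (intro holomorphic_intros) auto
    then show "sin_quotient n holomorphic_on (UNIV - {?a, - ?a})"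
      by (rule holomorphic_transform) (use n sq in \<open>simp add: sin_quotient_eq(1)\<close>)
    fix z assume z: "z \<in> {?a, - ?a}"
    have "\<forall>\<^sub>F w in at z. w \<in> - ({?a, - ?a} - {z})"
      by (intro topological_tendstoD[OF tendsto_ident_at] open_Compl finite_imp_closed) auto
    then have "\<forall>\<^sub>F w in at z. w \<notin> {?a, - ?a}"
      using eventually_neq_at_within[of z z UNIV] by eventually_elim (use z in auto)
    then have "\<forall>\<^sub>F w in at z. ?f w = sin_quotient n w"
      by eventually_elim (use n sq in \<open>simp add: sin_quotient_eq(1)\<close>)
    with sin_quotient_eq(2)[OF n, of z] show "(sin_quotient n \<longlongrightarrow> sin_quotient n z) (at z)"
      by (rule Lim_transform_eventually)
  qed auto
qed

lemma sin_quotient_minus: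
  assumes "n \<ge> 1"
  shows "sin_quotient n (- y) = - sin_quotient n y"
  using assms by (auto simp: sin_quotient_eq(1))

text \<open>By oddness Re z >= 0 may be assumed, so that |z + pi n| >= pi n; the other factor z - pi
  n is cancelled by |sin z| = |sin(z - pi n)| <= |z - pi n| exp |Im z|.\<close>

lemma norm_sin_quotient_le_aux:
  assumes n: "n \<ge> 1"
  shows "cmod (sin_quotient n z) \<le> exp \<bar>Im z\<bar> / (pi * real n)"
proof -
  let ?a = "of_real pi * of_nat n :: complex"
  have a: "cmod ?a = pi * real n" by (simp add: norm_mult)
  have an: "pi * real n > 0" using n by simp
  have main: "cmod (sin_quotient n z) \<le> exp \<bar>Im z\<bar> / (pi * real n)" if Re: "Re z \<ge> 0" for z
  proof (cases "z\<^sup>2 = ?a\<^sup>2")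
    case True
    then have "z = ?a \<or> z = - ?a" by (simp add: power2_eq_iff)
    then have "cmod z = pi * real n" using a by auto
    then have "cmod (sin_quotient n z) = cmod (cos z) / (2 * (pi * real n))"
      using n True by (simp add: sin_quotient_eq(1) norm_divide norm_mult)
    also have "\<dots> \<le> exp \<bar>Im z\<bar> / (pi * real n)"
      using norm_cos_le_exp_Im[of z] an by (intro frac_le) auto
    finally show ?thesis .
  next
    case False
    then have ne: "z - ?a \<noteq> 0" "z + ?a \<noteq> 0" by (auto simp: power2_eq_iff eq_neg_iff_add_eq_0)
    have "sin (z - ?a) = sin z * cos ?a" using sin_of_nat_mult_pi[of n] by (simp add: sin_diff)
    moreover have "cmod (cos ?a) = 1"
    proof -
      have "(cos ?a)\<^sup>2 = 1" using sin_cos_squared_add[of ?a] sin_of_nat_mult_pi[of n] by simp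
      then show ?thesis by (metis norm_minus_cancel norm_one power2_eq_1_iff)
    qed
    ultimately have "cmod (sin z) = cmod (sin (z - ?a))" by (simp add: norm_mult)
    also have "\<dots> \<le> cmod (z - ?a) * exp \<bar>Im z\<bar>"
      using norm_sin_le_norm_mult_exp_Im[of "z - ?a"] by simp
    finally have s: "cmod (sin z) \<le> cmod (z - ?a) * exp \<bar>Im z\<bar>" .
    have "z\<^sup>2 - ?a\<^sup>2 = (z - ?a) * (z + ?a)" by (simp add: power2_eq_square algebra_simps)
    then have "cmod (sin_quotient n z) = cmod (sin z) / (cmod (z - ?a) * cmod (z + ?a))"
      using n False by (simp add: sin_quotient_eq(1) norm_divide norm_mult)
    also have "\<dots> \<le> (cmod (z - ?a) * exp \<bar>Im z\<bar>) / (cmod (z - ?a) * cmod (z + ?a))"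
      using s by (intro divide_right_mono) auto
    also have "\<dots> = exp \<bar>Im z\<bar> / cmod (z + ?a)" using ne by simp
    also have "\<dots> \<le> exp \<bar>Im z\<bar> / (pi * real n)"
      using complex_Re_le_cmod[of "z + ?a"] Re an by (intro frac_le) auto
    finally show ?thesis .
  qed
  show ?thesis
    using main[of z] main[of "- z"] n by (cases "Re z \<ge> 0") (simp_all add: sin_quotient_minus)
qed

text \<open>A second power of n is gained from (pi n)^2 Q = z^2 Q - sin z for the quotient Q, at the
  price of a quadratic factor in z. It makes series with coefficients O(n^\<tau>), \<tau> < 1,
  converge absolutely.\<close>

lemma norm_sin_quotient_le:
  assumes n: "n \<ge> 1"
  shows "cmod (sin_quotient n z) \<le> (1 + (cmod z)\<^sup>2) * exp \<bar>Im z\<bar> / (real n)\<^sup>2"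
proof -
  let ?a = "of_real pi * of_nat n :: complex"
  have pn: "1 \<le> pi * real n" using n pi_ge_two mult_mono[of 1 pi 1 "real n"] by simp
  have "?a\<^sup>2 * sin_quotient n z = z\<^sup>2 * sin_quotient n z - sin z"
  proof (cases "z\<^sup>2 = ?a\<^sup>2")
    case True
    then have "z = ?a \<or> z = - ?a" by (simp add: power2_eq_iff)
    then have "sin z = 0" using sin_of_nat_mult_pi[of n] by auto
    with True show ?thesis by simp
  next
    case False
    then show ?thesis using n by (simp add: sin_quotient_eq(1) field_simps)
  qed
  then have "cmod (?a\<^sup>2 * sin_quotient n z) \<le> cmod (z\<^sup>2 * sin_quotient n z) + cmod (sin z)"
    by (simp only: norm_triangle_ineq4)
  also have "\<dots> \<le> (cmod z)\<^sup>2 * (exp \<bar>Im z\<bar> / 1) + exp \<bar>Im z\<bar>"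
    unfolding norm_mult norm_power using pn
    by (intro add_mono mult_left_mono norm_sin_le_exp_Im order_trans[OF norm_sin_quotient_le_aux[OF n]] divide_left_mono) auto
  finally have "(pi * real n)\<^sup>2 * cmod (sin_quotient n z) \<le> (1 + (cmod z)\<^sup>2) * exp \<bar>Im z\<bar>"
    by (simp add: norm_mult norm_power algebra_simps)
  moreover have "(real n)\<^sup>2 * cmod (sin_quotient n z) \<le> (pi * real n)\<^sup>2 * cmod (sin_quotient n z)"
    using pi_ge_two mult_mono[of 1 pi "real n" "real n"] by (intro mult_right_mono power_mono) auto
  ultimately show ?thesis using n by (simp add: field_simps)
qed

lemma infsum_eq_suminf_indicator:
  fixes f :: "nat \<Rightarrow> complex"
  assumes "summable (\<lambda>n. norm (if n \<in> N then f n else 0))"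
  shows "(\<lambda>n. if n \<in> N then f n else 0) sums (\<Sum>\<^sub>\<infinity>n\<in>N. f n)"
proof -
  let ?g = "\<lambda>n. if n \<in> N then f n else 0"
  have s: "?g sums suminf ?g" by (intro summable_sums summable_norm_cancel[OF assms])
  then have "(?g has_sum suminf ?g) UNIV" by (rule norm_summable_imp_has_sum[OF assms])
  then have "infsum ?g UNIV = suminf ?g" by (rule infsumI)
  moreover have "infsum ?g UNIV = infsum f N" by (rule infsum_cong_neutral) auto
  ultimately show ?thesis using s by simp
qed

text \<open>The estimate of \<open>norm_sin_quotient_le\<close> separates the variable from the
  index, so multiples of one summable sequence are majorants on every disc and also give the global
  growth bound.\<close>

lemma sin_quotient_series:
  fixes c :: "nat \<Rightarrow> complex"
  assumes N: "\<And>n. n \<in> N \<Longrightarrow> n \<ge> 1" and summ: "summable (\<lambda>n. cmod (c n) / (real n)\<^sup>2)"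
  defines "G \<equiv> \<lambda>y. \<Sum>\<^sub>\<infinity>n\<in>N. c n * sin_quotient n y"
  shows "(\<lambda>n. if n \<in> N then c n * sin_quotient n y else 0) sums G y"
    and "G holomorphic_on UNIV"
    and "\<exists>D. \<forall>z. cmod (G z) \<le> D * (1 + (cmod z)\<^sup>2) * exp \<bar>Im z\<bar>"
proof -
  let ?t = "\<lambda>n y. if n \<in> N then c n * sin_quotient n y else 0"
  have bound: "cmod (?t n z) \<le> cmod (c n) / (real n)\<^sup>2 * ((1 + (cmod z)\<^sup>2) * exp \<bar>Im z\<bar>)" for n z
  proof (cases "n \<in> N")
    case True
    have "cmod (c n * sin_quotient n z) \<le> cmod (c n) * ((1 + (cmod z)\<^sup>2) * exp \<bar>Im z\<bar> / (real n)\<^sup>2)"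
      unfolding norm_mult using norm_sin_quotient_le[OF N[OF True]] by (rule mult_left_mono) simp
    then show ?thesis using True by simp
  qed auto
  have ns: "summable (\<lambda>n. cmod (?t n z))" for z
    by (rule summable_comparison_test'[OF summable_mult2[OF summ]]) (unfold real_norm_def abs_norm_cancel, rule bound)
  show sums: "(\<lambda>n. ?t n y) sums G y" for y
    unfolding G_def using ns by (rule infsum_eq_suminf_indicator)
  show "G holomorphic_on UNIV"
  proof (rule holomorphic_uniform_sequence[of UNIV "\<lambda>k y. \<Sum>n<k. ?t n y"])
    show "(\<lambda>y. \<Sum>n<k. ?t n y) holomorphic_on UNIV" for k
    proof (intro holomorphic_on_sum)
      fix n show "?t n holomorphic_on UNIV"
        using N sin_quotient_holomorphic by (cases "n \<in> N") (auto intro!: holomorphic_intros)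
    qed
    fix z :: complex
    have "uniform_limit (cball z 1) (\<lambda>k y. \<Sum>n<k. ?t n y) (\<lambda>y. suminf (\<lambda>n. ?t n y)) sequentially"
    proof (rule Weierstrass_m_test)
      let ?M = "(1 + (cmod z + 1)\<^sup>2) * exp (cmod z + 1)"
      show "summable (\<lambda>n. cmod (c n) / (real n)\<^sup>2 * ?M)" by (rule summable_mult2[OF summ])
      fix n y assume "y \<in> cball z 1"
      then have "cmod y \<le> cmod z + 1" using norm_triangle_ineq2[of y z] by (simp add: dist_norm norm_minus_commute)
      moreover have "\<bar>Im y\<bar> \<le> cmod y" by (rule abs_Im_le_cmod)
      ultimately have "(1 + (cmod y)\<^sup>2) * exp \<bar>Im y\<bar> \<le> ?M"
        by (intro mult_mono add_mono power_mono) auto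
      then show "cmod (?t n y) \<le> cmod (c n) / (real n)\<^sup>2 * ?M"
        by (intro order_trans[OF bound] mult_left_mono) auto
    qed
    moreover have "(\<lambda>y. suminf (\<lambda>n. ?t n y)) = G" using sums by (auto simp: sums_iff)
    ultimately show "\<exists>d>0. cball z d \<subseteq> UNIV \<and> uniform_limit (cball z d) (\<lambda>k y. \<Sum>n<k. ?t n y) G sequentially"
      by (intro exI[of _ 1]) auto
  qed auto
  have "cmod (G z) \<le> (\<Sum>n. cmod (c n) / (real n)\<^sup>2) * (1 + (cmod z)\<^sup>2) * exp \<bar>Im z\<bar>" for z
  proof -
    have "cmod (G z) = cmod (suminf (\<lambda>n. ?t n z))" using sums[of z] by (simp add: sums_iff)
    also have "\<dots> \<le> (\<Sum>n. cmod (?t n z))" by (rule summable_norm[OF ns])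
    also have "\<dots> \<le> (\<Sum>n. cmod (c n) / (real n)\<^sup>2 * ((1 + (cmod z)\<^sup>2) * exp \<bar>Im z\<bar>))"
      by (rule suminf_le[OF bound ns summable_mult2[OF summ]])
    also have "\<dots> = (\<Sum>n. cmod (c n) / (real n)\<^sup>2) * ((1 + (cmod z)\<^sup>2) * exp \<bar>Im z\<bar>)"
      by (rule suminf_mult2[OF summ, symmetric])
    finally show ?thesis by (simp only: mult.assoc)
  qed
  then show "\<exists>D. \<forall>z. cmod (G z) \<le> D * (1 + (cmod z)\<^sup>2) * exp \<bar>Im z\<bar>" by blast
qed

section \<open>Closure properties of exponential type\<close>

lemma exponential_type_add:
  assumes "exponential_type \<sigma> f" "exponential_type \<sigma> g"
  shows "exponential_type \<sigma> (\<lambda>z. f z + g z)"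
  unfolding exponential_type_def
proof (intro allI impI)
  fix \<epsilon> :: real assume e: "\<epsilon> > 0"
  obtain C where C: "C > 0" "\<And>z. cmod (f z) \<le> C * exp ((\<sigma> + \<epsilon>) * cmod z)"
    using assms(1) e unfolding exponential_type_def by metis
  obtain D where D: "D > 0" "\<And>z. cmod (g z) \<le> D * exp ((\<sigma> + \<epsilon>) * cmod z)"
    using assms(2) e unfolding exponential_type_def by metis
  have "cmod (f z + g z) \<le> (C + D) * exp ((\<sigma> + \<epsilon>) * cmod z)" for z
    using norm_triangle_ineq[of "f z" "g z"] C(2)[of z] D(2)[of z] by (simp add: distrib_right)
  with C(1) D(1) show "\<exists>C>0. \<forall>z. cmod (f z + g z) \<le> C * exp ((\<sigma> + \<epsilon>) * cmod z)"
    by (intro exI[of _ "C + D"]) auto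
qed

lemma exponential_type_cmult:
  assumes "exponential_type \<sigma> f"
  shows "exponential_type \<sigma> (\<lambda>z. c * f z)"
  unfolding exponential_type_def
proof (intro allI impI)
  fix \<epsilon> :: real assume e: "\<epsilon> > 0"
  obtain C where C: "C > 0" "\<And>z. cmod (f z) \<le> C * exp ((\<sigma> + \<epsilon>) * cmod z)"
    using assms(1) e unfolding exponential_type_def by metis
  have "cmod (c * f z) \<le> ((cmod c + 1) * C) * exp ((\<sigma> + \<epsilon>) * cmod z)" for z
    unfolding norm_mult mult.assoc using C(2) by (intro mult_mono) auto
  moreover have "(cmod c + 1) * C > 0" using C(1) by (intro mult_pos_pos add_nonneg_pos) auto
  ultimately show "\<exists>C>0. \<forall>z. cmod (c * f z) \<le> C * exp ((\<sigma> + \<epsilon>) * cmod z)" by blast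
qed

lemma exponential_type_diff:
  assumes "exponential_type \<sigma> f" "exponential_type \<sigma> g"
  shows "exponential_type \<sigma> (\<lambda>z. f z - g z)"
  using exponential_type_add[OF assms(1) exponential_type_cmult[OF assms(2), of "-1"]] by simp

text \<open>The spare factor exp(\<epsilon> |z|) absorbs 1 + |z|^2 by the quadratic Taylor bound of
  exp, whence the constant 1 + 2 / \<epsilon>^2.\<close>

lemma exponential_type_quadratic_bound:
  assumes "\<And>z. cmod (f z) \<le> D * (1 + (cmod z)\<^sup>2) * exp (\<sigma> * cmod z)"
  shows "exponential_type \<sigma> f"
  unfolding exponential_type_def
proof (intro allI impI)
  fix \<epsilon> :: real assume e: "\<epsilon> > 0"
  have "cmod (f z) \<le> ((\<bar>D\<bar> + 1) * (1 + 2 / \<epsilon>\<^sup>2)) * exp ((\<sigma> + \<epsilon>) * cmod z)" for z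
  proof -
    let ?r = "cmod z"
    have E: "1 + \<epsilon> * ?r + (\<epsilon> * ?r)\<^sup>2 / 2 \<le> exp (\<epsilon> * ?r)" using e by (intro exp_lower_Taylor_quadratic) auto
    have E1: "1 \<le> exp (\<epsilon> * ?r)" using e by simp
    have "(\<epsilon> * ?r)\<^sup>2 / 2 \<le> exp (\<epsilon> * ?r)" using E e by (smt (verit) mult_nonneg_nonneg norm_ge_zero)
    then have "?r\<^sup>2 \<le> 2 / \<epsilon>\<^sup>2 * exp (\<epsilon> * ?r)" using e by (simp add: field_simps power_mult_distrib)
    with E1 have r: "1 + ?r\<^sup>2 \<le> (1 + 2 / \<epsilon>\<^sup>2) * exp (\<epsilon> * ?r)" unfolding distrib_right mult_1 by (rule add_mono)
    have "cmod (f z) \<le> D * (1 + ?r\<^sup>2) * exp (\<sigma> * ?r)" by (rule assms)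
    also have "\<dots> \<le> (\<bar>D\<bar> + 1) * ((1 + 2 / \<epsilon>\<^sup>2) * exp (\<epsilon> * ?r)) * exp (\<sigma> * ?r)"
      using r by (intro mult_right_mono mult_mono) auto
    also have "\<dots> = ((\<bar>D\<bar> + 1) * (1 + 2 / \<epsilon>\<^sup>2)) * (exp (\<sigma> * ?r) * exp (\<epsilon> * ?r))" by (simp only: mult_ac)
    also have "exp (\<sigma> * ?r) * exp (\<epsilon> * ?r) = exp ((\<sigma> + \<epsilon>) * ?r)" by (simp add: distrib_right exp_add)
    finally show ?thesis .
  qed
  moreover have "(\<bar>D\<bar> + 1) * (1 + 2 / \<epsilon>\<^sup>2) > 0" by (intro mult_pos_pos add_nonneg_pos add_pos_nonneg) auto
  ultimately show "\<exists>C>0. \<forall>z. cmod (f z) \<le> C * exp ((\<sigma> + \<epsilon>) * cmod z)" by blast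
qed

text \<open>Half of \<epsilon> is spent on f and the other half on the factor |z|.\<close>

lemma exponential_type_mult_ident:
  assumes "exponential_type \<sigma> f"
  shows "exponential_type \<sigma> (\<lambda>z. z * f z)"
  unfolding exponential_type_def
proof (intro allI impI)
  fix \<epsilon> :: real assume e: "\<epsilon> > 0"
  then have e2: "\<epsilon> / 2 > 0" by simp
  obtain C where C: "C > 0" "\<And>z. cmod (f z) \<le> C * exp ((\<sigma> + \<epsilon> / 2) * cmod z)"
    using assms(1) e2 unfolding exponential_type_def by metis
  have "cmod (z * f z) \<le> (2 / \<epsilon> * C) * exp ((\<sigma> + \<epsilon>) * cmod z)" for z
  proof -
    have "1 + \<epsilon> / 2 * cmod z \<le> exp (\<epsilon> / 2 * cmod z)" by (rule exp_ge_add_one_self)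
    then have "cmod z \<le> 2 / \<epsilon> * exp (\<epsilon> / 2 * cmod z)" using e by (simp add: field_simps)
    then have "cmod (z * f z) \<le> (2 / \<epsilon> * exp (\<epsilon> / 2 * cmod z)) * (C * exp ((\<sigma> + \<epsilon> / 2) * cmod z))"
      unfolding norm_mult using C(2) e by (intro mult_mono) auto
    also have "\<dots> = (2 / \<epsilon> * C) * (exp (\<epsilon> / 2 * cmod z) * exp ((\<sigma> + \<epsilon> / 2) * cmod z))" by simp
    also have "exp (\<epsilon> / 2 * cmod z) * exp ((\<sigma> + \<epsilon> / 2) * cmod z) = exp ((\<sigma> + \<epsilon>) * cmod z)"
      by (simp add: algebra_simps flip: exp_add)
    finally show ?thesis .
  qed
  moreover have "2 / \<epsilon> * C > 0" using e C(1) by simp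
  ultimately show "\<exists>C>0. \<forall>z. cmod (z * f z) \<le> C * exp ((\<sigma> + \<epsilon>) * cmod z)" by blast
qed

lemma exponential_type_mult_power:
  assumes "exponential_type \<sigma> f"
  shows "exponential_type \<sigma> (\<lambda>z. z ^ k * f z)"
proof (induction k)
  case (Suc k)
  from exponential_type_mult_ident[OF Suc] show ?case by (simp add: mult.assoc)
qed (use assms in simp)

lemma exponential_type_sum:
  assumes "finite A" "\<And>i. i \<in> A \<Longrightarrow> exponential_type \<sigma> (f i)"
  shows "exponential_type \<sigma> (\<lambda>z. \<Sum>i\<in>A. f i z)"
  using assms
proof (induction A rule: finite_induct)
  case empty
  then show ?case by (intro exponential_type_quadratic_bound[where D = 0]) auto
next
  case (insert a A)
  then show ?case by (simp add: exponential_type_add)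
qed

lemma exp_abs_Im_le: "exp \<bar>Im z\<bar> \<le> exp (1 * cmod z)"
  using abs_Im_le_cmod[of z] by simp

lemma exponential_type_sin: "exponential_type 1 sin"
proof (rule exponential_type_quadratic_bound[where D = 1])
  fix z :: complex
  have "cmod (sin z) \<le> 1 * exp (1 * cmod z)"
    using norm_sin_le_exp_Im[of z] exp_abs_Im_le[of z] by linarith
  also have "\<dots> \<le> (1 * (1 + (cmod z)\<^sup>2)) * exp (1 * cmod z)"
    by (intro mult_right_mono) auto
  finally show "cmod (sin z) \<le> 1 * (1 + (cmod z)\<^sup>2) * exp (1 * cmod z)" .
qed

section \<open>The shape of the interpolant, for general coefficients\<close>

context
  fixes a :: "nat \<Rightarrow> complex" and c :: "nat \<Rightarrow> complex" and \<kappa> :: complex and N :: "nat set" and m :: nat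
    and F :: "complex \<Rightarrow> complex"
  assumes N: "\<And>n. n \<in> N \<Longrightarrow> n \<ge> 1" and summ: "summable (\<lambda>n. cmod (c n) / (real n)\<^sup>2)"
  defines "F \<equiv> \<lambda>y. - (sin y * (\<Sum>j=1..m. a j * (2 * y) ^ (2 * j)) +
        \<kappa> * y ^ (2 * (m + 1)) * (\<Sum>\<^sub>\<infinity>n\<in>N. c n * sin_quotient n y))"
begin

lemma interpolant_holomorphic: "F holomorphic_on UNIV"
  unfolding F_def using sin_quotient_series(2)[OF N summ] by (intro holomorphic_intros)

lemma interpolant_exponential_type: "exponential_type 1 F"
proof -
  let ?G = "\<lambda>y. \<Sum>\<^sub>\<infinity>n\<in>N. c n * sin_quotient n y"
  obtain D where D: "\<And>z. cmod (?G z) \<le> D * (1 + (cmod z)\<^sup>2) * exp \<bar>Im z\<bar>"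
    using sin_quotient_series(3)[OF N summ] by blast
  have "exponential_type 1 ?G"
  proof (rule exponential_type_quadratic_bound[where D = "\<bar>D\<bar>"])
    fix z
    have "cmod (?G z) \<le> D * (1 + (cmod z)\<^sup>2) * exp \<bar>Im z\<bar>" by (rule D)
    also have "\<dots> \<le> \<bar>D\<bar> * (1 + (cmod z)\<^sup>2) * exp (1 * cmod z)"
      using exp_abs_Im_le[of z] by (intro mult_mono mult_right_mono) auto
    finally show "cmod (?G z) \<le> \<bar>D\<bar> * (1 + (cmod z)\<^sup>2) * exp (1 * cmod z)" .
  qed
  then have "exponential_type 1 (\<lambda>z. (- 1) * ((\<Sum>j=1..m. (a j * 2 ^ (2 * j)) * (z ^ (2 * j) * sin z)) + \<kappa> * (z ^ (2 * (m + 1)) * ?G z)))"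
    by (intro exponential_type_cmult exponential_type_add exponential_type_sum exponential_type_mult_power exponential_type_sin) auto
  also have "(\<lambda>z. (- 1) * ((\<Sum>j=1..m. (a j * 2 ^ (2 * j)) * (z ^ (2 * j) * sin z)) + \<kappa> * (z ^ (2 * (m + 1)) * ?G z))) = F"
    unfolding F_def by (simp add: fun_eq_iff sum_distrib_left power_mult_distrib mult_ac)
  finally show ?thesis .
qed

text \<open>Both summands vanish at 0 to order at least 2: the polynomial has no constant term and
  meets a zero of sin, and the series carries the power y^(2 (m + 1)).\<close>

lemma interpolant_deriv_0: "deriv F 0 = 0"
proof -
  let ?G = "\<lambda>y. \<Sum>\<^sub>\<infinity>n\<in>N. c n * sin_quotient n y"
  let ?P = "\<lambda>y. \<Sum>j=1..m. a j * (2 * y) ^ (2 * j)"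
  have "?P holomorphic_on UNIV" by (intro holomorphic_intros)
  then have P: "(?P has_field_derivative deriv ?P 0) (at 0)" by (intro holomorphic_derivI) auto
  have G: "(?G has_field_derivative deriv ?G 0) (at 0)"
    using sin_quotient_series(2)[OF N summ] by (intro holomorphic_derivI) auto
  have P0: "?P 0 = 0" by (intro sum.neutral) auto
  have "(F has_field_derivative - ((sin 0 * deriv ?P 0 + cos 0 * 1 * ?P 0) + (\<kappa> * 0 ^ (2 * (m + 1)) * deriv ?G 0
      + \<kappa> * (of_nat (2 * (m + 1)) * (1 * 0 ^ (2 * (m + 1) - 1))) * ?G 0))) (at 0)"
    unfolding F_def by (rule derivative_eq_intros P G refl | simp add: algebra_simps)+
  then have "(F has_field_derivative 0) (at 0)" unfolding P0 by simp
  then show ?thesis by (rule DERIV_imp_deriv)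
qed

text \<open>At a node the sine kills the polynomial part and every quotient except the one with n =
  |k|, whose value is cos(pi k) / (2 pi k).\<close>

lemma interpolant_at_node:
  assumes k: "k \<noteq> 0"
  shows "F (of_real (pi * of_int k)) = (if nat \<bar>k\<bar> \<in> N then
     - (\<kappa> * of_real (pi * of_int k) ^ (2 * (m + 1)) * (c (nat \<bar>k\<bar>) * ((- 1) powi k / (2 * of_real (pi * of_int k))))) else 0)"
proof -
  let ?y = "of_real (pi * of_int k) :: complex"
  have sin0: "sin ?y = 0" unfolding sin_of_real by (simp add: sin_times_pi_eq_0 mult.commute[of pi])
  have cosk: "cos ?y = (- 1) powi k"
  proof -
    have "cos (pi * of_int k) = (- 1) powi k"
      by (cases "even k") (auto elim!: evenE oddE simp: cos_int_2pin power_int_minus_left algebra_simps cos_add sin_int_2pin)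
    then show ?thesis unfolding cos_of_real by (simp add: of_real_power_int)
  qed
  have sq: "?y\<^sup>2 = (of_real pi * of_nat n)\<^sup>2 \<longleftrightarrow> n = nat \<bar>k\<bar>" for n
  proof -
    have "?y\<^sup>2 = of_real ((pi * of_int k)\<^sup>2)" "(of_real pi * of_nat n)\<^sup>2 = (of_real ((pi * real n)\<^sup>2) :: complex)" by simp_all
    then have "?y\<^sup>2 = (of_real pi * of_nat n)\<^sup>2 \<longleftrightarrow> (pi * of_int k)\<^sup>2 = (pi * real n)\<^sup>2" by (simp only: of_real_eq_iff)
    also have "\<dots> \<longleftrightarrow> (real_of_int k)\<^sup>2 = (real_of_int (int n))\<^sup>2" by (simp add: power_mult_distrib)
    also have "\<dots> \<longleftrightarrow> k\<^sup>2 = (int n)\<^sup>2" by (metis of_int_eq_iff of_int_power)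
    also have "\<dots> \<longleftrightarrow> n = nat \<bar>k\<bar>" by (auto simp: power2_eq_iff)
    finally show ?thesis .
  qed
  have val: "sin_quotient n ?y = (if n = nat \<bar>k\<bar> then (- 1) powi k / (2 * ?y) else 0)" if "n \<ge> 1" for n
    unfolding sin_quotient_eq(1)[OF that] sq cosk sin0 by simp
  have "(\<Sum>\<^sub>\<infinity>n\<in>N. c n * sin_quotient n ?y) = (\<Sum>\<^sub>\<infinity>n\<in>N \<inter> {nat \<bar>k\<bar>}. c n * sin_quotient n ?y)"
    by (rule infsum_cong_neutral) (use val N in auto)
  also have "\<dots> = (if nat \<bar>k\<bar> \<in> N then c (nat \<bar>k\<bar>) * ((- 1) powi k / (2 * ?y)) else 0)"
    using val[of "nat \<bar>k\<bar>"] N by auto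
  finally show ?thesis unfolding F_def sin0 by simp
qed

lemma interpolant_minus: "F (- y) = - F y"
proof -
  have "(\<Sum>\<^sub>\<infinity>n\<in>N. c n * sin_quotient n (- y)) = (\<Sum>\<^sub>\<infinity>n\<in>N. - (c n * sin_quotient n y))"
    by (intro infsum_cong) (use N in \<open>simp add: sin_quotient_minus\<close>)
  then have "(\<Sum>\<^sub>\<infinity>n\<in>N. c n * sin_quotient n (- y)) = - (\<Sum>\<^sub>\<infinity>n\<in>N. c n * sin_quotient n y)"
    by (simp add: infsum_uminus)
  then show ?thesis unfolding F_def by (simp add: power_mult)
qed

end

section \<open>The Mellin transform of the kernel\<close>

text \<open>An incomplete last block has fewer than q terms, and these tend to 0.\<close>

lemma sums_of_block_limit:
  fixes t :: "nat \<Rightarrow> 'a::real_normed_vector"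
  assumes q: "q > 0" and lim: "(\<lambda>N. \<Sum>i<N*q. t i) \<longlonglongrightarrow> S" and t0: "t \<longlonglongrightarrow> 0"
  shows "t sums S"
proof -
  have div: "filterlim (\<lambda>n. n div q) at_top sequentially"
    unfolding filterlim_at_top
  proof
    fix Z show "\<forall>\<^sub>F n in sequentially. Z \<le> n div q"
      using eventually_ge_at_top[of "Z * q"]
    proof eventually_elim
      case (elim n)
      then show ?case using q by (metis div_le_mono nonzero_mult_div_cancel_right not_gr_zero)
    qed
  qed
  have lim1: "(\<lambda>n. \<Sum>i<(n div q)*q. t i) \<longlonglongrightarrow> S"
    by (rule filterlim_compose[OF lim div])
  have "(\<lambda>N. \<Sum>j<q. norm (t (j + N * q))) \<longlonglongrightarrow> (\<Sum>j<q. 0)"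
  proof (intro tendsto_sum tendsto_norm_zero)
    fix j
    have "filterlim (\<lambda>N. j + N * q) at_top sequentially"
    proof (rule filterlim_at_top_mono[OF filterlim_ident])
      show "\<forall>\<^sub>F N in sequentially. N \<le> j + N * q"
        using q by (intro always_eventually allI) (metis Suc_leI le_add2 le_trans mult.right_neutral mult_le_mono2 One_nat_def)
    qed
    then show "(\<lambda>N. t (j + N * q)) \<longlonglongrightarrow> 0" by (rule filterlim_compose[OF t0])
  qed
  then have err: "(\<lambda>n. \<Sum>j<q. norm (t (j + (n div q) * q))) \<longlonglongrightarrow> 0"
    using filterlim_compose[OF _ div] by fastforce
  have "(\<lambda>n. (\<Sum>i<n. t i) - (\<Sum>i<(n div q)*q. t i)) \<longlonglongrightarrow> 0"
  proof (rule Lim_null_comparison[OF always_eventually err], rule allI)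
    fix n
    define N where "N = n div q * q"
    have n: "N \<le> n" "n \<le> q + N"
      using mod_less_divisor[OF q, of n] div_mult_mod_eq[of n q] unfolding N_def by linarith+
    have "{..<n} = {..<N} \<union> {N..<n}" using n by auto
    then have "(\<Sum>i<n. t i) = (\<Sum>i<N. t i) + (\<Sum>i=N..<n. t i)"
      by (simp add: sum.union_disjoint ivl_disj_int)
    then have "norm ((\<Sum>i<n. t i) - (\<Sum>i<N. t i)) = norm (\<Sum>i=N..<n. t i)" by simp
    also have "\<dots> \<le> (\<Sum>i=N..<n. norm (t i))" by (rule norm_sum)
    also have "\<dots> \<le> (\<Sum>i=0+N..<q+N. norm (t i))" using n by (intro sum_mono2) auto
    also have "\<dots> = (\<Sum>j<q. norm (t (j + N)))"
      unfolding sum.shift_bounds_nat_ivl by (simp add: atLeast0LessThan)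
    finally show "norm ((\<Sum>i<n. t i) - (\<Sum>i<n div q * q. t i)) \<le> (\<Sum>j<q. norm (t (j + n div q * q)))"
      unfolding N_def .
  qed
  from tendsto_add[OF this lim1] show ?thesis by (simp add: sums_def)
qed

lemma powr_two_times_div:
  fixes z :: complex and n q :: nat
  assumes n: "n > 0" and q: "q > 0"
  shows "of_real (2 * real n / real q) powr (- z) = 2 powr (- z) * (of_nat q powr z * of_nat n powr (- z))"
proof -
  have P: "complex_of_real x powr w = exp (w * of_real (ln x))" if "x > 0" for x w
    using that by (simp add: powr_def Ln_of_real)
  have pos: "2 * real n / real q > 0" using n q by simp
  have "of_real (2 * real n / real q) powr (- z) = exp ((- z) * of_real (ln (2 * real n / real q)))"
    by (rule P[OF pos])
  also have "ln (2 * real n / real q) = ln 2 + ln (real n) - ln (real q)"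
    using n q by (simp add: ln_div ln_mult)
  also have "(- z) * of_real (ln 2 + ln (real n) - ln (real q)) =
      (- z) * of_real (ln 2) + (z * of_real (ln (real q)) + (- z) * of_real (ln (real n)))"
    by (simp add: algebra_simps)
  also have "exp \<dots> = of_real 2 powr (- z) * (of_real (real q) powr z * of_real (real n) powr (- z))"
    unfolding exp_add using n q by (subst (1 2 3) P) simp_all
  finally show ?thesis by simp
qed

context zero_sum_weights
begin

lemma K_of_real:
  "K (of_real u) = (\<Sum>l=1..q-1. x l * of_real (exp ((1 - 2 * real l / real q) * u))) / of_real (sinh u)"
proof -
  have "exp ((1 - 2 * of_nat l / of_nat q) * of_real u) = (of_real (exp ((1 - 2 * real l / real q) * u)) :: complex)" for l
    by (simp flip: exp_of_real)
  moreover have "sinh (of_real u :: complex) = of_real (sinh u)"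
    by (simp add: sinh_field_def exp_of_real flip: of_real_minus)
  ultimately show ?thesis unfolding K_def by (simp only:)
qed

text \<open>Since the weights sum to 0, the lowest exponential exp(-b u), b = 1 - 2 / q, may be
  subtracted from every term of the numerator, which makes it O(u exp(b u)). Divided by sinh this
  stays bounded at 0 and decays like exp(b u - u) = exp(-2 u / q), up to a linear factor.\<close>

lemma norm_K_le:
  assumes u: "u > 0"
  shows "cmod (K (of_real u)) \<le> 2 * (\<Sum>l=1..q-1. cmod (x l)) * ((1 + 2 * u) * exp (- (2 / real q * u)))"
proof -
  define b where "b = 1 - 2 / real q"
  define A where "A = (\<Sum>l=1..q-1. cmod (x l))"
  have A0: "A \<ge> 0" unfolding A_def by (intro sum_nonneg) auto
  have b0: "b \<ge> 0" using q by (simp add: b_def field_simps)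
  have b1: "b \<le> 1" using q by (simp add: b_def)
  let ?a = "\<lambda>l. 1 - 2 * real l / real q"
  have s: "sinh u > 0" using u by simp
  have "cmod (\<Sum>l=1..q-1. x l * of_real (exp (?a l * u))) = cmod (\<Sum>l=1..q-1. x l * of_real (exp (?a l * u) - exp (- b * u)))"
  proof -
    have "(\<Sum>l=1..q-1. x l * of_real (exp (?a l * u) - exp (- b * u))) =
       (\<Sum>l=1..q-1. x l * of_real (exp (?a l * u))) - (\<Sum>l=1..q-1. x l) * of_real (exp (- b * u))"
      by (simp add: sum_distrib_right right_diff_distrib flip: sum_subtractf)
    then show ?thesis using sum_x by simp
  qed
  also have "\<dots> \<le> (\<Sum>l=1..q-1. cmod (x l) * (2 * (u * exp (b * u))))"
  proof (intro sum_norm_le)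
    fix l assume l: "l \<in> {1..q-1}"
    have "2 * real l / real q \<ge> 2 / real q" using l q by (intro divide_right_mono) auto
    then have a1: "?a l \<le> b" by (simp add: b_def)
    have "real l \<le> real q - 1" using l q by (metis Suc_leI atLeastAtMost_iff le_diff_conv2 less_imp_le of_nat_1 of_nat_diff of_nat_le_iff One_nat_def)
    then have "2 * real l / real q \<le> 2 * (real q - 1) / real q" using q by (intro divide_right_mono) auto
    also have "\<dots> = 2 - 2 / real q" using q by (simp add: field_simps)
    finally have a2: "- b \<le> ?a l" by (simp add: b_def)
    have "\<bar>exp (?a l * u) - exp (- b * u)\<bar> \<le> exp (b * u) - exp (- b * u)"
    proof -
      have "- b * u \<le> ?a l * u" "?a l * u \<le> b * u" using mult_right_mono[OF a1] mult_right_mono[OF a2] u by (meson less_imp_le)+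
      then have "exp (- b * u) \<le> exp (?a l * u)" "exp (?a l * u) \<le> exp (b * u)" by (simp_all only: exp_le_cancel_iff)
      then show ?thesis by linarith
    qed
    also have "\<dots> \<le> 2 * (u * exp (b * u))"
    proof -
      have "(1 + (- (2 * (b * u)))) * exp (b * u) \<le> exp (- (2 * (b * u))) * exp (b * u)"
        by (intro mult_right_mono exp_ge_add_one_self) auto
      also have "\<dots> = exp (- b * u)" by (simp flip: exp_add)
      finally have "exp (b * u) - exp (- b * u) \<le> 2 * (b * u * exp (b * u))" by (simp add: algebra_simps)
      also have "\<dots> \<le> 2 * (1 * u * exp (b * u))" using b1 u by (intro mult_left_mono mult_right_mono) auto
      finally show ?thesis by simp
    qed
    finally show "cmod (x l * of_real (exp (?a l * u) - exp (- b * u))) \<le> cmod (x l) * (2 * (u * exp (b * u)))"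
      unfolding norm_mult norm_of_real by (intro mult_left_mono) auto
  qed
  also have "\<dots> = A * (2 * (u * exp (b * u)))" unfolding A_def by (rule sum_distrib_right[symmetric])
  finally have num: "cmod (\<Sum>l=1..q-1. x l * of_real (exp (?a l * u))) \<le> A * (2 * (u * exp (b * u)))" .
  \<comment> \<open>From sinh u = exp u (1 - exp(-2 u)) / 2 and exp(2 u) >= 1 + 2 u.\<close>
  have den: "exp u * (u / (1 + 2 * u)) \<le> sinh u"
  proof -
    have "1 + 2 * u \<le> exp (2 * u)" by (rule exp_ge_add_one_self)
    then have "1 / exp (2 * u) \<le> 1 / (1 + 2 * u)" using u by (intro divide_left_mono) auto
    then have "1 - 1 / (1 + 2 * u) \<le> 1 - exp (- (2 * u))" by (simp add: exp_minus inverse_eq_divide)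
    moreover have "1 - 1 / (1 + 2 * u) = 2 * (u / (1 + 2 * u))" using u by (simp add: field_simps)
    moreover define w where "w = u / (1 + 2 * u)"
    ultimately have "2 * w \<le> 1 - exp (- (2 * u))" by linarith
    then have "exp u * (2 * w) \<le> exp u * (1 - exp (- (2 * u)))" by (intro mult_left_mono) auto
    also have "\<dots> = exp u - exp (- u)" by (simp add: right_diff_distrib flip: exp_add)
    finally show ?thesis unfolding sinh_field_def w_def[symmetric] by simp
  qed
  have dp: "exp u * (u / (1 + 2 * u)) > 0" using u by simp
  have "cmod (K (of_real u)) = cmod (\<Sum>l=1..q-1. x l * of_real (exp (?a l * u))) / sinh u"
    unfolding K_of_real norm_divide norm_of_real using s by simp
  also have "\<dots> \<le> (A * (2 * (u * exp (b * u)))) / (exp u * (u / (1 + 2 * u)))"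
    using num den dp A0 u by (intro frac_le) auto
  also have "\<dots> = 2 * A * ((1 + 2 * u) * (exp (b * u) / exp u))"
  proof -
    have "(A * (2 * (u * X))) / (Y * (u / W)) = 2 * A * (W * (X / Y))" if "Y \<noteq> 0" "W \<noteq> 0" for X Y W
      using that u by simp
    then show ?thesis using u by simp
  qed
  also have "exp (b * u) / exp u = exp (- (2 / real q * u))"
  proof -
    have "b * u - u = - (2 / real q * u)" by (simp add: b_def left_diff_distrib)
    then show ?thesis by (simp only: exp_diff[symmetric])
  qed
  finally show ?thesis unfolding A_def .
qed

lemma continuous_on_K: "continuous_on {0<..} (\<lambda>u. K (of_real u))"
  unfolding K_of_real by (intro continuous_intros) auto

lemma Mellin_K_majorant:
  assumes p: "p > 0"
  shows "(\<lambda>u. u powr (p - 1) * (B * ((1 + 2 * u) * exp (- (2 / real q * u))))) integrable_on {0<..}"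
proof -
  have d: "2 / real q > 0" using q by simp
  have "(\<lambda>u. B * (u powr (p - 1) * exp (- (2 / real q * u))) + (2 * B) * (u powr ((p + 1) - 1) * exp (- (2 / real q * u)))) integrable_on {0<..}"
    using Gamma_integral_scaled_real(2)[OF p d] Gamma_integral_scaled_real(2)[of "p + 1", OF _ d] p
    by (intro integrable_add integrable_on_mult_right) auto
  moreover have "B * (u powr (p - 1) * exp (- (2 / real q * u))) + (2 * B) * (u powr ((p + 1) - 1) * exp (- (2 / real q * u)))
     = u powr (p - 1) * (B * ((1 + 2 * u) * exp (- (2 / real q * u))))" if "u \<in> {0<..}" for u
  proof -
    have "u powr ((p + 1) - 1) = u powr (p - 1) * u" using that powr_add[of u "p - 1" 1] by simp
    then show ?thesis by (simp add: algebra_simps)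
  qed
  ultimately show ?thesis by (rule integrable_eq)
qed

lemma Mellin_K_bound:
  assumes u: "u > 0"
  shows "cmod (of_real u powr (z - 1) * K (of_real u)) \<le>
     u powr (Re z - 1) * (2 * (\<Sum>l=1..q-1. cmod (x l)) * ((1 + 2 * u) * exp (- (2 / real q * u))))"
  unfolding norm_mult using u norm_K_le[OF u] by (simp add: cmod_of_real_powr mult_left_mono)

lemma Mellin_K_absolutely_integrable:
  assumes "Re z > 0"
  shows "(\<lambda>u. of_real u powr (z - 1) * K (of_real u)) absolutely_integrable_on {0<..}"
proof (rule integral_Ioi_bound)
  show "continuous_on {0<..} (\<lambda>u. of_real u powr (z - 1) * K (of_real u))"
    by (intro continuous_on_mult continuous_on_powr_of_real continuous_on_K)
  show "(\<lambda>u. u powr (Re z - 1) * (2 * (\<Sum>l=1..q-1. cmod (x l)) * ((1 + 2 * u) * exp (- (2 / real q * u))))) integrable_on {0<..}"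
    using assms by (rule Mellin_K_majorant)
qed (rule Mellin_K_bound)

text \<open>N terms of the expansion of 1 / sinh reproduce the kernel up to a factor in [0, 1], so
  the kernel itself dominates all partial sums.\<close>

lemma K_geometric_partial_sum:
  assumes u: "u > 0"
  shows "(\<Sum>k<N. \<Sum>l=1..q-1. x l * (2 * of_real (exp (- (2 * real (k * q + l) / real q * u))))) =
     K (of_real u) * of_real (1 - exp (- (2 * u)) ^ N)"
proof -
  define E where "E = exp (- (2 * u))"
  have E1: "E \<noteq> 1" using u by (simp add: E_def)
  let ?h = "\<lambda>l. exp (- (2 * real l / real q * u))"
  have s: "sinh u = exp u * (1 - E) / 2"
    unfolding E_def by (simp add: sinh_field_def right_diff_distrib flip: exp_add)
  have K: "K (of_real u) = (\<Sum>l=1..q-1. x l * of_real (2 * ?h l)) / of_real (1 - E)"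
  proof -
    have "exp ((1 - 2 * real l / real q) * u) = exp u * ?h l" for l
      by (simp add: left_diff_distrib flip: exp_add)
    then have "K (of_real u) = (\<Sum>l=1..q-1. x l * of_real (exp u * ?h l)) / of_real (exp u * (1 - E) / 2)"
      unfolding K_of_real s by (simp only:)
    also have "(\<Sum>l=1..q-1. x l * of_real (exp u * ?h l)) = of_real (exp u) * (\<Sum>l=1..q-1. x l * of_real (?h l))"
      unfolding sum_distrib_left by (intro sum.cong) auto
    also have "of_real (exp u) * (\<Sum>l=1..q-1. x l * of_real (?h l)) / of_real (exp u * (1 - E) / 2)
        = 2 * (\<Sum>l=1..q-1. x l * of_real (?h l)) / of_real (1 - E)" by simp
    also have "2 * (\<Sum>l=1..q-1. x l * of_real (?h l)) = (\<Sum>l=1..q-1. x l * of_real (2 * ?h l))"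
      unfolding sum_distrib_left by (intro sum.cong) auto
    finally show ?thesis .
  qed
  have "exp (- (2 * real (k * q + l) / real q * u)) = ?h l * E ^ k" for k l
  proof -
    have "- (2 * real (k * q + l) / real q * u) = - (2 * real l / real q * u) + real k * (- (2 * u))"
      using q by (simp add: field_simps)
    then show ?thesis unfolding E_def by (simp only: exp_add exp_of_nat_mult)
  qed
  then have "(\<Sum>k<N. \<Sum>l=1..q-1. x l * (2 * of_real (exp (- (2 * real (k * q + l) / real q * u))))) =
     (\<Sum>k<N. \<Sum>l=1..q-1. (x l * of_real (2 * ?h l)) * of_real (E ^ k))" by (simp add: mult_ac)
  also have "\<dots> = (\<Sum>l=1..q-1. x l * of_real (2 * ?h l)) * of_real (\<Sum>k<N. E ^ k)"
    unfolding of_real_sum sum_distrib_right sum_distrib_left by (rule refl)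
  also have "(\<Sum>k<N. E ^ k) = (1 - E ^ N) / (1 - E)"
    using E1 by (simp add: sum_gp_strict)
  finally show ?thesis unfolding K E_def by simp
qed

text \<open>The exponential of rate c = 2 (k q + l) / q integrates to Gamma(z) c^(-z), which
  produces the Dirichlet terms and the factor q^z. The terms stay grouped in blocks of q, where the
  partial sums are dominated for all Re z > 0.\<close>

lemma Mellin_K_eq_limit:
  assumes z: "Re z > 0"
  shows "(\<lambda>N. of_nat q powr z * Gamma z * (\<Sum>k<N. \<Sum>l=1..q-1. x l * of_nat (k * q + l) powr (- z))) \<longlonglongrightarrow>
     2 powr (z - 1) * integral {0<..} (\<lambda>u. of_real u powr (z - 1) * K (of_real u))"
proof -
  let ?f = "\<lambda>N u. of_real u powr (z - 1) * (\<Sum>k<N. \<Sum>l=1..q-1. x l * (2 * of_real (exp (- (2 * real (k * q + l) / real q * u)))))"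
  let ?S = "\<lambda>N. \<Sum>k<N. \<Sum>l=1..q-1. x l * of_nat (k * q + l) powr (- z)"
  have fint: "(?f N has_integral 2 powr (1 - z) * (of_nat q powr z * Gamma z * ?S N)) {0<..}" for N
  proof -
    let ?g = "\<lambda>k l u. (2 * x l) * (of_real u powr (z - 1) * of_real (exp (- (2 * real (k * q + l) / real q * u))))"
    have "((\<lambda>u. \<Sum>k<N. \<Sum>l=1..q-1. ?g k l u) has_integral
       (\<Sum>k<N. \<Sum>l=1..q-1. (2 * x l) * (Gamma z * of_real (2 * real (k * q + l) / real q) powr (- z)))) {0<..}"
    proof (intro has_integral_sum has_integral_mult_right Gamma_integral_scaled z)
      show "0 < 2 * real (k * q + l) / real q" if "l \<in> {1..q-1}" for k l
      proof -
        have "k * q + l > 0" using that by auto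
        then show ?thesis using q by (intro divide_pos_pos mult_pos_pos) (simp_all del: of_nat_add of_nat_mult)
      qed
    qed auto
    also have "(\<lambda>u. \<Sum>k<N. \<Sum>l=1..q-1. ?g k l u) = ?f N"
      by (simp add: fun_eq_iff sum_distrib_left mult_ac)
    also have "(\<Sum>k<N. \<Sum>l=1..q-1. (2 * x l) * (Gamma z * of_real (2 * real (k * q + l) / real q) powr (- z)))
       = (\<Sum>k<N. \<Sum>l=1..q-1. (2 powr (1 - z) * (of_nat q powr z * Gamma z)) * (x l * of_nat (k * q + l) powr (- z)))"
    proof (intro sum.cong refl)
      fix k l assume l: "l \<in> {1..q-1}"
      then have pos: "k * q + l > 0" by auto
      note eq = powr_two_times_div[OF pos, of q z]
      have p: "2 powr (1 - z) = 2 * 2 powr (- z)"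
        using powr_add[of 2 1 "- z"] by simp
      show "(2 * x l) * (Gamma z * of_real (2 * real (k * q + l) / real q) powr (- z)) =
         (2 powr (1 - z) * (of_nat q powr z * Gamma z)) * (x l * of_nat (k * q + l) powr (- z))"
        using q unfolding p by (subst eq) (simp_all only: mult_ac)
    qed
    also have "\<dots> = 2 powr (1 - z) * (of_nat q powr z * Gamma z * ?S N)"
      by (simp only: sum_distrib_left mult.assoc)
    finally show ?thesis .
  qed
  let ?h = "\<lambda>u. u powr (Re z - 1) * (2 * (\<Sum>l=1..q-1. cmod (x l)) * ((1 + 2 * u) * exp (- (2 / real q * u))))"
  have "(\<lambda>N. integral {0<..} (?f N)) \<longlonglongrightarrow> integral {0<..} (\<lambda>u. of_real u powr (z - 1) * K (of_real u))"
  proof (rule dominated_convergence(2)[where h = ?h])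
    show "?f N integrable_on {0<..}" for N using fint by blast
    show "?h integrable_on {0<..}" using z by (rule Mellin_K_majorant)
    fix u :: real assume "u \<in> {0<..}"
    then have u: "u > 0" by simp
    have eq: "?f N u = of_real u powr (z - 1) * K (of_real u) * of_real (1 - exp (- (2 * u)) ^ N)" for N
      unfolding K_geometric_partial_sum[OF u] by (simp only: mult.assoc)
    have e: "0 \<le> exp (- (2 * u)) ^ N" "exp (- (2 * u)) ^ N \<le> 1" for N using u by (auto intro: power_le_one)
    show "norm (?f N u) \<le> ?h u" for N
    proof -
      have "norm (?f N u) = cmod (of_real u powr (z - 1) * K (of_real u)) * \<bar>1 - exp (- (2 * u)) ^ N\<bar>"
        unfolding eq norm_mult[of _ "of_real _"] norm_of_real by (rule refl)
      also have "\<dots> \<le> cmod (of_real u powr (z - 1) * K (of_real u)) * 1"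
        using e[of N] by (intro mult_left_mono) auto
      also have "\<dots> \<le> ?h u" using Mellin_K_bound[OF u, of z] by (simp only: mult_1_right)
      finally show ?thesis .
    qed
    have "(\<lambda>N. of_real u powr (z - 1) * K (of_real u) * of_real (1 - exp (- (2 * u)) ^ N)) \<longlonglongrightarrow>
       of_real u powr (z - 1) * K (of_real u) * of_real (1 - 0)"
      using u by (intro tendsto_intros LIMSEQ_power_zero) auto
    then show "(\<lambda>N. ?f N u) \<longlonglongrightarrow> of_real u powr (z - 1) * K (of_real u)" unfolding eq by simp
  qed
  then have "(\<lambda>N. 2 powr (1 - z) * (of_nat q powr z * Gamma z * ?S N)) \<longlonglongrightarrow> integral {0<..} (\<lambda>u. of_real u powr (z - 1) * K (of_real u))"
    using fint by (simp only: integral_unique[OF fint])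
  then have "(\<lambda>N. 2 powr (z - 1) * (2 powr (1 - z) * (of_nat q powr z * Gamma z * ?S N))) \<longlonglongrightarrow>
      2 powr (z - 1) * integral {0<..} (\<lambda>u. of_real u powr (z - 1) * K (of_real u))"
    by (intro tendsto_intros)
  moreover have "2 powr (z - 1) * 2 powr (1 - z) = (1 :: complex)"
    by (simp flip: powr_add)
  ultimately show ?thesis by (simp only: mult.assoc[symmetric] mult_1)
qed

end

section \<open>Characters and the L-series\<close>

lemma dirichlet_character_0:
  assumes "dirichlet_character q chi" "q > 1"
  shows "chi (int q * n) = 0"
proof -
  have "\<not> coprime (int q * n) (int q)"
  proof
    assume "coprime (int q * n) (int q)"
    then have "int q dvd 1" by (rule coprime_common_divisor) auto
    then show False using assms(2) by simp
  qed
  then show ?thesis using assms(1) unfolding dirichlet_character_def by blast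
qed

lemma dirichlet_character_periodic:
  assumes "dirichlet_character q chi"
  shows "chi (n + k * int q) = chi n"
proof (induction k rule: int_induct[of _ 0])
  case (step1 i)
  have "chi (n + (i + 1) * int q) = chi ((n + i * int q) + int q)" by (simp add: algebra_simps)
  with step1 assms show ?case by (auto simp: dirichlet_character_def)
next
  case (step2 i)
  have "chi ((n + (i - 1) * int q) + int q) = chi (n + i * int q)" by (simp add: algebra_simps)
  with step2 assms show ?case by (auto simp: dirichlet_character_def)
qed simp

text \<open>Multiplication by a unit a with \<chi>(a) \<noteq> 1 permutes the residues, so the sum
  equals \<chi>(a) times itself.\<close>

lemma nonprincipal_character_sum:
  assumes chi: "dirichlet_character q chi" and np: "\<not> principal_character q chi" and q: "q > 1"
  shows "(\<Sum>l=1..q-1. chi (int l)) = 0"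
proof -
  obtain a where a: "coprime a (int q)" "chi a \<noteq> 1"
    using np chi unfolding principal_character_def dirichlet_character_def by metis
  let ?R = "{0..<int q}"
  let ?\<pi> = "\<lambda>l. (a * l) mod int q"
  have inj: "inj_on ?\<pi> ?R"
  proof
    fix l l' assume l: "l \<in> ?R" "l' \<in> ?R" and eq: "?\<pi> l = ?\<pi> l'"
    from eq have "int q dvd a * l - a * l'" by (simp add: mod_eq_dvd_iff)
    then have "int q dvd a * (l - l')" by (simp add: right_diff_distrib)
    then have "int q dvd l - l'" using a(1) by (simp add: coprime_commute coprime_dvd_mult_right_iff)
    moreover have "\<bar>l - l'\<bar> < int q" using l by auto
    ultimately have "l - l' = 0" using zdvd_not_zless by (metis abs_of_nat dvd_imp_le_int linorder_not_le)
    then show "l = l'" by simp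
  qed
  have "?\<pi> ` ?R \<subseteq> ?R" using q by auto
  then have im: "?\<pi> ` ?R = ?R" using inj by (intro card_subset_eq) (auto simp: card_image)
  have per: "chi (l mod int q) = chi l" for l
    using dirichlet_character_periodic[OF chi, of "l mod int q" "l div int q"] by (simp add: mod_div_mult_eq)
  have "(\<Sum>l\<in>?R. chi l) = (\<Sum>l\<in>?\<pi> ` ?R. chi l)" unfolding im ..
  also have "\<dots> = (\<Sum>l\<in>?R. chi (?\<pi> l))" by (simp add: sum.reindex[OF inj])
  also have "\<dots> = chi a * (\<Sum>l\<in>?R. chi l)"
    unfolding per using chi by (simp add: dirichlet_character_def sum_distrib_left)
  finally have "(1 - chi a) * (\<Sum>l\<in>?R. chi l) = 0" by (simp add: algebra_simps)
  then have 0: "(\<Sum>l\<in>?R. chi l) = 0" using a(2) by simp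
  have "?R = int ` {..<q}" by (simp add: image_int_atLeastLessThan flip: atLeast0LessThan)
  then have "(\<Sum>l\<in>?R. chi l) = (\<Sum>l<q. chi (int l))" by (simp add: sum.reindex)
  also have "\<dots> = (\<Sum>l=1..q-1. chi (int l))"
    using dirichlet_character_0[OF chi q, of 0] q by (intro sum_lessThan_eq_from_1) auto
  finally show ?thesis using 0 by simp
qed

text \<open>The limit along whole blocks is the limit of all partial sums, since the terms of the
  Dirichlet series tend to 0; this covers the conditionally convergent range as well.\<close>

lemma Mellin_K_eq_dirichlet_L:
  assumes chi: "dirichlet_character q chi" and np: "\<not> principal_character q chi" and q: "q > 1"
    and z: "Re z > 0"
  shows "2 powr (z - 1) * integral {0<..} (\<lambda>u. of_real u powr (z - 1) * zero_sum_weights.K q (\<lambda>l. chi (int l)) (of_real u))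
    = of_nat q powr z * Gamma z * dirichlet_L chi z"
proof -
  interpret zero_sum_weights q "\<lambda>l. chi (int l)"
    using q nonprincipal_character_sum[OF chi np q] by unfold_locales
  let ?t = "\<lambda>i. chi (int (Suc i)) * of_nat (Suc i) powr (- z)"
  let ?c = "of_nat q powr z * Gamma z"
  let ?I = "2 powr (z - 1) * integral {0<..} (\<lambda>u. of_real u powr (z - 1) * K (of_real u))"
  have c0: "?c \<noteq> 0" using q z by (auto simp: Gamma_eq_zero_iff elim!: nonpos_Ints_cases')
  have blk: "(\<Sum>i<N*q. ?t i) = (\<Sum>k<N. \<Sum>l=1..q-1. chi (int l) * of_nat (k * q + l) powr (- z))" for N
  proof -
    have "(\<Sum>i<N*q. ?t i) = (\<Sum>k<N. \<Sum>i=0+k*q..<q+k*q. ?t i)"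
      by (subst sum.nat_group[symmetric]) (simp add: add.commute)
    also have "\<dots> = (\<Sum>k<N. \<Sum>l=1..q-1. chi (int l) * of_nat (k * q + l) powr (- z))"
    proof (rule sum.cong[OF refl])
      fix k
      have "(\<Sum>i=0+k*q..<q+k*q. ?t i) = (\<Sum>j<q. ?t (j + k * q))"
        unfolding sum.shift_bounds_nat_ivl by (simp add: atLeast0LessThan)
      also have "\<dots> = (\<Sum>j<q. chi (int (Suc j)) * of_nat (k * q + Suc j) powr (- z))"
      proof (intro sum.cong refl)
        fix j
        have "int (Suc (j + k * q)) = int (Suc j) + int k * int q" by simp
        then have "chi (int (Suc (j + k * q))) = chi (int (Suc j))" using dirichlet_character_periodic[OF chi] by metis
        then show "?t (j + k * q) = chi (int (Suc j)) * of_nat (k * q + Suc j) powr (- z)"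
          by (simp add: add_ac)
      qed
      \<comment> \<open>The series starts at l = 1, so a block reaches from k q + 1 to k q + q; its
        last term carries \<chi>(q) = 0.\<close>
      also have "\<dots> = (\<Sum>l=1..q. chi (int l) * of_nat (k * q + l) powr (- z))"
        by (rule sum.reindex_bij_witness[of _ "\<lambda>l. l - 1" Suc]) auto
      also have "{1..q} = insert q {1..q-1}" using q by auto
      also have "(\<Sum>l\<in>insert q {1..q-1}. chi (int l) * of_nat (k * q + l) powr (- z)) =
         (\<Sum>l=1..q-1. chi (int l) * of_nat (k * q + l) powr (- z))"
        using dirichlet_character_0[OF chi q, of 1] q by (subst sum.insert) auto
      finally show "(\<Sum>i=0+k*q..<q+k*q. ?t i) = (\<Sum>l=1..q-1. chi (int l) * of_nat (k * q + l) powr (- z))" .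
    qed
    finally show ?thesis .
  qed
  have "(\<lambda>N. ?c * (\<Sum>i<N*q. ?t i) / ?c) \<longlonglongrightarrow> ?I / ?c"
    unfolding blk by (rule tendsto_divide[OF Mellin_K_eq_limit[OF z] tendsto_const c0])
  then have lim: "(\<lambda>N. \<Sum>i<N*q. ?t i) \<longlonglongrightarrow> ?I / ?c" using c0 by simp
  have "?t \<longlonglongrightarrow> 0"
  proof (rule Lim_null_comparison)
    let ?B = "\<Sum>l<q. cmod (chi (int l))"
    have "((\<lambda>x::real. x powr (- Re z)) \<longlongrightarrow> 0) at_top" using z by (intro tendsto_neg_powr filterlim_ident) auto
    moreover have "filterlim (\<lambda>i. real (Suc i)) at_top sequentially"
      by (intro filterlim_compose[OF filterlim_real_sequentially] filterlim_Suc)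
    ultimately have "(\<lambda>i. real (Suc i) powr (- Re z)) \<longlonglongrightarrow> 0" by (rule filterlim_compose)
    from tendsto_mult_left[OF this, of ?B] show "(\<lambda>i. ?B * real (Suc i) powr (- Re z)) \<longlonglongrightarrow> 0" by simp
    show "\<forall>\<^sub>F i in sequentially. norm (?t i) \<le> ?B * real (Suc i) powr (- Re z)"
    proof (intro always_eventually allI)
      fix i
      have "int (Suc i) = int (Suc i mod q) + int (Suc i div q) * int q"
        by (metis add.commute div_mult_mod_eq of_nat_add of_nat_mult)
      then have "chi (int (Suc i)) = chi (int (Suc i mod q))" using dirichlet_character_periodic[OF chi] by metis
      moreover have "cmod (chi (int (Suc i mod q))) \<le> ?B" using q by (intro member_le_sum) auto
      moreover have "cmod (of_nat (Suc i) powr (- z)) = real (Suc i) powr (- Re z)"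
        using cmod_of_real_powr[of "real (Suc i)" "- z"] by simp
      ultimately show "norm (?t i) \<le> ?B * real (Suc i) powr (- Re z)"
        unfolding norm_mult by (simp add: mult_right_mono del: of_nat_Suc)
    qed
  qed
  with lim have "?t sums (?I / ?c)" using q by (intro sums_of_block_limit[of q]) auto
  then have "dirichlet_L chi z = ?I / ?c"
    using z by (simp add: dirichlet_L_def dirichlet_series_def sums_iff)
  then show ?thesis using c0 by simp
qed

section \<open>The Stieltjes transform of the kernel\<close>

text \<open>Extending the fraction by u^2 + b^2 with an auxiliary b different from c splits the
  integrand into two-pole integrands with exponents z + 2 and z.\<close>

lemma Mellin_one_pole_absolutely_integrable:
  fixes z :: complex and c :: real
  assumes z: "0 < Re z" "Re z < 2" and c: "c > 0"
  shows "(\<lambda>u. of_real u powr (z - 1) / complex_of_real (u\<^sup>2 + c\<^sup>2)) absolutely_integrable_on {0<..}"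
proof -
  define b where "b = c + 1"
  have b: "b > 0" "b \<noteq> c" using c by (auto simp: b_def)
  let ?f = "\<lambda>z u. of_real u powr (z - 1) / complex_of_real ((u\<^sup>2 + b\<^sup>2) * (u\<^sup>2 + c\<^sup>2))"
  have z2: "0 < Re (z + 2)" "Re (z + 2) < 4" "z + 2 \<noteq> 2" and z0: "0 < Re z" "Re z < 4" "z \<noteq> 2"
    using z by auto
  have "(\<lambda>u. ?f (z + 2) u + of_real (b\<^sup>2) * ?f z u) absolutely_integrable_on {0<..}"
    using Mellin_two_poles_square(1)[OF z2 b(1) c b(2)] Mellin_two_poles_square(1)[OF z0 b(1) c b(2)]
    by (intro set_integral_add set_integrable_mult_right) auto
  moreover have "?f (z + 2) u + of_real (b\<^sup>2) * ?f z u = of_real u powr (z - 1) / complex_of_real (u\<^sup>2 + c\<^sup>2)"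
    if "u \<in> {0<..}" for u
  proof -
    have pw: "of_real u powr (z + 2 - 1) = of_real u powr (z - 1) * complex_of_real (u\<^sup>2)"
      using that powr_add[of "complex_of_real u" "z - 1" 2] by (simp add: powr_numeral)
    have ne: "complex_of_real (u\<^sup>2 + b\<^sup>2) \<noteq> 0" "complex_of_real (u\<^sup>2 + c\<^sup>2) \<noteq> 0"
      unfolding of_real_eq_0_iff using that by (auto simp: add_nonneg_eq_0_iff)
    have frac: "X * U / ((U + b') * C) + b' * (X / ((U + b') * C)) = X / C"
      if "U + b' \<noteq> 0" "C \<noteq> 0" for X U C b' :: complex
    proof -
      have "X * U / ((U + b') * C) + b' * (X / ((U + b') * C)) = X * (U + b') / ((U + b') * C)"
        by (simp only: distrib_left add_divide_distrib mult.commute times_divide_eq_right times_divide_eq_left)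
      then show ?thesis using that by simp
    qed
    show ?thesis unfolding pw of_real_mult of_real_add
      by (rule frac) (use ne in \<open>simp_all only: of_real_add not_False_eq_True\<close>)
  qed
  ultimately show ?thesis by (subst (asm) set_integrable_cong[OF refl refl]) auto
qed

context zero_sum_weights
begin

section \<open>Integrating the pole terms\<close>

lemma pole_pair_0: "pole_pair u 0 = 0"
  using sum_x by (simp add: pole_pair_def Wcos_def)

text \<open>By the addition theorem this is the sum of x_l sin(2 pi n l / q + pi w / 2), the inner
  sum in \<open>gamma_fun\<close>.\<close>

definition Wphase :: "complex \<Rightarrow> nat \<Rightarrow> complex" where
  "Wphase w n = Wcos n * sin (of_real pi * w / 2) + Wsin n * cos (of_real pi * w / 2)"

lemma Wphase_0: "Wphase w 0 = 0"
  using sum_x by (simp add: Wphase_def Wcos_def Wsin_def)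

context
  fixes y :: real and w :: complex
  assumes y: "y > 0" "sin y \<noteq> 0" and w: "0 < Re w" "Re w < 2" "w \<noteq> 1"
begin

lemma y_neq_pi: "y \<noteq> pi * real n"
  using y(2) by (metis mult.commute sin_npi)

text \<open>Sine and cosine of pi w / 2 vanish exactly at the even and the odd integers w, and 1 is
  the only integer in the open strip.\<close>

lemma trig_w_nonzero: "sin (of_real pi * w / 2) \<noteq> 0" "cos (of_real pi * w / 2) \<noteq> 0"
proof -
  have k: "w \<noteq> of_int (2 * k)" for k :: int
  proof
    assume "w = of_int (2 * k)"
    then have "Re w = 2 * of_int k" by simp
    with w have "0 < real_of_int k" "real_of_int k < 1" by linarith+
    then show False by simp
  qed
  show "sin (of_real pi * w / 2) \<noteq> 0"
  proof
    assume "sin (of_real pi * w / 2) = 0"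
    then obtain n :: int where "of_real pi * w / 2 = of_real (of_int n * pi)" by (auto simp: sin_eq_0)
    then have "w = of_int (2 * n)" by (simp add: field_simps)
    with k show False by blast
  qed
  show "cos (of_real pi * w / 2) \<noteq> 0"
  proof
    assume "cos (of_real pi * w / 2) = 0"
    then obtain n :: int where "of_real pi * w / 2 = of_real (of_int n * pi) + of_real pi / 2" by (auto simp: cos_eq_0)
    then have "of_real pi * w = of_real pi * (of_int (2 * n) + 1)" by (simp add: field_simps)
    then have wn: "w = of_int (2 * n) + 1" by simp
    then have "Re w = 2 * of_int n + 1" by simp
    with w have "- 1 < real_of_int n" "real_of_int n < 1" by linarith+
    then have "n = 0" by linarith
    with wn w(3) show False by simp
  qed
qed

text \<open>The parts of a pole pair proportional to u and constant in u lead to two-pole Mellin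
  integrals with exponents w + 1 and w, hence to the denominators cos(pi w / 2) and sin(pi w / 2).
  The powers of pi n combine to \<open>Wphase\<close> over sin(pi w); the powers of y stay apart and
  later become phi.\<close>

lemma integral_pole_pair:
  "((\<lambda>u. of_real u powr (w - 1) * pole_pair (of_real u) n / of_real (u\<^sup>2 + y\<^sup>2)) has_integral
     2 * of_real pi / sin (of_real pi * w) * (of_real (pi * real n) powr (w - 1) * Wphase w n / of_real (y\<^sup>2 - (pi * real n)\<^sup>2))
     - (of_real pi * of_real y powr (w - 1) / cos (of_real pi * w / 2) * (Wcos n / of_real (y\<^sup>2 - (pi * real n)\<^sup>2))
        + of_real pi * of_real y powr (w - 2) / sin (of_real pi * w / 2) * (of_real (pi * real n) * Wsin n / of_real (y\<^sup>2 - (pi * real n)\<^sup>2)))) {0<..}"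
proof (cases "n = 0")
  case True
  have "Wcos 0 = 0" using sum_x by (simp add: Wcos_def)
  then show ?thesis using True by (simp add: pole_pair_0 Wphase_0 has_integral_is_0)
next
  case False
  define b where "b = pi * real n"
  have b: "b > 0" "b \<noteq> y" using False y_neq_pi[of n] by (auto simp: b_def)
  have zc: "0 < Re (w + 1)" "Re (w + 1) < 4" "w + 1 \<noteq> 2" and zs: "0 < Re w" "Re w < 4" "w \<noteq> 2"
    using w by (auto simp: complex_eq_iff)
  let ?I = "\<lambda>z u. of_real u powr (z - 1) / complex_of_real ((u\<^sup>2 + b\<^sup>2) * (u\<^sup>2 + y\<^sup>2))"
  let ?V = "\<lambda>z. of_real pi / (2 * sin (of_real pi * z / 2)) * (of_real b powr (z - 2) - of_real y powr (z - 2)) / complex_of_real (y\<^sup>2 - b\<^sup>2)"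
  have Ic: "(?I (w + 1) has_integral ?V (w + 1)) {0<..}"
    using abs_int_imp_has_integral[OF Mellin_two_poles_square(1)[OF zc b(1) y(1) b(2)]]
    unfolding Mellin_two_poles_square(2)[OF zc b(1) y(1) b(2)] .
  have Is: "(?I w has_integral ?V w) {0<..}"
    using abs_int_imp_has_integral[OF Mellin_two_poles_square(1)[OF zs b(1) y(1) b(2)]]
    unfolding Mellin_two_poles_square(2)[OF zs b(1) y(1) b(2)] .
  have "((\<lambda>u. (2 * Wcos n) * ?I (w + 1) u + (2 * of_real b * Wsin n) * ?I w u) has_integral
      (2 * Wcos n) * ?V (w + 1) + (2 * of_real b * Wsin n) * ?V w) {0<..}"
    by (intro has_integral_add has_integral_mult_right Ic Is)
  moreover have "(2 * Wcos n) * ?I (w + 1) u + (2 * of_real b * Wsin n) * ?I w u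
      = of_real u powr (w - 1) * pole_pair (of_real u) n / of_real (u\<^sup>2 + y\<^sup>2)" if "u \<in> {0<..}" for u
  proof -
    have "of_real u powr (w + 1 - 1) = of_real u powr (w - 1) * complex_of_real u"
      using that powr_add[of "complex_of_real u" "w - 1" 1] by simp
    moreover have "2 * c * (X * U / (B * Y)) + 2 * b' * s * (X / (B * Y)) = X * ((2 * U * c + 2 * b' * s) / B) / Y"
      for c X U B Y b' s :: complex
      by (simp add: add_divide_distrib algebra_simps)
    ultimately show ?thesis unfolding pole_pair_def b_def[symmetric] by (simp only: of_real_mult of_real_add of_real_power)
  qed
  ultimately have 1: "((\<lambda>u. of_real u powr (w - 1) * pole_pair (of_real u) n / of_real (u\<^sup>2 + y\<^sup>2)) has_integral
      (2 * Wcos n) * ?V (w + 1) + (2 * of_real b * Wsin n) * ?V w) {0<..}"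
    by (rule has_integral_eq[rotated])
  have "of_real pi * (w + 1) / 2 = of_real pi * w / 2 + of_real pi / 2" by (simp add: distrib_left add_divide_distrib)
  then have sc: "sin (of_real pi * (w + 1) / 2) = cos (of_real pi * w / 2)" by (simp only: sin_add) simp
  have ss: "sin (of_real pi * w) = 2 * sin (of_real pi * w / 2) * cos (of_real pi * w / 2)"
    using sin_double[of "of_real pi * w / 2"] by simp
  have bw: "of_real b powr (w - 1) = of_real b * complex_of_real b powr (w - 2)"
    using b powr_add[of "complex_of_real b" 1 "w - 2"] by (simp add: add.commute)
  have w12: "w + 1 - 2 = w - 1" by simp
  have alg: "2 * c * (p / (2 * k) * (b' * B - Y1) / D) + 2 * b' * s * (p / (2 * t) * (B - Y2) / D) =
      2 * p / (2 * t * k) * (b' * B * (c * t + s * k) / D) - (p * Y1 / k * (c / D) + p * Y2 / t * (b' * s / D))"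
    if "k \<noteq> 0" "t \<noteq> 0" "D \<noteq> 0" for c p k b' B Y1 D s t Y2 :: complex
    using that by (simp add: field_simps)
  have D: "complex_of_real (y\<^sup>2 - b\<^sup>2) \<noteq> 0"
    unfolding of_real_eq_0_iff using b y by (simp add: power2_eq_iff_nonneg)
  have "(2 * Wcos n) * ?V (w + 1) + (2 * of_real b * Wsin n) * ?V w =
     2 * of_real pi / sin (of_real pi * w) * (of_real b powr (w - 1) * Wphase w n / of_real (y\<^sup>2 - b\<^sup>2))
     - (of_real pi * of_real y powr (w - 1) / cos (of_real pi * w / 2) * (Wcos n / of_real (y\<^sup>2 - b\<^sup>2))
        + of_real pi * of_real y powr (w - 2) / sin (of_real pi * w / 2) * (of_real b * Wsin n / of_real (y\<^sup>2 - b\<^sup>2)))"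
    unfolding w12 sc ss bw Wphase_def by (rule alg[OF trig_w_nonzero(2,1) D])
  with 1 show ?thesis unfolding b_def by (simp only:)
qed

text \<open>The difference of the partial fractions at i y and -i y isolates the cosine weights,
  their sum the sine weights. The condition sin y \<noteq> 0 keeps both points away from the
  poles.\<close>

lemma pole_sums_at_imaginary_point:
  shows "(\<lambda>M. \<Sum>n<M*q. Wcos n / of_real (y\<^sup>2 - (pi * real n)\<^sup>2)) \<longlonglongrightarrow>
      (\<Sum>l=1..q-1. x l * of_real (cos ((1 - 2 * real l / real q) * y))) / (2 * of_real y * of_real (sin y))"
    and "(\<lambda>M. \<Sum>n<M*q. of_real (pi * real n) * Wsin n / of_real (y\<^sup>2 - (pi * real n)\<^sup>2)) \<longlonglongrightarrow>
      - (\<Sum>l=1..q-1. x l * of_real (sin ((1 - 2 * real l / real q) * y))) / (2 * of_real (sin y))"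
proof -
  let ?a = "\<lambda>l. (1 - 2 * real l / real q) * y"
  let ?C = "\<Sum>l=1..q-1. x l * of_real (cos (?a l))" and ?S = "\<Sum>l=1..q-1. x l * of_real (sin (?a l))"
  have sh: "sinh (\<i> * of_real y) = \<i> * of_real (sin y)" "sinh (- (\<i> * of_real y)) = - (\<i> * of_real (sin y))"
  proof -
    show "sinh (\<i> * of_real y) = \<i> * of_real (sin y)"
      by (simp add: sinh_conv_sin sin_of_real flip: mult.assoc)
    then show "sinh (- (\<i> * of_real y)) = - (\<i> * of_real (sin y))" by simp
  qed
  have s0: "complex_of_real (sin y) \<noteq> 0" "complex_of_real y \<noteq> 0" using y by auto
  have Kp: "K (\<i> * of_real y) = (?C + \<i> * ?S) / (\<i> * of_real (sin y))"
  proof -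
    have "exp ((1 - 2 * of_nat l / of_nat q) * (\<i> * of_real y)) = of_real (cos (?a l)) + \<i> * of_real (sin (?a l))" for l
    proof -
      have "(1 - 2 * of_nat l / of_nat q) * (\<i> * of_real y) = \<i> * of_real (?a l)" by simp
      then show ?thesis by (simp only: exp_Euler cos_of_real sin_of_real)
    qed
    then have "K (\<i> * of_real y) = (\<Sum>l=1..q-1. x l * (of_real (cos (?a l)) + \<i> * of_real (sin (?a l)))) / sinh (\<i> * of_real y)"
      unfolding K_def by (simp only:)
    then show ?thesis unfolding sh by (simp only: distrib_left sum.distrib sum_distrib_left mult.left_commute)
  qed
  have Km: "K (- (\<i> * of_real y)) = (?C - \<i> * ?S) / (- (\<i> * of_real (sin y)))"
  proof -
    have "exp ((1 - 2 * of_nat l / of_nat q) * (- (\<i> * of_real y))) = of_real (cos (?a l)) - \<i> * of_real (sin (?a l))" for l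
    proof -
      have "(1 - 2 * of_nat l / of_nat q) * (- (\<i> * of_real y)) = \<i> * of_real (- ?a l)" by simp
      then have "exp ((1 - 2 * of_nat l / of_nat q) * (- (\<i> * of_real y))) = of_real (cos (- ?a l)) + \<i> * of_real (sin (- ?a l))"
        by (simp only: exp_Euler cos_of_real sin_of_real)
      then show ?thesis by (simp only: cos_minus sin_minus of_real_minus mult_minus_right add_uminus_conv_diff)
    qed
    then have "K (- (\<i> * of_real y)) = (\<Sum>l=1..q-1. x l * (of_real (cos (?a l)) - \<i> * of_real (sin (?a l)))) / sinh (- (\<i> * of_real y))"
      unfolding K_def by (simp only:)
    then show ?thesis unfolding sh by (simp only: right_diff_distrib sum_subtractf sum_distrib_left mult.left_commute)
  qed
  have lp: "(\<lambda>M. \<Sum>n<M*q. pole_pair (\<i> * of_real y) n) \<longlonglongrightarrow> K (\<i> * of_real y)"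
    by (rule K_partial_fractions) (simp add: sh y)
  have lm: "(\<lambda>M. \<Sum>n<M*q. pole_pair (- (\<i> * of_real y)) n) \<longlonglongrightarrow> K (- (\<i> * of_real y))"
    by (rule K_partial_fractions) (simp only: sh, use y in simp)
  have D: "complex_of_real (y\<^sup>2 - (pi * real n)\<^sup>2) \<noteq> 0" for n
    unfolding of_real_eq_0_iff using y_neq_pi[of n] y(1) by (simp add: power2_eq_iff_nonneg)
  have tp: "pole_pair (\<i> * of_real y) n = - (2 * (\<i> * of_real y) * Wcos n + 2 * of_real (pi * real n) * Wsin n) / of_real (y\<^sup>2 - (pi * real n)\<^sup>2)"
    and tm: "pole_pair (- (\<i> * of_real y)) n = - (- 2 * (\<i> * of_real y) * Wcos n + 2 * of_real (pi * real n) * Wsin n) / of_real (y\<^sup>2 - (pi * real n)\<^sup>2)" for n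
  proof -
    have d: "(\<i> * of_real y)\<^sup>2 + of_real ((pi * real n)\<^sup>2) = - complex_of_real (y\<^sup>2 - (pi * real n)\<^sup>2)"
      by (simp add: power_mult_distrib)
    show "pole_pair (\<i> * of_real y) n = - (2 * (\<i> * of_real y) * Wcos n + 2 * of_real (pi * real n) * Wsin n) / of_real (y\<^sup>2 - (pi * real n)\<^sup>2)"
      unfolding pole_pair_def d by (simp only: divide_minus_right minus_divide_left)
    show "pole_pair (- (\<i> * of_real y)) n = - (- 2 * (\<i> * of_real y) * Wcos n + 2 * of_real (pi * real n) * Wsin n) / of_real (y\<^sup>2 - (pi * real n)\<^sup>2)"
      unfolding pole_pair_def power2_minus d by (simp only: divide_minus_right minus_divide_left mult_minus_left mult_minus_right)
  qed
  have "(\<lambda>M. ((\<Sum>n<M*q. pole_pair (\<i> * of_real y) n) - (\<Sum>n<M*q. pole_pair (- (\<i> * of_real y)) n)) / (- 4 * (\<i> * of_real y))) \<longlonglongrightarrow>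
      (K (\<i> * of_real y) - K (- (\<i> * of_real y))) / (- 4 * (\<i> * of_real y))"
    by (intro tendsto_divide tendsto_diff lp lm tendsto_const) (use s0 in auto)
  also have "(\<lambda>M. ((\<Sum>n<M*q. pole_pair (\<i> * of_real y) n) - (\<Sum>n<M*q. pole_pair (- (\<i> * of_real y)) n)) / (- 4 * (\<i> * of_real y)))
     = (\<lambda>M. \<Sum>n<M*q. Wcos n / of_real (y\<^sup>2 - (pi * real n)\<^sup>2))"
  proof -
    have "(- (2 * Y * c + s) / d - - (- 2 * Y * c + s) / d) / (- 4 * Y) = c / d" if "Y \<noteq> 0" "d \<noteq> 0" for Y c s d :: complex
      using that by (simp add: field_simps)
    then have "(pole_pair (\<i> * of_real y) n - pole_pair (- (\<i> * of_real y)) n) / (- 4 * (\<i> * of_real y)) = Wcos n / of_real (y\<^sup>2 - (pi * real n)\<^sup>2)" for n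
      unfolding tp tm using D[of n] s0 by simp
    then show ?thesis by (simp only: sum_subtractf[symmetric] sum_divide_distrib)
  qed
  also have "(K (\<i> * of_real y) - K (- (\<i> * of_real y))) / (- 4 * (\<i> * of_real y)) = ?C / (2 * of_real y * of_real (sin y))"
  proof -
    have "((C + \<i> * S) / (\<i> * t) - (C - \<i> * S) / (- (\<i> * t))) / (- 4 * (\<i> * Y)) = C / (2 * Y * t)"
      if "t \<noteq> 0" "Y \<noteq> 0" for C S t Y :: complex
      using that by (simp add: field_simps)
    then show ?thesis unfolding Kp Km using s0 by blast
  qed
  finally show "(\<lambda>M. \<Sum>n<M*q. Wcos n / of_real (y\<^sup>2 - (pi * real n)\<^sup>2)) \<longlonglongrightarrow> ?C / (2 * of_real y * of_real (sin y))" .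
  have "(\<lambda>M. ((\<Sum>n<M*q. pole_pair (\<i> * of_real y) n) + (\<Sum>n<M*q. pole_pair (- (\<i> * of_real y)) n)) / (- 4)) \<longlonglongrightarrow>
      (K (\<i> * of_real y) + K (- (\<i> * of_real y))) / (- 4)"
    by (intro tendsto_divide tendsto_add lp lm tendsto_const) auto
  also have "(\<lambda>M. ((\<Sum>n<M*q. pole_pair (\<i> * of_real y) n) + (\<Sum>n<M*q. pole_pair (- (\<i> * of_real y)) n)) / (- 4))
     = (\<lambda>M. \<Sum>n<M*q. of_real (pi * real n) * Wsin n / of_real (y\<^sup>2 - (pi * real n)\<^sup>2))"
  proof -
    have "(- (2 * Y * c + 2 * p * s) / d + - (- 2 * Y * c + 2 * p * s) / d) / (- 4) = p * s / d" if "d \<noteq> 0" for Y c s d p :: complex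
      using that by (simp add: field_simps)
    then have "(pole_pair (\<i> * of_real y) n + pole_pair (- (\<i> * of_real y)) n) / (- 4) = of_real (pi * real n) * Wsin n / of_real (y\<^sup>2 - (pi * real n)\<^sup>2)" for n
      unfolding tp tm using D[of n] by blast
    then show ?thesis by (simp only: sum.distrib[symmetric] sum_divide_distrib)
  qed
  also have "(K (\<i> * of_real y) + K (- (\<i> * of_real y))) / (- 4) = - ?S / (2 * of_real (sin y))"
  proof -
    have "((C + \<i> * S) / (\<i> * t) + (C - \<i> * S) / (- (\<i> * t))) / (- 4) = - S / (2 * t)"
      if "t \<noteq> 0" for C S t :: complex
      using that by (simp add: field_simps)
    then show ?thesis unfolding Kp Km using s0 by blast
  qed
  finally show "(\<lambda>M. \<Sum>n<M*q. of_real (pi * real n) * Wsin n / of_real (y\<^sup>2 - (pi * real n)\<^sup>2)) \<longlonglongrightarrow> - ?S / (2 * of_real (sin y))" .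
qed

text \<open>The uniform block bound allows integrating the partial fractions against u^(w - 1) /
  (u^2 + y^2). The integrated series splits into the one sought and the two pole sums at the
  imaginary point; the latter have known limits, and solving for the former gives the
  formula.\<close>

theorem Stieltjes_K_series:
  "(\<lambda>M. \<Sum>n<M*q. of_real (pi * real n) powr (w - 1) * Wphase w n / of_real (y\<^sup>2 - (pi * real n)\<^sup>2)) \<longlonglongrightarrow>
     sin (of_real pi * w) / (2 * of_real pi) *
       (integral {0<..} (\<lambda>u. of_real u powr (w - 1) * K (of_real u) / of_real (u\<^sup>2 + y\<^sup>2)) +
        of_real pi * of_real y powr (w - 2) / (2 * of_real (sin y)) *
         ((\<Sum>l=1..q-1. x l * of_real (cos ((1 - 2 * real l / real q) * y))) / cos (of_real pi * w / 2)
          - (\<Sum>l=1..q-1. x l * of_real (sin ((1 - 2 * real l / real q) * y))) / sin (of_real pi * w / 2)))"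
proof -
  obtain D where D: "\<And>M u. u > 0 \<Longrightarrow> cmod (\<Sum>n<M*q. pole_pair (of_real u) n) \<le> D" by (rule pole_pair_sum_bound) blast
  let ?R = "integral {0<..} (\<lambda>u. of_real u powr (w - 1) * K (of_real u) / of_real (u\<^sup>2 + y\<^sup>2))"
  let ?C = "\<Sum>l=1..q-1. x l * of_real (cos ((1 - 2 * real l / real q) * y))"
  let ?S = "\<Sum>l=1..q-1. x l * of_real (sin ((1 - 2 * real l / real q) * y))"
  let ?A = "\<lambda>n. of_real (pi * real n) powr (w - 1) * Wphase w n / of_real (y\<^sup>2 - (pi * real n)\<^sup>2)"
  let ?cc = "\<lambda>n. Wcos n / of_real (y\<^sup>2 - (pi * real n)\<^sup>2)"
  let ?ss = "\<lambda>n. of_real (pi * real n) * Wsin n / of_real (y\<^sup>2 - (pi * real n)\<^sup>2)"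
  define \<alpha> where "\<alpha> = 2 * of_real pi / sin (of_real pi * w)"
  define \<beta> where "\<beta> = of_real pi * of_real y powr (w - 1) / cos (of_real pi * w / 2)"
  define \<delta> where "\<delta> = of_real pi * of_real y powr (w - 2) / sin (of_real pi * w / 2)"
  let ?f = "\<lambda>M u. \<Sum>n<M*q. of_real u powr (w - 1) * pole_pair (of_real u) n / of_real (u\<^sup>2 + y\<^sup>2)"
  have feq: "?f M u = (\<Sum>n<M*q. pole_pair (of_real u) n) * (of_real u powr (w - 1) / of_real (u\<^sup>2 + y\<^sup>2))" for M u
    unfolding sum_distrib_right by (intro sum.cong refl) simp
  have fint: "(?f M has_integral (\<Sum>n<M*q. \<alpha> * ?A n - (\<beta> * ?cc n + \<delta> * ?ss n))) {0<..}" for M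
    unfolding \<alpha>_def \<beta>_def \<delta>_def by (intro has_integral_sum integral_pole_pair) auto
  have "(\<lambda>M. integral {0<..} (?f M)) \<longlonglongrightarrow> ?R"
  proof (rule dominated_convergence(2)[where h = "\<lambda>u. D * norm (of_real u powr (w - 1) / complex_of_real (u\<^sup>2 + y\<^sup>2))"])
    show "?f M integrable_on {0<..}" for M using fint by blast
    have "(\<lambda>u. norm (of_real u powr (w - 1) / complex_of_real (u\<^sup>2 + y\<^sup>2))) integrable_on {0<..}"
      using Mellin_one_pole_absolutely_integrable[OF w(1,2) y(1)] by (simp add: absolutely_integrable_on_def)
    then show "(\<lambda>u. D * norm (of_real u powr (w - 1) / complex_of_real (u\<^sup>2 + y\<^sup>2))) integrable_on {0<..}"
      by (rule integrable_on_mult_right)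
    fix u :: real assume "u \<in> {0<..}"
    then have u: "u > 0" by simp
    show "norm (?f M u) \<le> D * norm (of_real u powr (w - 1) / complex_of_real (u\<^sup>2 + y\<^sup>2))" for M
      unfolding feq norm_mult using D[OF u] by (rule mult_right_mono) simp
    have "sinh (complex_of_real u) = of_real (sinh u)"
      by (simp add: sinh_field_def exp_of_real flip: of_real_minus)
    then have "sinh (complex_of_real u) \<noteq> 0" using u by simp
    from tendsto_mult_right[OF K_partial_fractions[OF this], of "of_real u powr (w - 1) / of_real (u\<^sup>2 + y\<^sup>2)"]
    show "(\<lambda>M. ?f M u) \<longlonglongrightarrow> of_real u powr (w - 1) * K (of_real u) / of_real (u\<^sup>2 + y\<^sup>2)"
      unfolding feq by (simp only: times_divide_eq_right mult.commute)
  qed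
  then have "(\<lambda>M. \<Sum>n<M*q. \<alpha> * ?A n - (\<beta> * ?cc n + \<delta> * ?ss n)) \<longlonglongrightarrow> ?R"
    by (simp only: integral_unique[OF fint])
  also have "(\<lambda>M. \<Sum>n<M*q. \<alpha> * ?A n - (\<beta> * ?cc n + \<delta> * ?ss n)) =
     (\<lambda>M. \<alpha> * (\<Sum>n<M*q. ?A n) - (\<beta> * (\<Sum>n<M*q. ?cc n) + \<delta> * (\<Sum>n<M*q. ?ss n)))"
    by (simp only: sum_subtractf sum.distrib sum_distrib_left)
  finally have L: "(\<lambda>M. \<alpha> * (\<Sum>n<M*q. ?A n) - (\<beta> * (\<Sum>n<M*q. ?cc n) + \<delta> * (\<Sum>n<M*q. ?ss n))) \<longlonglongrightarrow> ?R" .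
  have P: "(\<lambda>M. \<beta> * (\<Sum>n<M*q. ?cc n) + \<delta> * (\<Sum>n<M*q. ?ss n)) \<longlonglongrightarrow>
      \<beta> * (?C / (2 * of_real y * of_real (sin y))) + \<delta> * (- ?S / (2 * of_real (sin y)))"
    by (intro tendsto_add tendsto_mult tendsto_const pole_sums_at_imaginary_point)
  from tendsto_mult_left[OF tendsto_add[OF L P], of "1 / \<alpha>"]
  have "(\<lambda>M. 1 / \<alpha> * (\<alpha> * (\<Sum>n<M*q. ?A n))) \<longlonglongrightarrow>
     1 / \<alpha> * (?R + (\<beta> * (?C / (2 * of_real y * of_real (sin y))) + \<delta> * (- ?S / (2 * of_real (sin y)))))"
    by (simp only: diff_add_cancel)
  note lim = this
  have sw: "sin (of_real pi * w) \<noteq> 0"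
    using sin_double[of "of_real pi * w / 2"] trig_w_nonzero by simp
  then have "\<alpha> \<noteq> 0" by (simp add: \<alpha>_def)
  then have cancel: "1 / \<alpha> * (\<alpha> * X) = X" for X by simp
  have inv: "1 / \<alpha> = sin (of_real pi * w) / (2 * of_real pi)" by (simp add: \<alpha>_def)
  have rest: "\<beta> * (?C / (2 * of_real y * of_real (sin y))) + \<delta> * (- ?S / (2 * of_real (sin y))) =
     of_real pi * of_real y powr (w - 2) / (2 * of_real (sin y)) * (?C / cos (of_real pi * w / 2) - ?S / sin (of_real pi * w / 2))"
  proof -
    have yw: "of_real y powr (w - 1) = of_real y * complex_of_real y powr (w - 2)"
      using y powr_add[of "complex_of_real y" 1 "w - 2"] by (simp add: add.commute)
    have "p * (Y * X) / k * (C / (2 * Y * t)) + p * X / s * (- S / (2 * t)) = p * X / (2 * t) * (C / k - S / s)"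
      if "Y \<noteq> 0" "k \<noteq> 0" "s \<noteq> 0" "t \<noteq> 0" for p Y X k C t s S :: complex
      using that by (simp add: field_simps)
    then show ?thesis unfolding \<beta>_def \<delta>_def yw using y trig_w_nonzero by simp
  qed
  show ?thesis using lim[unfolded cancel, unfolded rest inv] .
qed

end

end

section \<open>The interpolant\<close>

lemma continuous_AE_bounded_imp_bounded:
  fixes f :: "real \<Rightarrow> real"
  assumes cont: "continuous_on UNIV f" and AE: "AE y in lebesgue. f y \<le> C"
  shows "f x \<le> C"
proof (rule ccontr)
  assume "\<not> f x \<le> C"
  then have ne: "{y. C < f y} \<noteq> {}" by (auto simp: not_le)
  \<comment> \<open>An open set that is not empty is not negligible, so a violation of the bound
    cannot hide in the exceptional null set.\<close>
  have op: "open {y. C < f y}" using cont by (intro open_Collect_less continuous_intros)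
  obtain N where "negligible N" "{y. \<not> f y \<le> C} \<subseteq> N"
    using AE by (auto simp: eventually_ae_filter_negligible)
  then have "negligible {y. C < f y}" by (auto simp: not_le elim: negligible_subset)
  with open_not_negligible[OF op ne] show False by blast
qed

lemma admissible_interpolant_unique:
  assumes "admissible_interpolant s q chi g1" "admissible_interpolant s q chi g2"
  shows "g1 = g2"
proof -
  let ?p = "phi_fun s q chi"
  have hol: "g1 holomorphic_on UNIV" "g2 holomorphic_on UNIV"
    and et: "exponential_type 1 g1" "exponential_type 1 g2"
    and node: "\<And>n::int. g1 (of_real (pi * of_int n)) = ?p (pi * of_int n)" "\<And>n::int. g2 (of_real (pi * of_int n)) = ?p (pi * of_int n)"
    and L: "in_L_infinity (\<lambda>y. ?p y - g1 (of_real y))" "in_L_infinity (\<lambda>y. ?p y - g2 (of_real y))"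
    and d: "deriv g1 0 = 0" "deriv g2 0 = 0"
    using assms unfolding admissible_interpolant_def by auto
  define h where "h z = g1 z - g2 z" for z
  have holh: "h holomorphic_on UNIV" unfolding h_def by (intro holomorphic_intros hol)
  have eth: "exponential_type 1 h" unfolding h_def using et by (rule exponential_type_diff)
  have zeros: "h (of_real (pi * of_int n)) = 0" for n :: int using node by (simp add: h_def)
  obtain C1 C2 where C: "AE y in lebesgue. norm (?p y - g1 (of_real y)) \<le> C1" "AE y in lebesgue. norm (?p y - g2 (of_real y)) \<le> C2"
    using L unfolding in_L_infinity_def by blast
  have "AE y in lebesgue. norm (h (of_real y)) \<le> C1 + C2"
    using C
  proof eventually_elim
    case (elim y)
    have "h (of_real y) = (?p y - g2 (of_real y)) - (?p y - g1 (of_real y))" by (simp add: h_def)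
    then show ?case using norm_triangle_ineq4[of "?p y - g2 (of_real y)" "?p y - g1 (of_real y)"] elim by simp
  qed
  moreover have "continuous_on UNIV (\<lambda>y. norm (h (of_real y)))"
    by (intro continuous_on_norm continuous_on_compose2[OF holomorphic_on_imp_continuous_on[OF holh]] continuous_intros) auto
  \<comment> \<open>With phi cancelled, the bound concerns a continuous function and therefore holds
    at every point.\<close>
  ultimately have bnd: "norm (h (of_real y)) \<le> C1 + C2" for y
    by (rule continuous_AE_bounded_imp_bounded[rotated])
  obtain c where c: "\<And>z. h z = c * sin z"
    using bounded_type_one_vanishing_at_sin_zeros[OF holh eth bnd zeros] by metis
  have "(h has_field_derivative deriv g1 0 - deriv g2 0) (at 0)"
    unfolding h_def
    by (intro DERIV_diff holomorphic_derivI[OF hol(1) open_UNIV] holomorphic_derivI[OF hol(2) open_UNIV]) auto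
  moreover have "(h has_field_derivative c) (at 0)"
  proof -
    have "((\<lambda>z. c * sin z) has_field_derivative c) (at 0)" by (auto intro!: derivative_eq_intros)
    then show ?thesis unfolding c[abs_def, symmetric] .
  qed
  ultimately have "c = 0" using d DERIV_unique by fastforce
  then have "h z = 0" for z using c by simp
  then show ?thesis by (auto simp: h_def fun_eq_iff)
qed

text \<open>Used with r = y^2 and v = u^2; the exact remainder makes the expansion valid for every
  ratio r / v, large or small.\<close>

lemma geometric_partial_fraction:
  fixes r v :: real
  assumes "r > 0" "v > 0"
  shows "r / (r + v) = (\<Sum>j=1..m. (- 1) ^ (j - 1) * (r ^ j / v ^ j)) + (- 1) ^ m * (r ^ (m + 1) / (v ^ m * (v + r)))"
proof (induction m)
  case (Suc m)
  have "r ^ (m + 1) / (v ^ m * (v + r)) = r ^ (m + 1) / v ^ (m + 1) - r ^ (m + 2) / (v ^ (m + 1) * (v + r))"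
  proof -
    have "A / (V * t) = A / (V * v) - A * r / (V * v * t)" if "t = v + r" "V > 0" for A V t :: real
    proof -
      have t: "t > 0" using that assms by simp
      have "A / (V * v) - A * r / (V * v * t) = A * t / (V * v * t) - A * r / (V * v * t)" using t by simp
      also have "\<dots> = A * v / (V * v * t)"
        unfolding that(1) by (simp only: diff_divide_distrib[symmetric] right_diff_distrib[symmetric] add_diff_cancel_right')
      finally show ?thesis using assms by simp
    qed
    from this[OF refl, of "v ^ m" "r ^ (m + 1)"] show ?thesis using assms by (simp add: mult.commute)
  qed
  then have "(- 1) ^ m * (r ^ (m + 1) / (v ^ m * (v + r))) =
     (- 1) ^ m * (r ^ (m + 1) / v ^ (m + 1)) + (- 1) ^ (m + 1) * (r ^ (m + 2) / (v ^ (m + 1) * (v + r)))"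
    by (simp add: right_diff_distrib)
  with Suc show ?case by simp
qed (simp add: add.commute)

locale nonprincipal_setup =
  fixes q :: nat and chi :: "int \<Rightarrow> complex" and s :: complex
  assumes q1: "q > 1" and chi: "dirichlet_character q chi" and np: "\<not> principal_character q chi"
    and s0: "Re s > 0" and s_even: "\<And>k::nat. k \<ge> 1 \<Longrightarrow> Re s \<noteq> 2 * real k"
    and s_nat: "\<And>n::nat. n \<ge> 1 \<Longrightarrow> s \<noteq> of_nat n"

sublocale nonprincipal_setup \<subseteq> zero_sum_weights q "\<lambda>l. chi (int l)"
  using q1 nonprincipal_character_sum[OF chi np q1] by unfold_locales

context nonprincipal_setup
begin

abbreviation (input) m :: nat where "m \<equiv> m1 s"

text \<open>An even shift of s into the strip 0 < Re w < 2 where the pole integrals are available;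
  it changes the half-angle sine and cosine only by the sign (-1)^\<open>m1 s\<close>.\<close>

definition w :: complex where "w = s - 2 * of_nat (m1 s)"

text \<open>The floor in \<open>m1\<close> gives 0 <= Re w < 2; equality on the left would make Re s
  zero or a positive even number, and w = 1 would make s an odd natural number.\<close>

lemma w_bounds: "0 < Re w" "Re w < 2" "w \<noteq> 1"
proof -
  have f: "\<lfloor>Re s / 2\<rfloor> \<ge> 0" using s0 by simp
  then have m: "real (m1 s) = of_int \<lfloor>Re s / 2\<rfloor>" by (simp add: m1_def)
  have 1: "real (m1 s) \<le> Re s / 2" "Re s / 2 < real (m1 s) + 1" unfolding m by linarith+
  have "Re s \<noteq> 2 * real (m1 s)" using s_even[of "m1 s"] s0 by (cases "m1 s = 0") auto
  with 1 show "0 < Re w" "Re w < 2" by (auto simp: w_def)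
  show "w \<noteq> 1"
  proof
    assume "w = 1"
    then have "s = of_nat (2 * m1 s + 1)" by (simp add: w_def algebra_simps)
    then show False using s_nat[of "2 * m1 s + 1"] by simp
  qed
qed

lemma s_eq: "s = w + 2 * of_nat (m1 s)" by (simp add: w_def)

lemma sin_cos_half_s:
  "sin (of_real pi * s / 2) = (- 1) ^ m1 s * sin (of_real pi * w / 2)"
  "cos (of_real pi * s / 2) = (- 1) ^ m1 s * cos (of_real pi * w / 2)"
proof -
  have e: "of_real pi * s / 2 = of_real pi * w / 2 + of_real (real (m1 s) * pi)"
    by (subst s_eq) (simp add: algebra_simps add_divide_distrib)
  have z: "sin (complex_of_real (real (m1 s) * pi)) = 0" "cos (complex_of_real (real (m1 s) * pi)) = (- 1) ^ m1 s"
    unfolding sin_of_real cos_of_real by (simp_all add: sin_npi cos_npi)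
  show "sin (of_real pi * s / 2) = (- 1) ^ m1 s * sin (of_real pi * w / 2)"
    "cos (of_real pi * s / 2) = (- 1) ^ m1 s * cos (of_real pi * w / 2)"
    unfolding e sin_add cos_add z by (simp_all add: mult.commute)
qed

lemma trig_half_w_nonzero: "sin (of_real pi * w / 2) \<noteq> 0" "cos (of_real pi * w / 2) \<noteq> 0"
  \<comment> \<open>The point y = 1, where sin is positive, serves to enter the context in which the
    lemma was proved.\<close>
  using trig_w_nonzero[of 1 w] w_bounds sin_gt_zero_02[of 1] by auto

lemma trig_half_s_nonzero: "sin (of_real pi * s / 2) \<noteq> 0" "cos (of_real pi * s / 2) \<noteq> 0"
  unfolding sin_cos_half_s using trig_half_w_nonzero by auto

lemma sin_pi_s: "sin (of_real pi * s) = 2 * sin (of_real pi * s / 2) * cos (of_real pi * s / 2)"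
  "sin (of_real pi * w) = 2 * sin (of_real pi * w / 2) * cos (of_real pi * w / 2)"
  using sin_double[of "of_real pi * s / 2"] sin_double[of "of_real pi * w / 2"] by simp_all

lemma sin_pi_s_eq: "sin (of_real pi * s) = sin (of_real pi * w)"
  unfolding sin_pi_s sin_cos_half_s by (simp add: mult_ac flip: power_mult_distrib)

lemma sin_pi_s_nonzero: "sin (of_real pi * s) \<noteq> 0"
  unfolding sin_pi_s using trig_half_s_nonzero by simp

lemma Wphase_s: "Wphase s n = (- 1) ^ m1 s * Wphase w n"
  unfolding Wphase_def sin_cos_half_s by (simp add: algebra_simps)

lemma Wphase_eq_sum:
  "(\<Sum>l=1..q-1. chi (int l) * sin (2 * of_real pi * of_nat n * of_nat l / of_nat q + of_real pi * z / 2)) = Wphase z n"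
proof -
  have "sin (2 * of_real pi * of_nat n * of_nat l / of_nat q + of_real pi * z / 2) =
     of_real (cos (2 * pi * real n * real l / real q)) * sin (of_real pi * z / 2) +
     of_real (sin (2 * pi * real n * real l / real q)) * cos (of_real pi * z / 2)" for l
  proof -
    have "2 * of_real pi * of_nat n * of_nat l / of_nat q = complex_of_real (2 * pi * real n * real l / real q)" by simp
    then show ?thesis by (simp only: sin_add sin_of_real cos_of_real) (simp only: add.commute)
  qed
  then show ?thesis
    by (simp add: Wphase_def Wcos_def Wsin_def sum_distrib_right distrib_left sum.distrib mult.assoc)
qed

lemma Wphase_eq_sum_sgn:
  assumes "n \<noteq> 0"
  shows "(\<Sum>l=1..q-1. chi (int l) * sin (2 * of_real pi * of_int n * of_nat l / of_nat q + of_real pi * z / 2 * of_int (sgn n)))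
     = of_int (sgn n) * Wphase z (nat \<bar>n\<bar>)"
proof (cases "n > 0")
  case True
  then have "of_int n = (of_nat (nat \<bar>n\<bar>) :: complex)" by simp
  then show ?thesis using True Wphase_eq_sum[of "nat \<bar>n\<bar>" z] by simp
next
  case False
  with assms have n: "n < 0" by simp
  then have "of_int n = - (of_nat (nat \<bar>n\<bar>) :: complex)" by (simp add: of_nat_nat)
  then have "sin (2 * of_real pi * of_int n * of_nat l / of_nat q + of_real pi * z / 2 * of_int (sgn n)) =
    - sin (2 * of_real pi * of_nat (nat \<bar>n\<bar>) * of_nat l / of_nat q + of_real pi * z / 2)" for l
  proof -
    assume e: "of_int n = - (of_nat (nat \<bar>n\<bar>) :: complex)"
    have "2 * of_real pi * of_int n * of_nat l / of_nat q + of_real pi * z / 2 * of_int (sgn n) =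
       - (2 * of_real pi * of_nat (nat \<bar>n\<bar>) * of_nat l / of_nat q + of_real pi * z / 2)"
      unfolding e using n by simp
    then show ?thesis by (simp only: sin_minus)
  qed
  then show ?thesis using n Wphase_eq_sum[of "nat \<bar>n\<bar>" z] by (simp add: sum_negf)
qed

section \<open>Symmetry of the exceptional set\<close>

lemma E_set_iff_Wexp: "n \<in> E_set q chi \<longleftrightarrow> Wexp (- n) = 0"
  unfolding E_set_def Wexp_def by simp

text \<open>Replacing l by q - l and using \<chi>(-l) = \<chi>(-1) \<chi>(l), which rests on the
  multiplicativity of the character.\<close>

lemma Wexp_minus: "Wexp n = chi (- 1) * Wexp (- n)"
proof -
  have "chi (- 1) * Wexp (- n) = (\<Sum>l=1..q-1. chi (- int l) * exp (2 * of_real pi * \<i> * of_int n * of_nat l / of_nat q))"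
  proof -
    have "chi (- int l) = chi (- 1) * chi (int l)" for l
      using chi by (metis dirichlet_character_def mult_minus1)
    then show ?thesis unfolding Wexp_def by (simp add: sum_distrib_left mult.assoc)
  qed
  also have "\<dots> = (\<Sum>l=1..q-1. chi (int l) * exp (- (2 * of_real pi * \<i> * of_int n * of_nat l / of_nat q)))"
  proof (rule sum.reindex_bij_witness[of _ "\<lambda>l. q - l" "\<lambda>l. q - l"])
    fix l assume l: "l \<in> {1..q-1}"
    then have "int (q - l) = - int l + 1 * int q" by auto
    then have c: "chi (int (q - l)) = chi (- int l)" using dirichlet_character_periodic[OF chi] by metis
    have "- (2 * of_real pi * \<i> * of_int n * of_nat (q - l) / of_nat q) =
       2 * of_real pi * \<i> * of_int n * of_nat l / of_nat q + 2 * of_real pi * \<i> * of_int (- n)"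
    proof -
      have "complex_of_nat (q - l) = of_nat q - of_nat l" using l by (subst of_nat_diff) auto
      then show ?thesis using q by (simp only:) (simp add: field_simps)
    qed
    note e = this
    have "exp (- (2 * of_real pi * \<i> * of_int n * of_nat (q - l) / of_nat q)) =
       exp (2 * of_real pi * \<i> * of_int n * of_nat l / of_nat q)"
      unfolding e exp_add exp_2pi_i_of_int by (rule mult_1_right)
    with c show "chi (int (q - l)) * exp (- (2 * of_real pi * \<i> * of_int n * of_nat (q - l) / of_nat q)) =
        chi (- int l) * exp (2 * of_real pi * \<i> * of_int n * of_nat l / of_nat q)" by simp
  qed auto
  finally show ?thesis unfolding Wexp_def by simp
qed

lemma chi_minus_1: "chi (- 1) \<noteq> 0"
  using chi by (simp add: dirichlet_character_def)

lemma E_set_minus: "- n \<in> E_set q chi \<longleftrightarrow> n \<in> E_set q chi"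
  by (metis E_set_iff_Wexp Wexp_minus chi_minus_1 minus_minus mult_eq_0_iff)

lemma E_set_nat_abs: "int (nat \<bar>n\<bar>) \<in> E_set q chi \<longleftrightarrow> n \<in> E_set q chi"
  using E_set_minus[of n] by (cases "n \<ge> 0") auto

text \<open>Membership makes \<open>Wexp\<close> vanish at both n and -n, hence both trigonometric
  weights. Thus the indices left out of the series in gamma would contribute 0.\<close>

lemma Wphase_E_set:
  assumes "int n \<in> E_set q chi"
  shows "Wphase z n = 0"
proof -
  have "Wexp (- int n) = 0" "Wexp (int n) = 0"
    using assms E_set_iff_Wexp Wexp_minus[of "int n"] by auto
  then have "Wcos n + \<i> * Wsin n = 0" "Wcos n - \<i> * Wsin n = 0" by (simp_all add: Wexp_int)
  then have "2 * Wcos n = 0" "2 * \<i> * Wsin n = 0" by algebra+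
  then show ?thesis by (simp add: Wphase_def)
qed

definition N :: "nat set" where "N = {n. 1 \<le> n \<and> int n \<notin> E_set q chi}"

definition c :: "nat \<Rightarrow> complex" where
  "c n = (of_real pi * of_nat n) powr (w - 1) * Wphase s n"

definition \<kappa> :: complex where "\<kappa> = of_real pi * 2 powr s / sin (of_real pi * s)"

definition a :: "nat \<Rightarrow> complex" where
  "a j = (- 1) ^ (j - 1) * of_nat q powr (s - 2 * of_nat j) * Gamma (s - 2 * of_nat j) * dirichlet_L chi (s - 2 * of_nat j)"

lemma gamma_fun_eq:
  "gamma_fun s q chi = (\<lambda>y. - (sin y * (\<Sum>j=1..m. a j * (2 * y) ^ (2 * j)) +
        \<kappa> * y ^ (2 * (m + 1)) * (\<Sum>\<^sub>\<infinity>n\<in>N. c n * sin_quotient n y)))"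
proof
  fix y
  have p: "s - 2 * of_nat (m1 s) - 1 = w - 1" by (simp add: w_def)
  show "gamma_fun s q chi y = - (sin y * (\<Sum>j=1..m. a j * (2 * y) ^ (2 * j)) +
        \<kappa> * y ^ (2 * (m + 1)) * (\<Sum>\<^sub>\<infinity>n\<in>N. c n * sin_quotient n y))"
    unfolding gamma_fun_def p Wphase_eq_sum N_def[symmetric] c_def[symmetric] a_def[symmetric]
    by (simp add: \<kappa>_def)
qed

lemma N_ge_1: "n \<in> N \<Longrightarrow> n \<ge> 1" by (simp add: N_def)

text \<open>The angles 2 pi n l / q are real and leave the imaginary part of the argument of sin
  unchanged, so \<open>Wphase\<close> is bounded in n and the terms are O(n^(Re w - 3)) with Re w <
  2.\<close>

lemma c_summable: "summable (\<lambda>n. cmod (c n) / (real n)\<^sup>2)"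
proof -
  define B where "B = (\<Sum>l=1..q-1. cmod (chi (int l))) * exp \<bar>Im (of_real pi * s / 2)\<bar>"
  have "cmod (Wphase s n) \<le> B" for n
  proof -
    have "cmod (Wphase s n) \<le> (\<Sum>l=1..q-1. cmod (chi (int l)) * exp \<bar>Im (of_real pi * s / 2)\<bar>)"
      unfolding Wphase_eq_sum[symmetric]
    proof (rule sum_norm_le)
      fix l
      have "2 * of_real pi * of_nat n * of_nat l / of_nat q = complex_of_real (2 * pi * real n * real l / real q)" by simp
      then have "Im (2 * of_real pi * of_nat n * of_nat l / of_nat q + of_real pi * s / 2) = Im (of_real pi * s / 2)"
        by (simp only: plus_complex.sel Im_complex_of_real add_0)
      then show "cmod (chi (int l) * sin (2 * of_real pi * of_nat n * of_nat l / of_nat q + of_real pi * s / 2))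
          \<le> cmod (chi (int l)) * exp \<bar>Im (of_real pi * s / 2)\<bar>"
        unfolding norm_mult using norm_sin_le_exp_Im by (metis mult_left_mono norm_ge_zero)
    qed
    then show ?thesis by (simp add: B_def sum_distrib_right)
  qed
  note W = this
  have "summable (\<lambda>n. (pi powr (Re w - 1) * B) * real n powr (Re w - 3))"
    using w_bounds by (intro summable_mult) (simp add: summable_real_powr_iff)
  then show ?thesis
  proof (rule summable_comparison_test')
    fix n :: nat assume n: "n \<ge> 1"
    have "cmod (c n) = (pi * real n) powr (Re w - 1) * cmod (Wphase s n)"
      using n cmod_of_real_powr[of "pi * real n" "w - 1"] by (simp add: c_def norm_mult)
    also have "\<dots> \<le> (pi * real n) powr (Re w - 1) * B" by (intro mult_left_mono W) auto
    also have "(pi * real n) powr (Re w - 1) = pi powr (Re w - 1) * real n powr (Re w - 1)"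
      by (simp add: powr_mult)
    finally have "cmod (c n) / (real n)\<^sup>2 \<le> pi powr (Re w - 1) * real n powr (Re w - 1) * B / (real n)\<^sup>2"
      by (rule divide_right_mono) simp
    also have "\<dots> = (pi powr (Re w - 1) * B) * (real n powr (Re w - 1) / real n powr 2)"
      using n by (simp add: powr_numeral)
    also have "real n powr (Re w - 1) / real n powr 2 = real n powr (Re w - 3)"
      using powr_diff[of "real n" "Re w - 1" 2] by simp
    finally show "norm (cmod (c n) / (real n)\<^sup>2) \<le> (pi powr (Re w - 1) * B) * real n powr (Re w - 3)"
      by simp
  qed
qed

lemma gamma_fun_holomorphic: "gamma_fun s q chi holomorphic_on UNIV"
  unfolding gamma_fun_eq by (rule interpolant_holomorphic[OF N_ge_1 c_summable])

lemma gamma_fun_exponential_type: "exponential_type 1 (gamma_fun s q chi)"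
  unfolding gamma_fun_eq by (rule interpolant_exponential_type[OF N_ge_1 c_summable])

lemma gamma_fun_deriv_0: "deriv (gamma_fun s q chi) 0 = 0"
  unfolding gamma_fun_eq by (rule interpolant_deriv_0[OF N_ge_1 c_summable])

lemma gamma_fun_0: "gamma_fun s q chi 0 = 0"
  unfolding gamma_fun_eq by simp

lemma gamma_fun_minus: "gamma_fun s q chi (- y) = - gamma_fun s q chi y"
  unfolding gamma_fun_eq by (rule interpolant_minus[OF N_ge_1 c_summable])

lemma phi_fun_0: "phi_fun s q chi 0 = 0"
  by (simp add: phi_fun_def)

lemma phi_fun_minus: "phi_fun s q chi (- y) = - phi_fun s q chi y"
proof -
  have "A * (Y * (- S) / a' + Y * (- g) * C / b) = - (A * (Y * S / a' + Y * g * C / b))" for A Y S a' g C b :: complex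
    by (simp add: algebra_simps)
  then show ?thesis
    unfolding phi_fun_def mult_minus_right sin_minus cos_minus of_real_minus sum_negf abs_minus_cancel sgn_minus .
qed

section \<open>Values at the nodes\<close>

definition node_value :: "int \<Rightarrow> complex" where
  "node_value k = - (of_real pi * 2 powr (s - 1) * (- 1) powi k * of_real (pi * of_int \<bar>k\<bar>) powr s
                      / sin (of_real pi * s)) * (of_int (sgn k) * Wphase s (nat \<bar>k\<bar>))"

lemma two_powr_s: "2 powr s = 2 * 2 powr (s - 1)" "2 powr (s - 1) = 2 * 2 powr (s - 2 :: complex)"
  using powr_add[of "2 :: complex" 1 "s - 1"] powr_add[of "2 :: complex" 1 "s - 2"] by simp_all

text \<open>With r = pi |k| the powers r^(2 (m + 1)) and r^(w - 1) multiply to r times r^s, and the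
  extra r cancels against the 1 / (2 pi k) of the sine quotient up to the sign of k. For k in the
  exceptional set both sides are 0.\<close>

lemma gamma_fun_at_node:
  assumes k: "k \<noteq> 0"
  shows "gamma_fun s q chi (of_real (pi * of_int k)) = node_value k"
proof -
  let ?n = "nat \<bar>k\<bar>" and ?r = "complex_of_real (pi * of_int \<bar>k\<bar>)"
  have n: "?n \<in> N \<longleftrightarrow> k \<notin> E_set q chi" using k E_set_nat_abs[of k] unfolding N_def mem_Collect_eq by linarith
  have val: "gamma_fun s q chi (of_real (pi * of_int k)) = (if ?n \<in> N then
     - (\<kappa> * of_real (pi * of_int k) ^ (2 * (m + 1)) * (c ?n * ((- 1) powi k / (2 * of_real (pi * of_int k))))) else 0)"
    unfolding gamma_fun_eq by (rule interpolant_at_node[OF N_ge_1 c_summable k])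
  show ?thesis
  proof (cases "?n \<in> N")
    case False
    then have "Wphase s ?n = 0" using n E_set_nat_abs[of k] Wphase_E_set[of ?n s] by blast
    then show ?thesis unfolding val using False by (simp add: node_value_def)
  next
    case True
    have r: "?r \<noteq> 0" using k by simp
    have "pi * real_of_int \<bar>k\<bar> = pi * real ?n" by simp
    then have rn: "?r = of_real pi * of_nat ?n" by (simp only: of_real_mult of_real_of_nat_eq)
    have kr: "of_real (pi * of_int k) = of_int (sgn k) * ?r"
      by (cases "k > 0") (use k in \<open>auto simp: sgn_if\<close>)
    have sg: "of_int (sgn k) * of_int (sgn k) = (1 :: complex)" using k by (auto simp: sgn_if)
    have pw: "of_real (pi * of_int k) ^ (2 * (m + 1)) = ?r ^ (2 * (m + 1))"
    proof -
      have "(complex_of_real (pi * of_int k))\<^sup>2 = ?r\<^sup>2"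
        by (simp only: of_real_power[symmetric]) (simp add: power_mult_distrib)
      then show ?thesis by (simp only: power_mult)
    qed
    have rs: "?r ^ (2 * (m + 1)) * ?r powr (w - 1) = ?r * ?r powr s"
    proof -
      have "?r ^ (2 * (m + 1)) = ?r powr (of_nat (2 * (m + 1)))" by (rule powr_nat'[symmetric]) (use r in auto)
      then have "?r ^ (2 * (m + 1)) * ?r powr (w - 1) = ?r powr (of_nat (2 * (m + 1)) + (w - 1))" by (simp only: powr_add)
      also have "of_nat (2 * (m + 1)) + (w - 1) = 1 + s" by (simp add: w_def)
      also have "?r powr (1 + s) = ?r * ?r powr s" unfolding powr_add using r by (simp only: powr_to_1)
      finally show ?thesis .
    qed
    have inv: "1 / (2 * of_real (pi * of_int k)) = of_int (sgn k) / (2 * ?r)"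
    proof -
      have "1 / (2 * (g * R)) = g / (2 * R)" if "g * g = 1" for g R :: complex
      proof -
        have "g \<noteq> 0" using that by auto
        then have "1 / (2 * (g * R)) = (g * g) / (2 * (g * R))" using that by simp
        with \<open>g \<noteq> 0\<close> show ?thesis by simp
      qed
      from this[OF sg] show ?thesis unfolding kr .
    qed
    have alg: "A * P * (X * S * (e / D)) = A * (P * X) * S * e * (1 / D)" for A P X S e D :: complex by simp
    have "\<kappa> * of_real (pi * of_int k) ^ (2 * (m + 1)) * (c ?n * ((- 1) powi k / (2 * of_real (pi * of_int k))))
        = \<kappa> * ?r ^ (2 * (m + 1)) * (?r powr (w - 1) * Wphase s ?n * ((- 1) powi k / (2 * of_real (pi * of_int k))))"
      unfolding c_def rn[symmetric] pw by (rule refl)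
    also have "\<dots> = \<kappa> * (?r ^ (2 * (m + 1)) * ?r powr (w - 1)) * Wphase s ?n * (- 1) powi k * (1 / (2 * of_real (pi * of_int k)))"
      by (rule alg)
    also have "\<dots> = \<kappa> * (?r * ?r powr s) * Wphase s ?n * (- 1) powi k * (of_int (sgn k) / (2 * ?r))"
      unfolding rs inv by (rule refl)
    also have "\<dots> = \<kappa> / 2 * ?r powr s * Wphase s ?n * (- 1) powi k * of_int (sgn k)"
      using r by (simp del: of_real_mult)
    also have "\<dots> = - node_value k"
      unfolding \<kappa>_def node_value_def two_powr_s(1) by (simp del: of_real_mult)
    finally show ?thesis unfolding val using True by simp
  qed
qed

text \<open>The angle (2 l / q - 1) pi k differs from 2 pi k l / q by pi k, which contributes the
  sign (-1)^k; over the common denominator sin(pi s / 2) cos(pi s / 2) = sin(pi s) / 2 the two sums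
  form \<open>Wphase s\<close>.\<close>

lemma phi_fun_at_node:
  assumes k: "k \<noteq> 0"
  shows "phi_fun s q chi (pi * of_int k) = node_value k"
proof -
  let ?n = "nat \<bar>k\<bar>"
  have ck: "cos (pi * of_int k) = (- 1) powi k" and sk: "sin (pi * of_int k) = 0"
    by (cases "even k", auto elim!: evenE oddE simp: cos_int_2pin power_int_minus_left algebra_simps cos_add sin_int_2pin sin_add)
  have ang: "(2 * real l / real q - 1) * (pi * of_int k) = 2 * pi * of_int k * real l / real q - pi * of_int k" for l
    by (simp add: algebra_simps)
  have kn: "real_of_int k = of_int (sgn k) * real ?n" using k by (auto simp: sgn_if)
  have sn: "sin (2 * pi * of_int k * real l / real q) = of_int (sgn k) * sin (2 * pi * real ?n * real l / real q)"
    and cn: "cos (2 * pi * of_int k * real l / real q) = cos (2 * pi * real ?n * real l / real q)" for l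
    unfolding kn using k by (auto simp: sgn_if)
  have S: "(\<Sum>l=1..q-1. chi (int l) * of_real (sin ((2 * real l / real q - 1) * (pi * of_int k)))) = (- 1) powi k * of_int (sgn k) * Wsin ?n"
    unfolding ang sin_diff ck sk sn Wsin_def sum_distrib_left by (intro sum.cong refl) (simp add: of_real_power_int)
  have C: "(\<Sum>l=1..q-1. chi (int l) * of_real (cos ((2 * real l / real q - 1) * (pi * of_int k)))) = (- 1) powi k * Wcos ?n"
    unfolding ang cos_diff ck sk cn Wcos_def sum_distrib_left by (intro sum.cong refl) (simp add: of_real_power_int)
  have ab: "\<bar>pi * real_of_int k\<bar> = pi * of_int \<bar>k\<bar>" by (simp add: abs_mult)
  have sg: "sgn (pi * real_of_int k) = of_int (sgn k)" by (simp add: sgn_mult) (simp add: sgn_if)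
  have alg: "- p * z * (R * (e * g * S) / t + R * g * (e * C) / k') = - (p * (2 * z) * e * R / (2 * t * k')) * (g * (C * t + S * k'))"
    if "t \<noteq> 0" "k' \<noteq> 0" for p z R e g S t C k' :: complex
    using that by (simp add: field_simps)
  show ?thesis
    unfolding phi_fun_def S C ab sg node_value_def Wphase_def sin_pi_s(1) two_powr_s(2) of_real_of_int_eq
    by (rule alg[OF trig_half_s_nonzero])
qed

end

section \<open>The integral representation of the difference\<close>

context nonprincipal_setup
begin

definition I :: "real \<Rightarrow> complex" where
  "I y = 2 powr (s - 1) * integral {0<..} (\<lambda>u. of_real u powr (s - 1) * K (of_real u) * of_real (y\<^sup>2 / (y\<^sup>2 + u\<^sup>2)))"

text \<open>The factor 2^(2 j) comes from 2^(s - 1) = 2^(2 j) 2^(s - 2 j - 1) and turns y^(2 j) into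
  the (2 y)^(2 j) of gamma. The restriction on j keeps Re (s - 2 j) positive, as the Mellin formula
  requires.\<close>

lemma moment_eq:
  assumes j: "j \<le> m1 s"
  shows "2 powr (s - 1) * integral {0<..} (\<lambda>u. of_real u powr (s - 2 * of_nat j - 1) * K (of_real u)) =
     2 ^ (2 * j) * (of_nat q powr (s - 2 * of_nat j) * Gamma (s - 2 * of_nat j) * dirichlet_L chi (s - 2 * of_nat j))"
proof -
  have "real j \<le> real (m1 s)" using j by simp
  then have "Re (s - 2 * of_nat j) > 0" using w_bounds(1) by (simp add: w_def)
  note M = Mellin_K_eq_dirichlet_L[OF chi np q1 this]
  have "(2 :: complex) powr (s - 1) = 2 powr (of_nat (2 * j)) * 2 powr (s - 2 * of_nat j - 1)"
    unfolding powr_add[symmetric] by simp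
  also have "(2 :: complex) powr (of_nat (2 * j)) = 2 ^ (2 * j)" by (rule powr_nat') simp
  finally have e: "(2 :: complex) powr (s - 1) = 2 ^ (2 * j) * 2 powr (s - 2 * of_nat j - 1)" .
  show ?thesis unfolding e M[symmetric] by (rule mult.assoc)
qed

lemma moment_0:
  "2 powr (s - 1) * integral {0<..} (\<lambda>u. of_real u powr (s - 1) * K (of_real u)) =
     of_nat q powr s * Gamma s * dirichlet_L chi s"
  using moment_eq[of 0] by simp

lemma Stieltjes_absolutely_integrable:
  assumes y: "y \<noteq> 0"
  shows "(\<lambda>u. of_real u powr (w - 1) * K (of_real u) / of_real (u\<^sup>2 + y\<^sup>2)) absolutely_integrable_on {0<..}"
proof (rule integral_Ioi_bound)
  have ne: "complex_of_real (u\<^sup>2 + y\<^sup>2) \<noteq> 0" for u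
    unfolding of_real_eq_0_iff using y by (auto simp: add_nonneg_eq_0_iff)
  show "continuous_on {0<..} (\<lambda>u. of_real u powr (w - 1) * K (of_real u) / of_real (u\<^sup>2 + y\<^sup>2))"
    by (intro continuous_on_divide continuous_on_mult continuous_on_powr_of_real continuous_on_K continuous_intros ballI ne)
  have "(\<lambda>u. norm (of_real u powr (w - 1) * K (of_real u))) integrable_on {0<..}"
    using Mellin_K_absolutely_integrable[OF w_bounds(1)] by (simp add: absolutely_integrable_on_def)
  then show "(\<lambda>u. norm (of_real u powr (w - 1) * K (of_real u)) * (1 / y\<^sup>2)) integrable_on {0<..}"
    by (rule integrable_on_mult_left)
  fix u :: real
  have "norm (of_real u powr (w - 1) * K (of_real u) / of_real (u\<^sup>2 + y\<^sup>2)) =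
     norm (of_real u powr (w - 1) * K (of_real u)) * (1 / (u\<^sup>2 + y\<^sup>2))"
    unfolding norm_divide norm_of_real by simp
  also have "\<dots> \<le> norm (of_real u powr (w - 1) * K (of_real u)) * (1 / y\<^sup>2)"
    using y by (intro mult_left_mono frac_le) auto
  finally show "norm (of_real u powr (w - 1) * K (of_real u) / of_real (u\<^sup>2 + y\<^sup>2)) \<le>
     norm (of_real u powr (w - 1) * K (of_real u)) * (1 / y\<^sup>2)" .
qed

text \<open>For j <= \<open>m1 s\<close> the moments at s - 2 j converge at 0, so they may be
  integrated separately; dividing u^(2 \<open>m1 s\<close>) out of u^(s - 1) leaves the exponent w -
  1 of the remainder.\<close>

lemma I_eq:
  assumes y: "y > 0"
  shows "I y = (\<Sum>j=1..m1 s. a j * (2 * of_real y) ^ (2 * j)) +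
     2 powr (s - 1) * (- 1) ^ m1 s * of_real y ^ (2 * (m1 s + 1)) *
       integral {0<..} (\<lambda>u. of_real u powr (w - 1) * K (of_real u) / of_real (u\<^sup>2 + y\<^sup>2))"
proof -
  let ?m = "m1 s"
  let ?X = "\<lambda>j u. of_real u powr (s - 2 * of_nat j - 1) * K (of_real u)"
  let ?Z = "\<lambda>u. of_real u powr (w - 1) * K (of_real u) / of_real (u\<^sup>2 + y\<^sup>2)"
  let ?b = "\<lambda>j. (- 1) ^ (j - 1) * complex_of_real y ^ (2 * j)"
  let ?e = "(- 1) ^ ?m * complex_of_real y ^ (2 * (?m + 1))"
  have pt: "of_real u powr (s - 1) * K (of_real u) * of_real (y\<^sup>2 / (y\<^sup>2 + u\<^sup>2)) =
      (\<Sum>j=1..?m. ?b j * ?X j u) + ?e * ?Z u" if u: "u \<in> {0<..}" for u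
  proof -
    have up: "u > 0" using u by simp
    have ex: "of_real u powr (s - 1) = of_real u ^ (2 * j) * of_real u powr (s - 2 * of_nat j - 1)" for j
    proof -
      have "complex_of_real u powr (s - 1) = of_real u powr (of_nat (2 * j)) * of_real u powr (s - 2 * of_nat j - 1)"
        unfolding powr_add[symmetric] by simp
      also have "complex_of_real u powr (of_nat (2 * j)) = of_real u ^ (2 * j)"
        by (rule powr_nat') (use up in simp)
      finally show ?thesis .
    qed
    have "y\<^sup>2 / (y\<^sup>2 + u\<^sup>2) = (\<Sum>j=1..?m. (- 1) ^ (j - 1) * ((y\<^sup>2) ^ j / (u\<^sup>2) ^ j)) + (- 1) ^ ?m * ((y\<^sup>2) ^ (?m + 1) / ((u\<^sup>2) ^ ?m * (u\<^sup>2 + y\<^sup>2)))"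
      using y up by (intro geometric_partial_fraction) auto
    then have "complex_of_real (y\<^sup>2 / (y\<^sup>2 + u\<^sup>2)) =
       (\<Sum>j=1..?m. (- 1) ^ (j - 1) * (of_real y ^ (2 * j) / of_real u ^ (2 * j))) +
       (- 1) ^ ?m * (of_real y ^ (2 * (?m + 1)) / (of_real u ^ (2 * ?m) * of_real (u\<^sup>2 + y\<^sup>2)))"
      unfolding power_mult[symmetric]
      by (simp only: of_real_add of_real_sum of_real_mult of_real_divide of_real_power of_real_minus of_real_1)
    then have expand: "of_real u powr (s - 1) * K (of_real u) * of_real (y\<^sup>2 / (y\<^sup>2 + u\<^sup>2)) =
       (\<Sum>j=1..?m. of_real u powr (s - 1) * K (of_real u) * ((- 1) ^ (j - 1) * (of_real y ^ (2 * j) / of_real u ^ (2 * j)))) +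
       of_real u powr (s - 1) * K (of_real u) * ((- 1) ^ ?m * (of_real y ^ (2 * (?m + 1)) / (of_real u ^ (2 * ?m) * of_real (u\<^sup>2 + y\<^sup>2))))"
      by (simp only: distrib_left sum_distrib_left)
    have t1: "of_real u powr (s - 1) * K (of_real u) * ((- 1) ^ (j - 1) * (of_real y ^ (2 * j) / of_real u ^ (2 * j))) = ?b j * ?X j u" for j
      using up by (subst ex[of j]) simp
    have t2: "of_real u powr (s - 1) * K (of_real u) * ((- 1) ^ ?m * (of_real y ^ (2 * (?m + 1)) / (of_real u ^ (2 * ?m) * of_real (u\<^sup>2 + y\<^sup>2)))) = ?e * ?Z u"
    proof -
      have "U * P * Kk * (o1 * (Y / (U * D))) = o1 * Y * (P * Kk / D)" if "U \<noteq> 0" for U P Kk o1 Y D :: complex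
        using that by simp
      then show ?thesis using up unfolding ex[of ?m] w_def[symmetric] by simp
    qed
    show ?thesis unfolding expand t1 t2 ..
  qed
  have pos: "Re (s - 2 * of_nat j) > 0" if "j \<le> ?m" for j
  proof -
    have "real j \<le> real (m1 s)" using that by simp
    then show ?thesis using w_bounds(1) by (simp add: w_def)
  qed
  have "((\<lambda>u. (\<Sum>j=1..?m. ?b j * ?X j u) + ?e * ?Z u) has_integral
     (\<Sum>j=1..?m. ?b j * integral {0<..} (?X j)) + ?e * integral {0<..} ?Z) {0<..}"
    using y by (intro has_integral_add has_integral_sum has_integral_mult_right abs_int_imp_has_integral
       Stieltjes_absolutely_integrable Mellin_K_absolutely_integrable pos) auto
  then have "integral {0<..} (\<lambda>u. (\<Sum>j=1..?m. ?b j * ?X j u) + ?e * ?Z u) =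
     (\<Sum>j=1..?m. ?b j * integral {0<..} (?X j)) + ?e * integral {0<..} ?Z" by (rule integral_unique)
  moreover have "integral {0<..} (\<lambda>u. of_real u powr (s - 1) * K (of_real u) * of_real (y\<^sup>2 / (y\<^sup>2 + u\<^sup>2))) =
     integral {0<..} (\<lambda>u. (\<Sum>j=1..?m. ?b j * ?X j u) + ?e * ?Z u)"
    by (rule integral_cong[OF pt])
  ultimately have "I y = (\<Sum>j=1..?m. ?b j * (2 powr (s - 1) * integral {0<..} (?X j))) + 2 powr (s - 1) * (?e * integral {0<..} ?Z)"
    unfolding I_def by (simp only: distrib_left sum_distrib_left mult.left_commute)
  also have "(\<Sum>j=1..?m. ?b j * (2 powr (s - 1) * integral {0<..} (?X j))) = (\<Sum>j=1..?m. a j * (2 * of_real y) ^ (2 * j))"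
  proof (rule sum.cong[OF refl])
    fix j assume "j \<in> {1..?m}"
    then have "j \<le> m1 s" by simp
    from moment_eq[OF this] show "?b j * (2 powr (s - 1) * integral {0<..} (?X j)) = a j * (2 * of_real y) ^ (2 * j)"
      by (simp only: a_def power_mult_distrib mult_ac)
  qed
  finally show ?thesis by (simp only: mult.assoc)
qed

text \<open>The full series converges, so its sum may be read off along the block ends M q, where
  the Stieltjes formula gives the limit; indices outside \<open>N\<close> contribute 0 there. The
  sign (-1)^\<open>m1 s\<close> is the ratio of \<open>Wphase s\<close> to
  \<open>Wphase w\<close>.\<close>

lemma sin_quotient_series_eq:
  assumes y: "y > 0" "sin y \<noteq> 0"
  shows "(\<Sum>\<^sub>\<infinity>n\<in>N. c n * sin_quotient n (of_real y)) =
     of_real (sin y) * (- 1) ^ m1 s * (sin (of_real pi * w) / (2 * of_real pi) *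
       (integral {0<..} (\<lambda>u. of_real u powr (w - 1) * K (of_real u) / of_real (u\<^sup>2 + y\<^sup>2)) +
        of_real pi * of_real y powr (w - 2) / (2 * of_real (sin y)) *
         ((\<Sum>l=1..q-1. chi (int l) * of_real (cos ((1 - 2 * real l / real q) * y))) / cos (of_real pi * w / 2)
          - (\<Sum>l=1..q-1. chi (int l) * of_real (sin ((1 - 2 * real l / real q) * y))) / sin (of_real pi * w / 2))))"
    (is "?G = ?\<sigma> * ?e * ?L")
proof -
  let ?A = "\<lambda>n. of_real (pi * real n) powr (w - 1) * Wphase w n / of_real (y\<^sup>2 - (pi * real n)\<^sup>2)"
  have eq: "(if n \<in> N then c n * sin_quotient n (of_real y) else 0) = ?\<sigma> * ?e * ?A n" for n
  proof (cases "n \<in> N")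
    case True
    then have n: "n \<ge> 1" by (rule N_ge_1)
    have "y\<^sup>2 \<noteq> (pi * real n)\<^sup>2" using y_neq_pi[OF y w_bounds, of n] y(1) by (simp add: power2_eq_iff_nonneg)
    moreover have e: "(complex_of_real y)\<^sup>2 = of_real (y\<^sup>2)" "(of_real pi * of_nat n)\<^sup>2 = complex_of_real ((pi * real n)\<^sup>2)" by simp_all
    ultimately have "sin_quotient n (of_real y) = ?\<sigma> / of_real (y\<^sup>2 - (pi * real n)\<^sup>2)"
      unfolding sin_quotient_eq(1)[OF n] e of_real_eq_iff sin_of_real of_real_diff[symmetric] by (simp only: if_False)
    then show ?thesis using True by (simp add: c_def Wphase_s)
  next
    case False
    then have "n = 0 \<or> int n \<in> E_set q chi" by (auto simp: N_def not_less_eq_eq)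
    then have "Wphase w n = 0" using Wphase_0 Wphase_E_set by auto
    then show ?thesis using False by simp
  qed
  have "(\<lambda>k. \<Sum>n<k. ?\<sigma> * ?e * ?A n) \<longlonglongrightarrow> ?G"
  proof -
    have "(\<lambda>n. if n \<in> N then c n * sin_quotient n (of_real y) else 0) sums ?G"
      by (rule sin_quotient_series(1)[OF N_ge_1 c_summable])
    then show ?thesis unfolding eq sums_def .
  qed
  moreover have "filterlim (\<lambda>M. M * q) at_top sequentially"
    using q by (intro filterlim_subseq strict_monoI) auto
  ultimately have "(\<lambda>M. \<Sum>n<M*q. ?\<sigma> * ?e * ?A n) \<longlonglongrightarrow> ?G" by (rule filterlim_compose)
  moreover have "(\<lambda>M. ?\<sigma> * ?e * (\<Sum>n<M*q. ?A n)) \<longlonglongrightarrow> ?\<sigma> * ?e * ?L"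
    by (intro tendsto_mult tendsto_const Stieltjes_K_series y w_bounds)
  ultimately show ?thesis unfolding sum_distrib_left[symmetric] by (rule LIMSEQ_unique)
qed

text \<open>In the evaluated series the y^(w - 2) part, multiplied by y^(2 (\<open>m1 s\<close> +
  1)), becomes the power y^s and cancels phi exactly. What remains is the polynomial part and the
  Stieltjes integral, that is, the expansion of \<open>I\<close>.\<close>

lemma phi_minus_gamma_pos:
  assumes y: "y > 0" "sin y \<noteq> 0"
  shows "phi_fun s q chi y - gamma_fun s q chi (of_real y) = of_real (sin y) * I y"
proof -
  let ?P = "\<Sum>j=1..m1 s. a j * (2 * complex_of_real y) ^ (2 * j)"
  let ?X = "integral {0<..} (\<lambda>u. of_real u powr (w - 1) * K (of_real u) / of_real (u\<^sup>2 + y\<^sup>2))"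
  let ?C = "\<Sum>l=1..q-1. chi (int l) * complex_of_real (cos ((1 - 2 * real l / real q) * y))"
  let ?S = "\<Sum>l=1..q-1. chi (int l) * complex_of_real (sin ((1 - 2 * real l / real q) * y))"
  have neg: "(2 * real l / real q - 1) * y = - ((1 - 2 * real l / real q) * y)" for l by (simp add: algebra_simps)
  have S: "(\<Sum>l=1..q-1. chi (int l) * complex_of_real (sin ((2 * real l / real q - 1) * y))) = - ?S"
    unfolding neg sin_minus of_real_minus mult_minus_right sum_negf ..
  have C: "(\<Sum>l=1..q-1. chi (int l) * complex_of_real (cos ((2 * real l / real q - 1) * y))) = ?C"
    unfolding neg cos_minus ..
  have ys: "complex_of_real y powr s = of_real y powr (w - 2) * of_real y ^ (2 * (m1 s + 1))"
  proof -
    have "complex_of_real y ^ (2 * (m1 s + 1)) = of_real y powr (of_nat (2 * (m1 s + 1)))"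
      by (rule powr_nat'[symmetric]) (use y in simp)
    moreover have "s = w - 2 + of_nat (2 * (m1 s + 1))" by (simp add: w_def)
    ultimately show ?thesis by (metis powr_add)
  qed
  have abs: "\<bar>y\<bar> = y" "complex_of_real (sgn y) = 1" using y by auto
  \<comment> \<open>Pure field arithmetic. \<open>e\<close> stands for (-1)^\<open>m1 s\<close>,
    \<open>W\<close> and \<open>V\<close> for the two factors of y^s, \<open>Z\<close> for 2^(s -
    2), \<open>t\<close> and \<open>k\<close> for the sine and cosine of pi w / 2, \<open>X\<close>
    for the Stieltjes integral.\<close>
  have alg: "- p * Z * (W * V * (- S) / (e * t) + W * V * 1 * C / (e * k)) - - (\<sigma> * P + p * (2 * (2 * Z)) / sw * V *
       (\<sigma> * e * (sw / (2 * p) * (X + p * W / (2 * \<sigma>) * (C / k - S / t)))))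
     = \<sigma> * (P + 2 * Z * e * V * X)"
    if nz: "t \<noteq> 0" "k \<noteq> 0" "sw \<noteq> 0" "p \<noteq> 0" "\<sigma> \<noteq> 0" and ee: "e * e = 1" for p Z W V S e t C k \<sigma> P sw X :: complex
  proof -
    have e0: "e \<noteq> 0" using ee by auto
    have inv: "1 / e = e" using ee e0 by (simp add: field_simps)
    have 1: "- p * Z * (W * V * (- S) / (e * t) + W * V * 1 * C / (e * k)) = - (p * Z * W * V * (1 / e) * (C / k - S / t))"
      using e0 nz by (simp add: field_simps)
    have 2: "p * (2 * (2 * Z)) / sw * V * (\<sigma> * e * (sw / (2 * p) * (X + p * W / (2 * \<sigma>) * R))) =
        2 * Z * V * \<sigma> * e * X + p * Z * V * W * e * R" for R
      using nz by (simp add: field_simps)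
    show ?thesis unfolding 1 2 inv by (simp add: algebra_simps)
  qed
  have ee: "(- 1) ^ m1 s * (- 1) ^ m1 s = (1 :: complex)" by (simp flip: power_mult_distrib)
  have sw: "sin (of_real pi * w) \<noteq> 0" using sin_pi_s_nonzero sin_pi_s_eq by simp
  have \<sigma>: "complex_of_real (sin y) \<noteq> 0" using y by simp
  show ?thesis
    unfolding phi_fun_def gamma_fun_eq sin_quotient_series_eq[OF y] I_eq[OF y(1)] S C abs ys sin_cos_half_s
      \<kappa>_def two_powr_s sin_pi_s_eq sin_of_real
    by (rule alg[OF trig_half_w_nonzero sw _ \<sigma> ee]) simp
qed

lemma I_minus: "I (- y) = I y"
  by (simp add: I_def)

text \<open>phi, gamma and sin are odd and \<open>I\<close> is even, which extends the identity to
  negative y.\<close>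

lemma phi_minus_gamma:
  assumes "sin y \<noteq> 0"
  shows "phi_fun s q chi y - gamma_fun s q chi (of_real y) = of_real (sin y) * I y"
proof (cases "y > 0")
  case False
  have "y \<noteq> 0" using assms by auto
  with False have "- y > 0" by simp
  moreover have "sin (- y) \<noteq> 0" using assms by simp
  ultimately have "phi_fun s q chi (- y) - gamma_fun s q chi (of_real (- y)) = of_real (sin (- y)) * I (- y)"
    by (rule phi_minus_gamma_pos)
  then show ?thesis
    unfolding phi_fun_minus of_real_minus gamma_fun_minus I_minus sin_minus by (simp add: algebra_simps)
qed (rule phi_minus_gamma_pos[OF _ assms])

text \<open>The integral identity was derived off the zeros of sin; at a node phi and gamma are
  compared through their common explicit value.\<close>

lemma phi_minus_gamma_at_zero_of_sin:
  assumes "sin y = 0"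
  shows "phi_fun s q chi y - gamma_fun s q chi (of_real y) = 0"
proof -
  obtain k :: int where k: "y = pi * of_int k"
    using assms by (metis mult.commute sin_zero_iff_int2)
  show ?thesis
  proof (cases "k = 0")
    case True
    then show ?thesis using k by (simp add: phi_fun_0 gamma_fun_0)
  next
    case False
    then show ?thesis using gamma_fun_at_node[OF False] phi_fun_at_node[OF False] unfolding k by simp
  qed
qed

section \<open>Boundedness and the limit at infinity\<close>

lemma I_integrand:
  assumes y: "y \<noteq> 0"
  defines "f \<equiv> \<lambda>u. of_real u powr (s - 1) * K (of_real u) * complex_of_real (y\<^sup>2 / (y\<^sup>2 + u\<^sup>2))"
  shows "f integrable_on {0<..}" and "\<And>u. norm (f u) \<le> norm (of_real u powr (s - 1) * K (of_real u))"
proof -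
  show b: "norm (f u) \<le> norm (of_real u powr (s - 1) * K (of_real u))" for u
  proof -
    have "0 \<le> y\<^sup>2 / (y\<^sup>2 + u\<^sup>2)" "y\<^sup>2 / (y\<^sup>2 + u\<^sup>2) \<le> 1" using y by (simp_all add: divide_le_eq_1_pos add_pos_nonneg)
    then have "norm (of_real u powr (s - 1) * K (of_real u)) * \<bar>y\<^sup>2 / (y\<^sup>2 + u\<^sup>2)\<bar> \<le> norm (of_real u powr (s - 1) * K (of_real u)) * 1"
      by (intro mult_left_mono) auto
    then show ?thesis unfolding f_def by (simp only: norm_mult norm_of_real mult_1_right)
  qed
  have "f absolutely_integrable_on {0<..}"
  proof (rule integral_Ioi_bound[where g = "\<lambda>u. norm (of_real u powr (s - 1) * K (of_real u))"])
    have ne: "y\<^sup>2 + u\<^sup>2 \<noteq> 0" for u using y by (auto simp: add_nonneg_eq_0_iff)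
    show "continuous_on {0<..} f" unfolding f_def
      by (intro continuous_on_mult continuous_on_powr_of_real continuous_on_K continuous_on_of_real continuous_on_divide continuous_intros ballI ne)
    show "(\<lambda>u. norm (of_real u powr (s - 1) * K (of_real u))) integrable_on {0<..}"
      using Mellin_K_absolutely_integrable[OF s0] by (simp add: absolutely_integrable_on_def)
  qed (rule b)
  then show "f integrable_on {0<..}" using abs_int_imp_has_integral by blast
qed

lemma norm_I_le:
  assumes "y \<noteq> 0"
  shows "cmod (I y) \<le> cmod (2 powr (s - 1)) * integral {0<..} (\<lambda>u. norm (of_real u powr (s - 1) * K (of_real u)))"
  unfolding I_def norm_mult
proof (intro mult_left_mono integral_norm_bound_integral I_integrand[OF assms])
  show "(\<lambda>u. cmod (of_real u powr (s - 1)) * cmod (K (of_real u))) integrable_on {0<..}"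
    using Mellin_K_absolutely_integrable[OF s0] by (simp add: absolutely_integrable_on_def norm_mult)
  show "norm (of_real u powr (s - 1) * K (of_real u) * complex_of_real (y\<^sup>2 / (y\<^sup>2 + u\<^sup>2))) \<le>
     cmod (of_real u powr (s - 1)) * cmod (K (of_real u))" for u
    using I_integrand(2)[OF assms, of u] unfolding norm_mult .
qed auto

lemma I_tendsto_at_top: "(I \<longlongrightarrow> of_nat q powr s * Gamma s * dirichlet_L chi s) at_top"
proof (rule tendsto_at_topI_sequentially)
  fix X :: "nat \<Rightarrow> real" assume X: "filterlim X at_top sequentially"
  then have "\<forall>\<^sub>F n in sequentially. X n > 0" by (simp add: filterlim_at_top_dense)
  \<comment> \<open>Dominated convergence runs along a sequence; dropping an initial segment keeps
    its members nonzero, as \<open>I_integrand\<close> requires.\<close>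
  then obtain n0 where n0: "\<And>n. n \<ge> n0 \<Longrightarrow> X n > 0" by (auto simp: eventually_sequentially)
  let ?f = "\<lambda>n u. of_real u powr (s - 1) * K (of_real u) * complex_of_real ((X (n + n0))\<^sup>2 / ((X (n + n0))\<^sup>2 + u\<^sup>2))"
  have ne: "X (n + n0) \<noteq> 0" for n using n0[of "n + n0"] by simp
  have "(\<lambda>n. integral {0<..} (?f n)) \<longlonglongrightarrow> integral {0<..} (\<lambda>u. of_real u powr (s - 1) * K (of_real u))"
  proof (rule dominated_convergence(2)[where h = "\<lambda>u. norm (of_real u powr (s - 1) * K (of_real u))"])
    show "?f n integrable_on {0<..}" for n by (rule I_integrand(1)[OF ne])
    show "(\<lambda>u. norm (of_real u powr (s - 1) * K (of_real u))) integrable_on {0<..}"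
      using Mellin_K_absolutely_integrable[OF s0] by (simp add: absolutely_integrable_on_def)
    show "norm (?f n u) \<le> norm (of_real u powr (s - 1) * K (of_real u))" for n u by (rule I_integrand(2)[OF ne])
    fix u :: real assume "u \<in> {0<..}"
    then have u: "u > 0" by simp
    have "((\<lambda>y. y\<^sup>2 / (y\<^sup>2 + u\<^sup>2)) \<longlongrightarrow> 1) at_top" by real_asymp
    then have "(\<lambda>n. (X n)\<^sup>2 / ((X n)\<^sup>2 + u\<^sup>2)) \<longlonglongrightarrow> 1" using X by (rule filterlim_compose)
    then have "(\<lambda>n. (X (n + n0))\<^sup>2 / ((X (n + n0))\<^sup>2 + u\<^sup>2)) \<longlonglongrightarrow> 1" by (rule LIMSEQ_ignore_initial_segment)
    then have "(\<lambda>n. ?f n u) \<longlonglongrightarrow> of_real u powr (s - 1) * K (of_real u) * of_real 1"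
      by (intro tendsto_intros)
    then show "(\<lambda>n. ?f n u) \<longlonglongrightarrow> of_real u powr (s - 1) * K (of_real u)" by simp
  qed
  then have "(\<lambda>n. I (X (n + n0))) \<longlonglongrightarrow> of_nat q powr s * Gamma s * dirichlet_L chi s"
    unfolding I_def moment_0[symmetric] by (rule tendsto_mult_left)
  then show "(\<lambda>n. I (X n)) \<longlonglongrightarrow> of_nat q powr s * Gamma s * dirichlet_L chi s"
    by (rule LIMSEQ_offset)
qed

lemma I_tendsto_at_infinity: "(I \<longlongrightarrow> of_nat q powr s * Gamma s * dirichlet_L chi s) at_infinity"
proof -
  have "(I \<longlongrightarrow> of_nat q powr s * Gamma s * dirichlet_L chi s) at_bot"
    using I_tendsto_at_top unfolding filterlim_at_bot_mirror I_minus .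
  with I_tendsto_at_top show ?thesis
    unfolding at_infinity_eq_at_top_bot by (intro filterlim_sup)
qed

lemma phi_minus_gamma_L_infinity: "in_L_infinity (\<lambda>y. phi_fun s q chi y - gamma_fun s q chi (of_real y))"
  unfolding in_L_infinity_def
proof
  \<comment> \<open>At y = 0 the default value 0 of \<open>powr\<close> agrees with the convention
    0^s = 0; elsewhere the exponential form makes measurability automatic.\<close>
  have powr_eq: "complex_of_real \<bar>y\<bar> powr s = (if y = 0 then 0 else exp (s * of_real (ln \<bar>y\<bar>)))" for y
    by (simp add: powr_def Ln_of_real)
  have "phi_fun s q chi \<in> borel_measurable borel"
    unfolding phi_fun_def[abs_def] powr_eq by measurable
  moreover have "(\<lambda>y. gamma_fun s q chi (of_real y)) \<in> borel_measurable borel"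
    by (intro borel_measurable_continuous_onI continuous_on_compose2[OF holomorphic_on_imp_continuous_on[OF gamma_fun_holomorphic]] continuous_intros) auto
  ultimately have "(\<lambda>y. phi_fun s q chi y - gamma_fun s q chi (of_real y)) \<in> borel_measurable lborel" by simp
  then show "(\<lambda>y. phi_fun s q chi y - gamma_fun s q chi (of_real y)) \<in> borel_measurable lebesgue"
    by (rule measurable_completion)
  let ?B = "cmod (2 powr (s - 1)) * integral {0<..} (\<lambda>u. norm (of_real u powr (s - 1) * K (of_real u)))"
  have "norm (phi_fun s q chi y - gamma_fun s q chi (of_real y)) \<le> \<bar>?B\<bar>" for y
  proof (cases "sin y = 0")
    case True
    then show ?thesis using phi_minus_gamma_at_zero_of_sin[OF True] by simp
  next
    case False
    then have "y \<noteq> 0" by auto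
    have "norm (phi_fun s q chi y - gamma_fun s q chi (of_real y)) = \<bar>sin y\<bar> * cmod (I y)"
      unfolding phi_minus_gamma[OF False] by (simp add: norm_mult)
    also have "\<dots> \<le> 1 * ?B"
      using norm_I_le[OF \<open>y \<noteq> 0\<close>] by (intro mult_mono) auto
    finally show ?thesis by linarith
  qed
  then show "\<exists>C. AE y in lebesgue. norm (phi_fun s q chi y - gamma_fun s q chi (of_real y)) \<le> C"
    by (intro exI[of _ "\<bar>?B\<bar>"] AE_I2)
qed

lemma phi_eq_gamma_at_nodes: "phi_fun s q chi (pi * of_int k) = gamma_fun s q chi (of_real (pi * of_int k))"
  using phi_minus_gamma_at_zero_of_sin[of "pi * of_int k"] sin_integer_2pi
  by (simp add: sin_zero_iff_int2 mult.commute)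

lemma gamma_fun_admissible: "admissible_interpolant s q chi (gamma_fun s q chi)"
  unfolding admissible_interpolant_def
  using gamma_fun_holomorphic gamma_fun_exponential_type phi_eq_gamma_at_nodes phi_minus_gamma_L_infinity gamma_fun_deriv_0
  by simp

lemma gamma_fun_E_set:
  assumes "k \<in> E_set q chi"
  shows "gamma_fun s q chi (of_real (pi * of_int k)) = 0"
proof (cases "k = 0")
  case False
  have "Wphase s (nat \<bar>k\<bar>) = 0" using assms E_set_nat_abs Wphase_E_set by blast
  then show ?thesis unfolding gamma_fun_at_node[OF False] by (simp add: node_value_def)
qed (simp add: gamma_fun_0)

lemma gamma_fun_not_E_set:
  assumes "\<bar>k\<bar> \<ge> 1"
  shows "gamma_fun s q chi (of_real (pi * of_int k)) =
     - (of_real pi * 2 powr (s - 1) * (- 1) powi k * of_real (pi * of_int \<bar>k\<bar>) powr s / sin (of_real pi * s)) *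
       (\<Sum>l = 1..q - 1. chi (int l) *
          sin (2 * of_real pi * of_int k * of_nat l / of_nat q + of_real pi * s / 2 * of_int (sgn k)))"
proof -
  have "k \<noteq> 0" using assms by auto
  from Wphase_eq_sum_sgn[OF this] gamma_fun_at_node[OF this] show ?thesis
    by (simp only: node_value_def)
qed

text \<open>The filter lets |y| tend to infinity through the points with sin y \<noteq> 0, and there
  the quotient is \<open>I y\<close>.\<close>

lemma phi_minus_gamma_quotient_tendsto:
  "((\<lambda>y. (phi_fun s q chi y - gamma_fun s q chi (of_real y)) / of_real (sin y))
     \<longlongrightarrow> of_nat q powr s * Gamma s * dirichlet_L chi s) (inf at_infinity (principal {y. sin y \<noteq> 0}))"
proof (rule Lim_transform_eventually)
  show "(I \<longlongrightarrow> of_nat q powr s * Gamma s * dirichlet_L chi s) (inf at_infinity (principal {y. sin y \<noteq> 0}))"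
    using I_tendsto_at_infinity by (rule tendsto_mono[rotated]) simp
  show "\<forall>\<^sub>F y in inf at_infinity (principal {y. sin y \<noteq> 0}).
      I y = (phi_fun s q chi y - gamma_fun s q chi (of_real y)) / of_real (sin y)"
    unfolding eventually_inf_principal by (auto simp: phi_minus_gamma)
qed

lemma q_powr_Gamma_nonzero: "of_nat q powr s * Gamma s \<noteq> 0"
  using q s0 by (auto simp: Gamma_eq_zero_iff elim!: nonpos_Ints_cases')

end

theorem theorem2p8:
  fixes q :: nat and chi :: "int \<Rightarrow> complex" and s :: complex
  assumes "q > 1"
    and "dirichlet_character q chi" and "\<not> principal_character q chi"
    and "Re s > 0"
    and "\<forall>k::nat. k \<ge> 1 \<longrightarrow> Re s \<noteq> 2 * real k"
    and "\<forall>n::nat. n \<ge> 1 \<longrightarrow> s \<noteq> of_nat n"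
  shows "(admissible_interpolant s q chi (gamma_fun s q chi) \<and>
          (\<forall>g. admissible_interpolant s q chi g \<longrightarrow> g = gamma_fun s q chi)) \<and>
         (\<forall>n::int.
            phi_fun s q chi (pi * of_int n) = gamma_fun s q chi (of_real (pi * of_int n)) \<and>
            (n \<in> E_set q chi \<longrightarrow> gamma_fun s q chi (of_real (pi * of_int n)) = 0) \<and>
            (\<bar>n\<bar> \<ge> 1 \<and> n \<notin> E_set q chi \<longrightarrow>
               gamma_fun s q chi (of_real (pi * of_int n)) =
                 - (of_real pi * 2 powr (s - 1) * (- 1) powi n * of_real (pi * of_int \<bar>n\<bar>) powr s
                      / sin (of_real pi * s)) *
                 (\<Sum>l = 1..q - 1. chi (int l) *
                    sin (2 * of_real pi * of_int n * of_nat l / of_nat q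
                         + of_real pi * s / 2 * of_int (sgn n))))) \<and>
         (\<exists>\<Lambda>. ((\<lambda>y::real. (phi_fun s q chi y - gamma_fun s q chi (of_real y)) / of_real (sin y))
                 \<longlongrightarrow> \<Lambda>) (inf at_infinity (principal {y. sin y \<noteq> 0})) \<and>
              dirichlet_L chi s = 1 / (of_nat q powr s * Gamma s) * \<Lambda>)"
proof -
  interpret nonprincipal_setup q chi s
    using assms by unfold_locales auto
  show ?thesis
  proof (intro conjI allI impI)
    show "admissible_interpolant s q chi (gamma_fun s q chi)" by (rule gamma_fun_admissible)
    show "g = gamma_fun s q chi" if "admissible_interpolant s q chi g" for g
      using that gamma_fun_admissible by (rule admissible_interpolant_unique)
    show "\<exists>\<Lambda>. ((\<lambda>y::real. (phi_fun s q chi y - gamma_fun s q chi (of_real y)) / of_real (sin y))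
                 \<longlongrightarrow> \<Lambda>) (inf at_infinity (principal {y. sin y \<noteq> 0})) \<and>
              dirichlet_L chi s = 1 / (of_nat q powr s * Gamma s) * \<Lambda>"
      using phi_minus_gamma_quotient_tendsto q_powr_Gamma_nonzero
      by (intro exI[of _ "of_nat q powr s * Gamma s * dirichlet_L chi s"]) auto
  qed (use phi_eq_gamma_at_nodes gamma_fun_E_set gamma_fun_not_E_set in auto)
qed

end
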